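(* Let $\ell \geqslant 1$ be a real number and let $f:\mathbb{Z}_{\geqslant 1}\to\mathbb{R}_{\geqslant 0}$ be an arithmetic function such that there exists $k \in \mathbb{Z}_{\geqslant 1}$ with $f(mn) \leqslant \tau_k(m) f(n)$ for all $(m,n)\in(\mathbb{Z}_{\geqslant 1})^2$. Then, uniformly for all real $x \geqslant \exp\left(7^{28}(12e\ell)^{28\log(192e\ell)}\right)$ and all real $y$ with $x^{1/\ell}\leqslant y\leqslant x$, we have $$\sum_{x-y<n\leqslant x} f(n) \leqslant \Lambda(k,\ell)\,\frac{y}{\log x}\sum_{n\leqslant x}\frac{f(n)}{n},$$ where $\Lambda(k,\ell) := 12\ell k^{6\ell} + 5\ell C_{k,\ell} + 9\ell D_{k,\ell}$, with $C_{k,\ell} := (10\ell(k-1))^{k^{16\ell}(k-1)}$, $D_{k,\ell} := A_k\max\left(A_k, 2k^{5\ell A_k}\right) + (2A_k)^{-A_k/4} e^{B_{k,\ell}/e} k^{5\ell B_{k,\ell}}\,\delta_{\{A_k<B_{k,\ell}\}} + 5$, $A_k := 125^k \cdot \frac{1092}{k^3}$, $B_{k,\ell} := \frac12 e^{4/e}k^{20\ell}$, and $\delta_{\{A_k<B_{k,\ell}\}}=1$ if $A_k<B_{k,\ell}$ and $0$ otherwise.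
   Context: $\tau_k(n)$ denotes the $k$-fold Dirichlet–Piltz divisor function, i.e. the number of ordered $k$-tuples $(d_1,\dots,d_k)$ of positive integers with $d_1\cdots d_k=n$. Sums over $n$ run over positive integers. *)

theory Defs
  imports "HOL-Analysis.Analysis"
begin

definition tau :: "nat \<Rightarrow> nat \<Rightarrow> nat" where
  "tau k n = card {ds :: nat list. length ds = k \<and> (\<forall>d\<in>set ds. d \<ge> 1) \<and> prod_list ds = n}"

definition A_const :: "nat \<Rightarrow> real" where
  "A_const k = 125 ^ k * (1092 / real k ^ 3)"

definition B_const :: "nat \<Rightarrow> real \<Rightarrow> real" where
  "B_const k l = (1/2) * exp (4 / exp 1) * real k powr (20 * l)"

definition C_const :: "nat \<Rightarrow> real \<Rightarrow> real" where
  "C_const k l = (if k = 1 then 1 else (10 * l * (real k - 1)) powr (real k powr (16 * l) * (real k - 1)))"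

definition D_const :: "nat \<Rightarrow> real \<Rightarrow> real" where
  "D_const k l = A_const k * max (A_const k) (2 * real k powr (5 * l * A_const k))
     + (2 * A_const k) powr (- A_const k / 4) * exp (B_const k l / exp 1)
         * real k powr (5 * l * B_const k l) * (if A_const k < B_const k l then 1 else 0)
     + 5"

definition Lambda_const :: "nat \<Rightarrow> real \<Rightarrow> real" where
  "Lambda_const k l = 12 * l * real k powr (6 * l) + 5 * l * C_const k l + 9 * l * D_const k l"

end

theory Submission
  imports Defs "HOL-Computational_Algebra.Squarefree"
begin

text \<open>Put \<open>z = y\<^sup>1\<^sup>/\<^sup>3\<close> and write each \<open>n\<close> in the interval as \<open>n = a b\<close>, where \<open>a \<le> z\<close> is the longest
  product of full prime powers of \<open>n\<close>, taken in increasing order of the primes, that does not exceed \<open>z\<close>;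
  let \<open>q\<close> be the least prime of \<open>b\<close>. If \<open>q > \<surd>z\<close>, then \<open>b\<close> has \<open>O(l)\<close> prime factors, so \<open>f n\<close> is at most
  a bounded multiple of \<open>f a\<close>, and a sieve bounds the number of admissible \<open>b\<close>. If \<open>q \<le> \<surd>z\<close> and
  \<open>a \<le> \<surd>z\<close>, then \<open>n\<close> is divisible by a large power of a small prime, and if \<open>a > \<surd>z\<close> and \<open>q \<le> ln z\<close>,
  then \<open>n\<close> has a large very smooth divisor; such \<open>n\<close> are so rare that \<open>f n \<le> C f 1 n\<^sup>1\<^sup>/\<^sup>1\<^sup>6\<^sup>l\<close> suffices.
  In the remaining case \<open>z\<^sup>1\<^sup>/\<^sup>(\<^sup>r\<^sup>+\<^sup>1\<^sup>) < q \<le> z\<^sup>1\<^sup>/\<^sup>r\<close> with \<open>r \<ge> 2\<close> and \<open>a > \<surd>z\<close>: the loss \<open>k\<^sup>3\<^sup>l\<^sup>(\<^sup>r\<^sup>+\<^sup>1\<^sup>)\<close> from the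
  prime factors of \<open>b\<close> is beaten by the gain of about \<open>r\<^sup>-\<^sup>r\<^sup>/\<^sup>5\<close> that Rankin's trick extracts from the
  smoothness of \<open>a\<close>.\<close>

section \<open>Divisor functions at prime powers\<close>

text \<open>The exponents are dictated by the sieve and by the prescribed constants. A cofactor
  \<open>b\<close> ranges over an interval of length \<open>y / a\<close>, at least y^(2/3), and the
  elementary sieve used here has error \<open>Q ^ 4\<close>: hence the cube root in
  \<open>z\<close>, and hence \<open>b\<close> is sieved only up to y^(1/m) with
  \<open>m \<ge> 9\<close>. For \<open>n \<le> x\<close> the exponent \<open>1 / (16 * l)\<close>
  costs at most y^(1/16), just less than the y^(1/15) that Rankin's trick with exponent 2/5 saves on
  smooth divisors above \<open>sqrt z\<close>; and 16 is also the exponent inside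
  \<open>C_const\<close>, so this pointwise bound is affordable. The same 16 serves the sum over
  \<open>r\<close>: k^(3l(r+1)) and r^(-r/5) balance near r = k^(15l), and passing from 15 to 16
  pays for all lower-order terms. Since \<open>f\<close> need not be multiplicative, its sums over
  smooth integers have no Euler product. Every estimate therefore compares a finite sum with the
  full sum of \<open>f n / n\<close>, and the hypothesis is only ever applied with \<open>m\<close>
  a prime power.\<close>

lemma finite_factor_lists:
  assumes "n \<ge> 1"
  shows "finite {ds :: nat list. length ds = k \<and> (\<forall>d\<in>set ds. d \<ge> 1) \<and> prod_list ds = n}"
proof (rule finite_subset)
  show "{ds :: nat list. length ds = k \<and> (\<forall>d\<in>set ds. d \<ge> 1) \<and> prod_list ds = n}
      \<subseteq> {ds. set ds \<subseteq> {..n} \<and> length ds = k}"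
  proof safe
    fix ds :: "nat list" and d
    assume "d \<in> set ds" "n = prod_list ds"
    then have "d dvd n" by (simp add: prod_list_dvd)
    then show "d \<le> prod_list ds" using assms \<open>n = _\<close> by (auto dest: dvd_imp_le)
  qed
qed (rule finite_lists_length_eq, simp)

lemma tau_0_prime_power: "prime p \<Longrightarrow> tau 0 (p ^ j) = (if j = 0 then 1 else 0)"
proof -
  assume p: "prime p"
  have "{ds :: nat list. length ds = 0 \<and> (\<forall>d\<in>set ds. d \<ge> 1) \<and> prod_list ds = p ^ j}
      = (if j = 0 then {[]} else {})"
    using prime_gt_1_nat[OF p] by (auto simp: nat_power_eq_Suc_0_iff dest!: sym[of "Suc 0"])
  then show ?thesis unfolding tau_def by simp
qed

text \<open>The first entry of a list is some \<open>p ^ (j - i)\<close> and the remaining entries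
  form a list for \<open>p ^ i\<close>. This recursion in \<open>k\<close> drives the three bounds
  that follow.\<close>

lemma tau_Suc_prime_power_le:
  assumes p: "prime (p :: nat)"
  shows "tau (Suc k) (p ^ j) \<le> (\<Sum>i\<le>j. tau k (p ^ i))"
proof -
  define L where "L k n = {ds :: nat list. length ds = k \<and> (\<forall>d\<in>set ds. d \<ge> 1) \<and> prod_list ds = n}" for k n
  have fin: "finite (L k (p ^ i))" for i
    unfolding L_def using p by (intro finite_factor_lists) (simp add: prime_gt_0_nat Suc_leI)
  have "L (Suc k) (p ^ j) \<subseteq> (\<Union>i\<le>j. (#) (p ^ (j - i)) ` L k (p ^ i))"
  proof
    fix ds assume ds: "ds \<in> L (Suc k) (p ^ j)"
    then obtain e es where es: "ds = e # es" by (cases ds) (auto simp: L_def)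
    have prod: "e * prod_list es = p ^ j" using ds es by (simp add: L_def)
    then have "e dvd p ^ j" "prod_list es dvd p ^ j" by (metis dvd_triv_left, metis dvd_triv_right)
    then obtain a i where ai: "e = p ^ a" "prod_list es = p ^ i" "i \<le> j"
      using p by (metis divides_primepow_nat)
    have "p ^ (a + i) = p ^ j" using prod ai by (simp add: power_add)
    then have "a = j - i" using p
      by (metis add_diff_cancel_right' power_inject_exp prime_gt_1_nat)
    then show "ds \<in> (\<Union>i\<le>j. (#) (p ^ (j - i)) ` L k (p ^ i))"
      using ds es ai by (auto simp: L_def)
  qed
  then have "card (L (Suc k) (p ^ j)) \<le> card (\<Union>i\<le>j. (#) (p ^ (j - i)) ` L k (p ^ i))"
    by (intro card_mono) (auto simp: fin)
  also have "\<dots> \<le> (\<Sum>i\<le>j. card ((#) (p ^ (j - i)) ` L k (p ^ i)))"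
    by (rule card_UN_le) simp
  also have "\<dots> \<le> (\<Sum>i\<le>j. card (L k (p ^ i)))"
    by (intro sum_mono card_image_le fin)
  finally show ?thesis unfolding tau_def L_def .
qed

text \<open>Meant for large primes, where \<open>k ^ j\<close> is a small power of
  \<open>p ^ j\<close>. The next bound, polynomial in the exponent, is meant for small
  primes.\<close>

lemma tau_prime_power_le_power: "prime p \<Longrightarrow> tau k (p ^ j) \<le> k ^ j"
proof (induction k arbitrary: j)
  case 0
  then show ?case by (simp add: tau_0_prime_power)
next
  case (Suc k)
  have geom: "(\<Sum>i\<le>j. k ^ i) \<le> Suc k ^ j" for j
  proof (induction j)
    case (Suc j)
    have "(\<Sum>i\<le>Suc j. k ^ i) \<le> Suc k ^ j + k * k ^ j" using Suc by simp
    also have "\<dots> \<le> Suc k ^ j + k * Suc k ^ j" by (intro add_mono mult_mono power_mono) auto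
    finally show ?case by simp
  qed simp
  have "tau (Suc k) (p ^ j) \<le> (\<Sum>i\<le>j. tau k (p ^ i))"
    using Suc.prems by (rule tau_Suc_prime_power_le)
  also have "\<dots> \<le> (\<Sum>i\<le>j. k ^ i)" by (intro sum_mono Suc)
  finally show ?case using geom[of j] by linarith
qed

lemma tau_prime_power_le_Suc_power: "prime p \<Longrightarrow> tau (Suc k) (p ^ j) \<le> Suc j ^ k"
proof (induction k arbitrary: j)
  case 0
  have "tau (Suc 0) (p ^ j) \<le> (\<Sum>i\<le>j. tau 0 (p ^ i))"
    using 0 by (rule tau_Suc_prime_power_le)
  also have "\<dots> = 1" using 0 by (simp add: tau_0_prime_power)
  finally show ?case by simp
next
  case (Suc k)
  have "tau (Suc (Suc k)) (p ^ j) \<le> (\<Sum>i\<le>j. tau (Suc k) (p ^ i))"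
    using Suc.prems by (rule tau_Suc_prime_power_le)
  also have "\<dots> \<le> (\<Sum>i\<le>j. Suc j ^ k)"
    using Suc by (intro sum_mono order.trans[OF Suc.IH] power_mono) auto
  finally show ?case by simp
qed

text \<open>The full power series equals \<open>(1 / (1 - s)) ^ k\<close>, because each increase of
  \<open>k\<close> is a Cauchy product with the geometric series. Truncating at \<open>J\<close>
  keeps everything finite.\<close>

lemma sum_tau_prime_power_le:
  fixes s :: real
  assumes p: "prime p" and s: "0 \<le> s" "s < 1"
  shows "(\<Sum>j\<le>J. real (tau k (p ^ j)) * s ^ j) \<le> (1 / (1 - s)) ^ k"
proof (induction k arbitrary: J)
  case 0
  have "(\<Sum>j\<le>J. real (tau 0 (p ^ j)) * s ^ j) = (\<Sum>j\<le>J. if j = 0 then 1 else 0)"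
    by (intro sum.cong) (auto simp: tau_0_prime_power[OF p])
  then show ?case by simp
next
  case (Suc k)
  have "(\<Sum>j\<le>J. real (tau (Suc k) (p ^ j)) * s ^ j)
      \<le> (\<Sum>j\<le>J. \<Sum>i\<le>j. (real (tau k (p ^ i)) * s ^ i) * s ^ (j - i))"
  proof (rule sum_mono)
    fix j
    have "real (tau (Suc k) (p ^ j)) * s ^ j \<le> real (\<Sum>i\<le>j. tau k (p ^ i)) * s ^ j"
      using s tau_Suc_prime_power_le[OF p, of k j] by (intro mult_right_mono) (auto simp del: of_nat_sum)
    also have "\<dots> = (\<Sum>i\<le>j. real (tau k (p ^ i)) * s ^ j)" by (simp add: sum_distrib_right)
    also have "\<dots> = (\<Sum>i\<le>j. (real (tau k (p ^ i)) * s ^ i) * s ^ (j - i))"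
      by (intro sum.cong) (simp_all flip: power_add)
    finally show "real (tau (Suc k) (p ^ j)) * s ^ j \<le> \<dots>" .
  qed
  also have "\<dots> = (\<Sum>(j, i)\<in>(SIGMA j:{..J}. {..j}). (real (tau k (p ^ i)) * s ^ i) * s ^ (j - i))"
    by (rule sum.Sigma) auto
  \<comment> \<open>With \<open>h = j - i\<close> the triangle of pairs is summed in the other
    order, and the inner sum becomes geometric.\<close>
  also have "\<dots> = (\<Sum>(i, h)\<in>(SIGMA i:{..J}. {..J - i}). (real (tau k (p ^ i)) * s ^ i) * s ^ h)"
    by (rule sum.reindex_bij_witness[of _ "\<lambda>(i, h). (i + h, i)" "\<lambda>(j, i). (i, j - i)"]) auto
  also have "\<dots> = (\<Sum>i\<le>J. \<Sum>h\<le>J - i. (real (tau k (p ^ i)) * s ^ i) * s ^ h)"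
    by (rule sum.Sigma[symmetric]) auto
  also have "\<dots> = (\<Sum>i\<le>J. (real (tau k (p ^ i)) * s ^ i) * (\<Sum>h\<le>J - i. s ^ h))"
    by (simp add: sum_distrib_left)
  also have "\<dots> \<le> (\<Sum>i\<le>J. (real (tau k (p ^ i)) * s ^ i) * (1 / (1 - s)))"
  proof (intro sum_mono mult_left_mono)
    fix i
    have "(\<Sum>h\<le>J - i. s ^ h) = (1 - s ^ Suc (J - i)) / (1 - s)"
      using s by (subst sum_gp0) auto
    also have "\<dots> \<le> 1 / (1 - s)" using s by (intro divide_right_mono) auto
    finally show "(\<Sum>h\<le>J - i. s ^ h) \<le> 1 / (1 - s)" .
  qed (use s in auto)
  also have "\<dots> = (\<Sum>i\<le>J. real (tau k (p ^ i)) * s ^ i) * (1 / (1 - s))"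
    by (rule sum_distrib_right[symmetric])
  also have "\<dots> \<le> (1 / (1 - s)) ^ k * (1 / (1 - s))"
    using s by (intro mult_right_mono Suc.IH) auto
  finally show ?case by (simp add: mult.commute)
qed

section \<open>Pointwise bounds and Rankin induction\<close>

text \<open>No coprimality of \<open>m\<close> and \<open>n\<close> is assumed, so a prime may be
  split off while the cofactor is still divisible by it. The constant function 1 with
  \<open>k = 1\<close> is also an instance; it turns the weighted bounds into counting
  bounds.\<close>

locale tau_submultiplicative =
  fixes f :: "nat \<Rightarrow> real" and k :: nat
  assumes nonneg: "n \<ge> 1 \<Longrightarrow> f n \<ge> 0"
    and k_pos: "k \<ge> 1"
    and submult: "m \<ge> 1 \<Longrightarrow> n \<ge> 1 \<Longrightarrow> f (m * n) \<le> real (tau k m) * f n"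
begin

text \<open>Counted with multiplicity, \<open>b\<close> has at most \<open>ln b / ln Q\<close> prime
  factors, and splitting off each of them costs a factor \<open>tau k p \<le> k\<close>.\<close>

lemma le_powr_rough:
  assumes Q: "Q > 1" and a: "a \<ge> 1" and b: "b \<ge> 1"
    and rough: "\<And>p. prime p \<Longrightarrow> p dvd b \<Longrightarrow> Q < real p"
  shows "f (b * a) \<le> real k powr (ln (real b) / ln Q) * f a"
  using b rough
proof (induction b rule: less_induct)
  case (less b)
  show ?case
  proof (cases "b = 1")
    case True
    then show ?thesis using k_pos by simp
  next
    case False
    then obtain p where p: "prime p" "p dvd b" using prime_factor_nat by blast
    then obtain c where c: "b = p * c" by (auto elim: dvdE)
    have c1: "c \<ge> 1" using c less.prems(1) by (cases c) auto
    have pQ: "Q < real p" using less.prems(2) p by blast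
    have "c < b" using c c1 prime_gt_1_nat[OF p(1)] by simp
    then have IH: "f (c * a) \<le> real k powr (ln (real c) / ln Q) * f a"
      using c c1 by (intro less.IH) (auto intro: less.prems(2))
    have "f (b * a) = f (p * (c * a))" by (simp add: c mult.assoc)
    also have "\<dots> \<le> real (tau k p) * f (c * a)"
      using c1 a prime_gt_0_nat[OF p(1)] by (intro submult) (auto simp: Suc_le_eq)
    also have "\<dots> \<le> real k * f (c * a)"
      using tau_prime_power_le_power[OF p(1), of k 1] c1 a
      by (intro mult_right_mono nonneg) (auto simp: Suc_le_eq)
    also have "\<dots> \<le> real k * (real k powr (ln (real c) / ln Q) * f a)"
      using IH by (intro mult_left_mono) auto
    also have "\<dots> = real k powr (1 + ln (real c) / ln Q) * f a"
      using k_pos by (simp add: powr_add)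
    also have "\<dots> \<le> real k powr (ln (real b) / ln Q) * f a"
    proof (intro mult_right_mono powr_mono nonneg a)
      have "1 \<le> ln (real p) / ln Q" using pQ Q by (simp add: field_simps)
      then show "1 + ln (real c) / ln Q \<le> ln (real b) / ln Q"
        using c c1 prime_gt_0_nat[OF p(1)] by (simp add: ln_mult add_divide_distrib)
    qed (use k_pos in auto)
    finally show ?thesis .
  qed
qed

text \<open>From \<open>k powr (16 * l)\<close> on, \<open>k\<close> itself is at most
  \<open>p powr (1 / (16 * l))\<close> and \<open>k ^ j\<close> suffices. For smaller
  \<open>p\<close> the polynomial bound \<open>(j + 1) ^ (k - 1)\<close> is compared with a power of
  \<open>2 ^ j\<close>, which costs a constant independent of \<open>p\<close> and
  \<open>j\<close>.\<close>

lemma tau_prime_power_le_powr: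
  assumes l: "l \<ge> 1" and p: "prime p"
  shows "real (tau k (p ^ j)) \<le> (if real p < real k powr (16 * l) then (10 * l * (real k - 1)) ^ (k - 1) else 1)
      * real (p ^ j) powr (1 / (16 * l))"
proof (cases "real p < real k powr (16 * l)")
  case False
  have "real k = (real k powr (16 * l)) powr (1 / (16 * l))"
    using l k_pos by (simp add: powr_powr)
  also have "\<dots> \<le> real p powr (1 / (16 * l))"
    using False l by (intro powr_mono2) auto
  finally have "real k ^ j \<le> (real p powr (1 / (16 * l))) ^ j" by (intro power_mono) auto
  also have "\<dots> = real (p ^ j) powr (1 / (16 * l))"
    using prime_gt_0_nat[OF p] by (simp add: powr_powr powr_realpow [symmetric] mult.commute)
  finally have "real k ^ j \<le> real (p ^ j) powr (1 / (16 * l))" .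
  moreover have "real (tau k (p ^ j)) \<le> real k ^ j"
  proof -
    have "real (tau k (p ^ j)) \<le> real (k ^ j)"
      by (intro of_nat_mono tau_prime_power_le_power p)
    then show ?thesis by simp
  qed
  ultimately have "real (tau k (p ^ j)) \<le> real (p ^ j) powr (1 / (16 * l))" by (rule order.trans[rotated])
  then show ?thesis using False by simp
next
  case True
  have k2: "k \<ge> 2"
  proof (rule ccontr)
    assume "\<not> k \<ge> 2"
    then have "k = 1" using k_pos by simp
    then show False using True prime_gt_1_nat[OF p] by simp
  qed
  define m where "m = real (k - 1)"
  have m: "m \<ge> 1" "m = real k - 1" using k2 by (auto simp: m_def)
  define u where "u = real j * ln 2 / (16 * l * m)"
  define T where "T = 16 * l * m / ln (2 :: real)"
  have ln2: "ln (2 :: real) \<ge> 2 / 3" by (rule ln2_ge_two_thirds)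
  have lm: "l * m \<ge> 1" using l m mult_mono[of 1 l 1 m] by simp
  have T: "T > 0" using ln2 lm by (simp add: T_def)
  have "ln 2 / 16 / (l * m) \<le> (0.7 / 16 :: real) / 1"
    using lm ln2 ln2_le_25_over_36 by (intro frac_le) auto
  then have invT: "1 / T \<le> 0.04375" by (simp add: T_def mult.assoc)
  \<comment> \<open>This is t \<le> exp (t - 1) at t = (j + 1) / T. The factor 1 / e, kept as 1 /
    2.5, lowers the constant from 16 / ln 2, more than 23, to below 10.\<close>
  have "1 + ((real j + 1) / T - 1) \<le> exp ((real j + 1) / T - 1)" by (rule exp_ge_add_one_self)
  then have "(real j + 1) / T \<le> exp (real j / T + (1 / T - 1))"
    by (simp add: add_divide_distrib add_diff_eq)
  also have "\<dots> = exp (real j / T) * exp (1 / T - 1)" by (rule exp_add)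
  also have "\<dots> \<le> exp (real j / T) * (1 / 2.5)"
  proof (rule mult_left_mono)
    have "(2.5 :: real) \<le> exp (0.95)"
    proof -
      have "(1 + 0.95 / 20) ^ 20 \<le> (exp (0.95 / 20 :: real)) ^ 20"
        by (intro power_mono exp_ge_add_one_self) auto
      also have "\<dots> = exp (0.95 :: real)" by (simp flip: exp_of_nat_mult)
      finally show ?thesis by (rule order.trans[rotated]) (simp add: power_def)
    qed
    have "exp (1 / T - 1) \<le> exp (- 0.95)" using invT by simp
    also have "\<dots> = 1 / exp 0.95" by (simp add: exp_minus field_simps)
    also have "\<dots> \<le> 1 / 2.5" using \<open>2.5 \<le> exp (0.95 :: real)\<close> by (intro divide_left_mono) auto
    finally show "exp (1 / T - 1) \<le> 1 / 2.5" .
  qed auto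
  finally have "(real j + 1) \<le> T / 2.5 * exp (real j / T)" using T by (simp add: field_simps)
  also have "\<dots> \<le> 10 * l * m * exp (real j / T)"
  proof (rule mult_right_mono)
    have "16 * l * m / ln 2 \<le> 16 * l * m / (2 / 3 :: real)"
      using ln2 lm by (intro divide_left_mono) auto
    then show "T / 2.5 \<le> 10 * l * m" using lm by (simp add: T_def field_simps)
  qed auto
  finally have step: "real j + 1 \<le> 10 * l * m * exp (real j / T)" .
  obtain k' where k': "k = Suc k'" using k_pos by (cases k) auto
  have "real (tau k (p ^ j)) \<le> (real j + 1) ^ (k - 1)"
    using tau_prime_power_le_Suc_power[OF p, of k' j] k'
    by (metis diff_Suc_1 of_nat_Suc of_nat_le_iff of_nat_power add.commute)
  also have "\<dots> \<le> (10 * l * m * exp (real j / T)) ^ (k - 1)"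
    using step by (intro power_mono) auto
  also have "\<dots> = (10 * l * m) ^ (k - 1) * exp (real j / T) ^ (k - 1)" by (rule power_mult_distrib)
  also have "exp (real j / T) ^ (k - 1) = exp (m * (real j / T))"
    by (simp only: m_def exp_of_nat_mult)
  also have "m * (real j / T) = real j * ln 2 * (1 / (16 * l))"
    using m l ln2 by (simp add: T_def field_simps)
  also have "exp (real j * ln 2 * (1 / (16 * l))) = real (2 ^ j) powr (1 / (16 * l))"
    by (simp add: powr_def ln_realpow)
  also have "(10 * l * m) ^ (k - 1) * real (2 ^ j) powr (1 / (16 * l))
      \<le> (10 * l * m) ^ (k - 1) * real (p ^ j) powr (1 / (16 * l))"
  proof (intro mult_left_mono powr_mono2)
    show "real (2 ^ j) \<le> real (p ^ j)"
      using prime_ge_2_nat[OF p] by (simp add: power_mono)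
  qed (use l m in auto)
  finally show ?thesis using True m by simp
qed

text \<open>Full prime powers are peeled off, so that each prime below
  \<open>k powr (16 * l)\<close> pays its constant once and not once per multiplicity.\<close>

lemma le_prime_factors_powr:
  assumes l: "l \<ge> 1" and n: "n \<ge> 1"
  shows "f n \<le> (\<Prod>p\<in>prime_factors n. if real p < real k powr (16 * l) then (10 * l * (real k - 1)) ^ (k - 1) else 1)
      * real n powr (1 / (16 * l)) * f 1"
  using n
proof (induction n rule: less_induct)
  case (less n)
  define c where "c p = (if real p < real k powr (16 * l) then (10 * l * (real k - 1)) ^ (k - 1) else 1)"
    for p :: nat
  show ?case
  proof (cases "n = 1")
    case False
    then obtain p where p: "prime p" "p dvd n" using prime_factor_nat by blast
    have np: "n \<noteq> 0" "\<not> is_unit p" using less.prems p by (auto simp: prime_gt_1_nat)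
    obtain m where m: "n = p ^ multiplicity p n * m" "\<not> p dvd m"
      using multiplicity_decompose'[of n p] np by metis
    define j where "j = multiplicity p n"
    have j: "j > 0" using p np by (simp add: j_def prime_multiplicity_gt_zero_iff)
    have n_eq: "n = p ^ j * m" using m by (simp add: j_def)
    have m1: "m \<ge> 1" using n_eq less.prems by (cases m) auto
    have pj: "p ^ j > 1" using j prime_gt_1_nat[OF p(1)] by (metis one_less_power)
    then have "m < n" using n_eq m1 by simp
    then have IH: "f m \<le> (\<Prod>p\<in>prime_factors m. c p) * real m powr (1 / (16 * l)) * f 1"
      using m1 less.IH unfolding c_def by blast
    have "prime_factors n = prime_factors (p ^ j) \<union> prime_factors m"
      unfolding n_eq using m1 prime_gt_0_nat[OF p(1)] by (subst prime_factors_product) auto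
    also have "prime_factors (p ^ j) = {p}"
      using j p by (simp add: prime_factorization_prime_power)
    finally have pf: "prime_factors n = insert p (prime_factors m)" by simp
    have c0: "c p \<ge> 0" for p using l k_pos by (simp add: c_def)
    have "f n \<le> real (tau k (p ^ j)) * f m" unfolding n_eq using m1 pj by (intro submult) auto
    also have "\<dots> \<le> c p * real (p ^ j) powr (1 / (16 * l)) * f m"
      using tau_prime_power_le_powr[OF l p(1), of j] m1
      unfolding c_def by (intro mult_right_mono nonneg)
    also have "\<dots> \<le> c p * real (p ^ j) powr (1 / (16 * l)) *
        ((\<Prod>p\<in>prime_factors m. c p) * real m powr (1 / (16 * l)) * f 1)"
      using IH c0 by (intro mult_left_mono) auto
    also have "\<dots> = (c p * (\<Prod>p\<in>prime_factors m. c p)) *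
        (real (p ^ j) powr (1 / (16 * l)) * real m powr (1 / (16 * l))) * f 1"
      by (simp add: mult_ac)
    also have "real (p ^ j) powr (1 / (16 * l)) * real m powr (1 / (16 * l)) = real n powr (1 / (16 * l))"
      unfolding n_eq by (simp add: powr_mult)
    also have "c p * (\<Prod>p\<in>prime_factors m. c p) = (\<Prod>p\<in>prime_factors n. c p)"
      using m(2) unfolding pf by (subst prod.insert) auto
    finally show ?thesis unfolding c_def .
  qed simp
qed

text \<open>At most \<open>k powr (16 * l)\<close> primes pay the constant
  \<open>(10 * l * (k - 1)) ^ (k - 1)\<close>; this is where the double exponential shape of
  \<open>C_const\<close> comes from. For \<open>k = 1\<close> no prime pays, in agreement with the
  value 1 of \<open>C_const\<close>.\<close>

lemma le_C_const:
  assumes l: "l \<ge> 1" and n: "n \<ge> 1"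
  shows "f n \<le> C_const k l * real n powr (1 / (16 * l)) * f 1"
proof -
  define M where "M = (10 * l * (real k - 1)) ^ (k - 1)"
  define S where "S = {p\<in>prime_factors n. real p < real k powr (16 * l)}"
  have M: "M \<ge> 1"
  proof (cases "k = 1")
    case False
    have "1 \<le> 10 * l * 1" using l by simp
    also have "\<dots> \<le> 10 * l * (real k - 1)" using l False k_pos by (intro mult_left_mono) auto
    finally show ?thesis unfolding M_def by (rule one_le_power)
  qed (simp add: M_def)
  have "(\<Prod>p\<in>prime_factors n. if real p < real k powr (16 * l) then M else 1) = (\<Prod>p\<in>S. M)"
    unfolding S_def by (intro prod.inter_filter[symmetric]) simp
  also have "\<dots> = M powr real (card S)" using M by (simp add: powr_realpow)
  also have "\<dots> \<le> C_const k l"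
  proof (cases "k = 1")
    case False
    have "S \<subseteq> {1..nat \<lfloor>real k powr (16 * l)\<rfloor>}"
    proof
      fix p assume "p \<in> S"
      then have "prime p" "real p \<le> real k powr (16 * l)" by (auto simp: S_def)
      then show "p \<in> {1..nat \<lfloor>real k powr (16 * l)\<rfloor>}"
        using prime_gt_0_nat[of p] by (simp add: le_nat_floor Suc_le_eq)
    qed
    then have "card S \<le> card {1..nat \<lfloor>real k powr (16 * l)\<rfloor>}" by (intro card_mono) auto
    then have "card S \<le> nat \<lfloor>real k powr (16 * l)\<rfloor>" by simp
    then have "real (card S) \<le> real (nat \<lfloor>real k powr (16 * l)\<rfloor>)" by (rule of_nat_mono)
    also have "\<dots> \<le> real k powr (16 * l)" by simp
    finally have "real (card S) \<le> real k powr (16 * l)" .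
    then have "M powr real (card S) \<le> M powr (real k powr (16 * l))"
      using M by (intro powr_mono) auto
    moreover have M_eq: "M = (10 * l * (real k - 1)) powr (real k - 1)"
      using l False k_pos by (simp add: M_def powr_realpow[symmetric] of_nat_diff)
    then have "M powr (real k powr (16 * l)) = C_const k l"
      using False by (simp add: C_const_def powr_powr mult.commute)
    ultimately show ?thesis by simp
  next
    case True
    have "S = {}" using True by (auto simp: S_def dest!: in_prime_factors_imp_prime prime_gt_1_nat)
    then show ?thesis using True M by (simp add: C_const_def)
  qed
  finally have "(\<Prod>p\<in>prime_factors n. if real p < real k powr (16 * l) then M else 1) \<le> C_const k l" .
  then have "(\<Prod>p\<in>prime_factors n. if real p < real k powr (16 * l) then M else 1)
      * (real n powr (1 / (16 * l)) * f 1) \<le> C_const k l * (real n powr (1 / (16 * l)) * f 1)"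
    by (intro mult_right_mono mult_nonneg_nonneg nonneg) auto
  then show ?thesis using le_prime_factors_powr[OF l n] unfolding M_def by (simp add: mult.assoc)
qed

text \<open>The largest factor by which attaching the weight of the single prime \<open>p\<close>
  can increase the sum. The differences of powers are the increments of that weight as the
  multiplicity grows from \<open>j - 1\<close> to \<open>j\<close>.\<close>

definition euler_factor :: "real \<Rightarrow> nat \<Rightarrow> nat \<Rightarrow> real" where
  "euler_factor \<delta> N p = 1 + (\<Sum>j=1..N. (real p powr (\<delta> * real j) - real p powr (\<delta> * real (j - 1)))
      * (real (tau k (p ^ j)) / real (p ^ j)))"

text \<open>Attaching the weights \<open>p powr (\<delta> * v)\<close> prime by prime avoids any multiplicativity: expanding the
  weight of \<open>p\<close> as a telescoping sum over the powers \<open>p ^ j\<close> dividing \<open>a\<close> leaves sums over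
  multiples of \<open>p ^ j\<close>, to which the hypothesis on \<open>f\<close> applies.\<close>

lemma rankin_induct:
  fixes \<delta> :: real
  assumes \<delta>: "\<delta> \<ge> 0" and P: "finite P" "\<And>p. p \<in> P \<Longrightarrow> prime p"
  shows "(\<Sum>a=1..N. f a / real a * (\<Prod>p\<in>P. real p powr (\<delta> * real (multiplicity p a))))
      \<le> (\<Prod>p\<in>P. euler_factor \<delta> N p) * (\<Sum>a=1..N. f a / real a)"
  using P
proof (induction P rule: finite_induct)
  case (insert p P)
  define F where "F a = f a / real a * (\<Prod>p\<in>P. real p powr (\<delta> * real (multiplicity p a)))" for a
  define u where "u j = real p powr (\<delta> * real j)" for j
  have p: "prime p" and P: "\<And>q. q \<in> P \<Longrightarrow> prime q" using insert.prems by auto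
  have p1: "p > 1" using prime_gt_1_nat[OF p] .
  have F0: "F a \<ge> 0" if "a \<ge> 1" for a
    unfolding F_def using that by (intro mult_nonneg_nonneg divide_nonneg_nonneg nonneg prod_nonneg) auto
  have u_mono: "u j - u (j - 1) \<ge> 0" for j
    using p1 \<delta> by (auto simp: u_def intro!: powr_mono mult_left_mono)
  have tele: "u (multiplicity p a) = 1 + (\<Sum>j=1..N. (u j - u (j - 1)) * of_bool (p ^ j dvd a))"
    if a: "a \<in> {1..N}" for a
  proof -
    define v where "v = multiplicity p a"
    have dvd: "p ^ j dvd a \<longleftrightarrow> j \<le> v" for j
      unfolding v_def using a p1 by (intro power_dvd_iff_le_multiplicity) auto
    \<comment> \<open>Exponents up to \<open>N\<close> suffice, since
      \<open>v < p ^ v \<le> a \<le> N\<close>.\<close>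
    have "v < p ^ v" using p1 by (simp add: power_gt_expt)
    also have "p ^ v \<le> a" using dvd[of v] a by (intro dvd_imp_le) auto
    finally have "v \<le> N" using a by simp
    then have "(\<Sum>j=1..N. (u j - u (j - 1)) * of_bool (p ^ j dvd a)) = (\<Sum>j=1..v. u j - u (j - 1))"
      by (intro sum.mono_neutral_cong_right) (auto simp: dvd)
    also have "\<dots> = u v - u 0" by (induction v) auto
    finally show ?thesis using p1 by (simp add: v_def u_def)
  qed
  have multiples: "(\<Sum>a=1..N. of_bool (p ^ j dvd a) * F a)
      \<le> real (tau k (p ^ j)) / real (p ^ j) * (\<Sum>a=1..N. F a)" for j
  proof -
    define d where "d = p ^ j"
    have d: "d \<ge> 1" using p1 by (simp add: d_def)
    have "(\<Sum>a=1..N. of_bool (d dvd a) * F a) = (\<Sum>a\<in>{a\<in>{1..N}. d dvd a}. F a)"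
      by (intro sum.mono_neutral_cong_right) auto
    also have "\<dots> = (\<Sum>m\<in>{1..N div d}. F (d * m))"
    proof (rule sum.reindex_bij_witness[of _ "\<lambda>m. d * m" "\<lambda>a. a div d"])
      fix a assume a: "a \<in> {a\<in>{1..N}. d dvd a}"
      then obtain c where "a = d * c" by (auto elim: dvdE)
      then show "a div d \<in> {1..N div d}" using a d div_le_mono[of a N d] by (cases c) auto
    next
      fix m assume m: "m \<in> {1..N div d}"
      have "d * m \<le> d * (N div d)" using m by simp
      also have "\<dots> \<le> N" by simp
      finally show "d * m \<in> {a\<in>{1..N}. d dvd a}" using m d by (auto simp: Suc_le_eq)
    qed (use d in auto)
    also have "\<dots> \<le> (\<Sum>m\<in>{1..N div d}. real (tau k d) / real d * F m)"
    proof (rule sum_mono)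
      fix m assume m: "m \<in> {1..N div d}"
      \<comment> \<open>The weights already attached belong to primes other than \<open>p\<close>,
        so they do not notice the factor \<open>p ^ j\<close>.\<close>
      have "(\<Prod>q\<in>P. real q powr (\<delta> * real (multiplicity q (d * m))))
          = (\<Prod>q\<in>P. real q powr (\<delta> * real (multiplicity q m)))"
      proof (intro prod.cong refl)
        fix q assume q: "q \<in> P"
        then have "p \<noteq> q" using insert.hyps by auto
        then have "multiplicity q d = 0"
          unfolding d_def using p P[OF q] by (simp add: multiplicity_distinct_prime_power)
        then have "multiplicity q (d * m) = multiplicity q m"
          using P[OF q] d m by (subst prime_elem_multiplicity_mult_distrib) auto
        then show "real q powr (\<delta> * real (multiplicity q (d * m))) = real q powr (\<delta> * real (multiplicity q m))"
          by simp
      qed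
      then have "F (d * m) = f (d * m) / (real d * real m)
          * (\<Prod>q\<in>P. real q powr (\<delta> * real (multiplicity q m)))" by (simp add: F_def)
      also have "\<dots> \<le> (real (tau k d) * f m) / (real d * real m)
          * (\<Prod>q\<in>P. real q powr (\<delta> * real (multiplicity q m)))"
        using d m by (intro mult_right_mono divide_right_mono submult prod_nonneg) auto
      also have "\<dots> = real (tau k d) / real d * F m" by (simp add: F_def)
      finally show "F (d * m) \<le> real (tau k d) / real d * F m" .
    qed
    \<comment> \<open>Enlarging the range of \<open>m\<close> back to \<open>N\<close> makes the
      bound a multiple of the original sum, as the induction requires.\<close>
    also have "\<dots> \<le> (\<Sum>m\<in>{1..N}. real (tau k d) / real d * F m)"
    proof (rule sum_mono2)
      have "N div d \<le> N" by simp
      then show "{1..N div d} \<subseteq> {1..N}" by (auto simp del: div_le_dividend)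
    qed (auto intro!: mult_nonneg_nonneg divide_nonneg_nonneg F0)
    finally show ?thesis unfolding d_def by (simp add: sum_distrib_left)
  qed
  have "(\<Sum>a=1..N. f a / real a * (\<Prod>p\<in>insert p P. real p powr (\<delta> * real (multiplicity p a))))
      = (\<Sum>a=1..N. F a * u (multiplicity p a))"
    using insert.hyps by (simp add: F_def u_def mult_ac)
  also have "\<dots> = (\<Sum>a=1..N. F a + (\<Sum>j=1..N. (u j - u (j - 1)) * (of_bool (p ^ j dvd a) * F a)))"
    by (intro sum.cong refl, subst tele) (simp_all only: distrib_left sum_distrib_left mult_1_right mult_ac)
  also have "\<dots> = (\<Sum>a=1..N. F a) + (\<Sum>j=1..N. (u j - u (j - 1)) * (\<Sum>a=1..N. of_bool (p ^ j dvd a) * F a))"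
    by (simp only: sum.distrib sum_distrib_left) (subst sum.swap, rule refl)
  also have "\<dots> \<le> (\<Sum>a=1..N. F a) + (\<Sum>j=1..N. (u j - u (j - 1)) *
      (real (tau k (p ^ j)) / real (p ^ j) * (\<Sum>a=1..N. F a)))"
    by (intro add_left_mono sum_mono mult_left_mono multiples u_mono)
  also have "\<dots> = euler_factor \<delta> N p * (\<Sum>a=1..N. F a)"
    by (simp only: euler_factor_def u_def distrib_right sum_distrib_right mult.assoc mult_1)
  also have "\<dots> \<le> euler_factor \<delta> N p * ((\<Prod>p\<in>P. euler_factor \<delta> N p) * (\<Sum>a=1..N. f a / real a))"
  proof (rule mult_left_mono)
    show "euler_factor \<delta> N p \<ge> 0"
      unfolding euler_factor_def u_def[symmetric]
      by (intro add_nonneg_nonneg sum_nonneg mult_nonneg_nonneg u_mono) auto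
  qed (use insert.IH P in \<open>simp add: F_def\<close>)
  finally show ?case using insert.hyps by (simp add: mult.assoc)
qed simp

end

section \<open>An upper bound sieve\<close>

lemma sum_multiples_approx:
  fixes u w :: real
  assumes u: "0 \<le> u" "u \<le> w" and d: "d \<ge> 1"
  shows "\<bar>(\<Sum>n | u < real n \<and> real n \<le> w. of_bool (d dvd n)) - (w - u) / real d\<bar> \<le> 1"
proof -
  define I where "I = {n. u < real n \<and> real n \<le> w}"
  have floor_iff: "real n \<le> t \<longleftrightarrow> n \<le> nat \<lfloor>t\<rfloor>" if "t \<ge> 0" for n t
    using that by (simp add: le_nat_iff le_floor_iff)
  then have floor_less: "t < real n \<longleftrightarrow> nat \<lfloor>t\<rfloor> < n" if "t \<ge> 0" for n t
    using that by (meson not_le)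
  have fin: "finite I" unfolding I_def
    by (rule finite_subset[of _ "{..nat \<lfloor>w\<rfloor>}"]) (use u floor_iff[of w] in auto)
  have "(\<Sum>n\<in>I. of_bool (d dvd n) :: real) = real (card {n\<in>I. d dvd n})"
    using fin by (simp add: Int_def)
  also have "{n\<in>I. d dvd n} = (*) d ` {m. u / d < real m \<and> real m \<le> w / d}"
  proof safe
    fix n assume "n \<in> I" "d dvd n"
    then show "n \<in> (*) d ` {m. u / d < real m \<and> real m \<le> w / d}"
      using d by (auto simp: I_def field_simps elim!: dvdE)
  next
    fix m assume "u / d < real m" "real m \<le> w / d"
    then show "d * m \<in> I" using d by (simp add: I_def field_simps)
  qed simp
  also have "card \<dots> = card {m. u / d < real m \<and> real m \<le> w / d}"
    using d by (intro card_image) (auto simp: inj_on_def)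
  also have "{m. u / d < real m \<and> real m \<le> w / d} = {nat \<lfloor>u / d\<rfloor><..nat \<lfloor>w / d\<rfloor>}"
  proof -
    have "0 \<le> u / d" "0 \<le> w / d" using u by auto
    then show ?thesis using floor_iff floor_less by auto
  qed
  also have "real (card \<dots>) = real_of_int (\<lfloor>w / d\<rfloor> - \<lfloor>u / d\<rfloor>)"
  proof -
    have "0 \<le> u / d" "0 \<le> w / d" "u / d \<le> w / d" using u by (auto intro: divide_right_mono)
    then have "0 \<le> u / d" "0 \<le> w / d" "\<lfloor>u / d\<rfloor> \<le> \<lfloor>w / d\<rfloor>" by (auto intro: floor_mono)
    then show ?thesis by (simp add: of_nat_diff nat_mono)
  qed
  finally have "(\<Sum>n\<in>I. of_bool (d dvd n)) = real_of_int \<lfloor>w / d\<rfloor> - real_of_int \<lfloor>u / d\<rfloor>" by simp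
  then show ?thesis unfolding I_def diff_divide_distrib abs_le_iff
    using of_int_floor_le[of "w / d"] real_of_int_floor_add_one_gt[of "w / d"]
      of_int_floor_le[of "u / d"] real_of_int_floor_add_one_gt[of "u / d"] by linarith
qed

text \<open>Expanding the product gives signed counts of multiples, each within 1 of its mean, and
  the errors add up to the expanded right-hand side. The divisor \<open>d\<close> is carried for the
  induction, which moves a prime from the product into \<open>d\<close>.\<close>

lemma sum_prod_multiples_approx:
  fixes u w :: real and c :: "nat \<Rightarrow> real"
  assumes u: "0 \<le> u" "u \<le> w" and R: "finite R" "\<And>p. p \<in> R \<Longrightarrow> prime p"
    and d: "d \<ge> 1" "\<And>p. p \<in> R \<Longrightarrow> \<not> p dvd d"
  shows "\<bar>(\<Sum>n | u < real n \<and> real n \<le> w. of_bool (d dvd n) * (\<Prod>p\<in>R. 1 + c p * of_bool (p dvd n)))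
      - (w - u) / real d * (\<Prod>p\<in>R. 1 + c p / real p)\<bar> \<le> (\<Prod>p\<in>R. 1 + \<bar>c p\<bar>)"
  using R d
proof (induction R arbitrary: d rule: finite_induct)
  case empty
  then show ?case using sum_multiples_approx[OF u] by simp
next
  case (insert q R)
  define I where "I = {n. u < real n \<and> real n \<le> w}"
  define S where "S d = (\<Sum>n\<in>I. of_bool (d dvd n) * (\<Prod>p\<in>R. 1 + c p * of_bool (p dvd n)))" for d
  define M where "M d = (w - u) / real d * (\<Prod>p\<in>R. 1 + c p / real p)" for d
  define E where "E = (\<Prod>p\<in>R. 1 + \<bar>c p\<bar>)"
  have q: "prime q" "\<not> q dvd d" using insert.prems by auto
  have R: "prime p" "\<not> p dvd d" if "p \<in> R" for p using that insert.prems by auto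
  have IH1: "\<bar>S d - M d\<bar> \<le> E"
    using insert.IH[of d] R insert.prems unfolding S_def M_def E_def I_def by simp
  have IH2: "\<bar>S (d * q) - M (d * q)\<bar> \<le> E"
    unfolding S_def M_def E_def I_def
  proof (rule insert.IH)
    show "d * q \<ge> 1" using insert.prems(2) prime_gt_0_nat[OF q(1)] by (simp add: Suc_le_eq)
    show "\<not> p dvd d * q" if "p \<in> R" for p
    proof -
      have "p \<noteq> q" using that insert.hyps by auto
      then have "\<not> p dvd q" using R[OF that] q(1) primes_dvd_imp_eq[of p q] by blast
      then show ?thesis using R[OF that] by (simp add: prime_dvd_mult_iff)
    qed
  qed (use R in auto)
  have dq: "d dvd n \<and> q dvd n \<longleftrightarrow> d * q dvd n" for n
    using q by (metis coprime_commute divides_mult dvd_mult_left dvd_mult_right prime_imp_coprime)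
  have "(\<Sum>n\<in>I. of_bool (d dvd n) * (\<Prod>p\<in>insert q R. 1 + c p * of_bool (p dvd n)))
      = (\<Sum>n\<in>I. of_bool (d dvd n) * (\<Prod>p\<in>R. 1 + c p * of_bool (p dvd n))
          + c q * (of_bool (d * q dvd n) * (\<Prod>p\<in>R. 1 + c p * of_bool (p dvd n))))"
    using insert.hyps dq by (intro sum.cong) (auto simp: of_bool_def algebra_simps)
  also have "\<dots> = S d + c q * S (d * q)"
    by (simp only: S_def sum.distrib sum_distrib_left)
  finally have 1: "(\<Sum>n\<in>I. of_bool (d dvd n) * (\<Prod>p\<in>insert q R. 1 + c p * of_bool (p dvd n)))
      = S d + c q * S (d * q)" .
  have 2: "(w - u) / real d * (\<Prod>p\<in>insert q R. 1 + c p / real p) = M d + c q * M (d * q)"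
    using insert.hyps by (simp add: M_def algebra_simps)
  have "\<bar>S d + c q * S (d * q) - (M d + c q * M (d * q))\<bar> = \<bar>(S d - M d) + c q * (S (d * q) - M (d * q))\<bar>"
    by (simp add: algebra_simps)
  also have "\<dots> \<le> \<bar>S d - M d\<bar> + \<bar>c q\<bar> * \<bar>S (d * q) - M (d * q)\<bar>"
    by (rule order.trans[OF abs_triangle_ineq]) (simp add: abs_mult)
  also have "\<dots> \<le> E + \<bar>c q\<bar> * E" by (intro add_mono IH1 mult_left_mono IH2) auto
  also have "\<dots> = (\<Prod>p\<in>insert q R. 1 + \<bar>c p\<bar>)" using insert.hyps by (simp add: E_def algebra_simps)
  finally show ?case using 1 2 unfolding I_def by simp
qed

lemma squarefree_eq_prod_prime_factors:
  fixes m :: nat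
  assumes "squarefree m"
  shows "(\<Prod>p\<in>prime_factors m. p) = m"
proof -
  have m0: "m > 0" using assms by (cases m) auto
  have "m = (\<Prod>p\<in>prime_factors m. p ^ multiplicity p m)" using m0 by (rule prime_factorization_nat)
  also have "\<dots> = (\<Prod>p\<in>prime_factors m. p)"
  proof (intro prod.cong refl)
    fix p assume "p \<in> prime_factors m"
    then have "prime p" "multiplicity p m > 0" by (auto simp: prime_factors_multiplicity)
    moreover from this have "multiplicity p m \<le> 1"
      using assms m0 by (simp add: squarefree_factorial_semiring'')
    ultimately have "multiplicity p m = 1" by simp
    then show "p ^ multiplicity p m = p" by simp
  qed
  finally show ?thesis by simp
qed

text \<open>For squarefree \<open>m\<close> this is the Ramanujan sum of modulus \<open>m\<close> at
  \<open>n\<close>, times the Moebius function of \<open>m\<close>.\<close>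

definition sieve_kernel :: "nat \<Rightarrow> nat \<Rightarrow> real" where
  "sieve_kernel m n = (\<Prod>p\<in>prime_factors m. 1 - real p * of_bool (p dvd n))"

text \<open>For squarefree indices the kernels have mean value zero unless \<open>m = 1\<close>, and are orthogonal
  in mean. The \<open>\<Lambda>\<^sup>2\<close> sieve below uses the weight \<open>\<Sum>m. sieve_kernel m n / m\<close>, whose mean square
  is easy to bound, in place of Selberg's optimal weights.\<close>

lemma sum_sieve_kernel_le:
  fixes u w :: real
  assumes u: "0 \<le> u" "u \<le> w" and m: "squarefree m" "squarefree m'"
  shows "(\<Sum>n | u < real n \<and> real n \<le> w. sieve_kernel m n * sieve_kernel m' n)
      \<le> of_bool (m = m') * (w - u) * real m + real m ^ 2 * real m' ^ 2"
proof -
  define R where "R = prime_factors m"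
  define R' where "R' = prime_factors m'"
  \<comment> \<open>For a common prime, (1 - p [p | n])^2 = 1 + (p^2 - 2 p) [p | n]. The two kernels
    thus merge into one product over \<open>R \<union> R'\<close> of the shape treated
    above.\<close>
  define c where "c p = (if p \<in> R \<and> p \<in> R' then (real p)\<^sup>2 - 2 * real p else - real p)" for p
  have fin: "finite R" "finite R'" by (simp_all add: R_def R'_def)
  have pr: "prime p" if "p \<in> R \<union> R'" for p
    using that by (auto simp: R_def R'_def)
  have ndvd: "\<not> p dvd 1" if "p \<in> R \<union> R'" for p
    using pr[OF that] by (metis not_prime_unit)
  have p2: "real p \<ge> 2" if "p \<in> R \<union> R'" for p
    using prime_ge_2_nat[OF pr[OF that]] by simp
  have ext: "(\<Prod>p\<in>R. g p) * (\<Prod>p\<in>R'. g p)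
      = (\<Prod>p\<in>R \<union> R'. (if p \<in> R then g p else 1) * (if p \<in> R' then g p else 1))" for g :: "nat \<Rightarrow> real"
  proof -
    have "(\<Prod>p\<in>R. g p) = (\<Prod>p\<in>R \<union> R'. if p \<in> R then g p else 1)"
      "(\<Prod>p\<in>R'. g p) = (\<Prod>p\<in>R \<union> R'. if p \<in> R' then g p else 1)"
      by (rule prod.mono_neutral_cong_left; use fin in auto)+
    then show ?thesis by (simp add: prod.distrib)
  qed
  have prod_kernel: "sieve_kernel m n * sieve_kernel m' n = (\<Prod>p\<in>R \<union> R'. 1 + c p * of_bool (p dvd n))" for n
    unfolding sieve_kernel_def R_def[symmetric] R'_def[symmetric] ext
    by (intro prod.cong) (auto simp: c_def power2_eq_square algebra_simps)
  have "\<bar>(\<Sum>n | u < real n \<and> real n \<le> w. of_bool (1 dvd n) * (\<Prod>p\<in>R \<union> R'. 1 + c p * of_bool (p dvd n)))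
      - (w - u) / real 1 * (\<Prod>p\<in>R \<union> R'. 1 + c p / real p)\<bar> \<le> (\<Prod>p\<in>R \<union> R'. 1 + \<bar>c p\<bar>)"
  proof -
    have "finite (R \<union> R')" using fin by simp
    note sum_prod_multiples_approx[of u w "R \<union> R'" 1 c, OF u this pr order.refl ndvd]
    then show ?thesis .
  qed
  then have "(\<Sum>n | u < real n \<and> real n \<le> w. sieve_kernel m n * sieve_kernel m' n)
      \<le> (w - u) * (\<Prod>p\<in>R \<union> R'. 1 + c p / real p) + (\<Prod>p\<in>R \<union> R'. 1 + \<bar>c p\<bar>)"
    by (simp add: prod_kernel)
  also have "(w - u) * (\<Prod>p\<in>R \<union> R'. 1 + c p / real p) \<le> (w - u) * (of_bool (m = m') * real m)"
  proof (rule mult_left_mono)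
    show "(\<Prod>p\<in>R \<union> R'. 1 + c p / real p) \<le> of_bool (m = m') * real m"
    proof (cases "R = R'")
      case True
      have "m = (\<Prod>p\<in>R. p)" unfolding R_def by (rule squarefree_eq_prod_prime_factors[OF m(1), symmetric])
      also have "\<dots> = (\<Prod>p\<in>R'. p)" by (simp only: True)
      also have "\<dots> = m'" unfolding R'_def by (rule squarefree_eq_prod_prime_factors[OF m(2)])
      finally have eq: "m = m'" .
      have "R \<union> R' = R" using True by simp
      then have "(\<Prod>p\<in>R \<union> R'. 1 + c p / real p) = (\<Prod>p\<in>R. 1 + c p / real p)" by (simp only:)
      also have "\<dots> \<le> (\<Prod>p\<in>R. real p)"
      proof (rule prod_mono)
        fix p assume p: "p \<in> R"
        then have "c p = real p * (real p - 2)" using True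
          by (simp add: c_def power2_eq_square algebra_simps)
        then have "1 + c p / real p = real p - 1" using p2[of p] p by simp
        then show "0 \<le> 1 + c p / real p \<and> 1 + c p / real p \<le> real p" using p2[of p] p by simp
      qed
      also have "\<dots> = real m"
        using squarefree_eq_prod_prime_factors[OF m(1)] by (simp add: R_def flip: of_nat_prod)
      finally show ?thesis using eq by simp
    next
      case False
      then obtain p where p: "p \<in> R \<union> R'" "\<not> (p \<in> R \<and> p \<in> R')"
        unfolding set_eq_iff by auto
      \<comment> \<open>A prime dividing only one of the two indices has local mean 1 - p / p, which
        annihilates the whole main term.\<close>
      then have "1 + c p / real p = 0" using p2[of p] by (auto simp: c_def)
      then have "(\<Prod>p\<in>R \<union> R'. 1 + c p / real p) = 0" using p fin by (intro prod_zero) auto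
      then show ?thesis by simp
    qed
  qed (use u in simp)
  also have "(\<Prod>p\<in>R \<union> R'. 1 + \<bar>c p\<bar>) \<le> (\<Prod>p\<in>R. (real p)\<^sup>2) * (\<Prod>p\<in>R'. (real p)\<^sup>2)"
    unfolding ext
  proof (rule prod_mono)
    fix p assume pR: "p \<in> R \<union> R'"
    then have p: "real p \<ge> 2" by (rule p2)
    have q: "(real p)\<^sup>2 \<ge> 2 * real p" using p by (simp add: power2_eq_square mult_right_mono)
    have one: "1 + real p \<le> (real p)\<^sup>2" using q p by simp
    have "1 + ((real p)\<^sup>2 - 2 * real p) \<le> (real p)\<^sup>2 * 1" using p by simp
    also have "\<dots> \<le> (real p)\<^sup>2 * (real p)\<^sup>2" using one p by (intro mult_left_mono) auto
    finally show "0 \<le> 1 + \<bar>c p\<bar> \<and>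
        1 + \<bar>c p\<bar> \<le> (if p \<in> R then (real p)\<^sup>2 else 1) * (if p \<in> R' then (real p)\<^sup>2 else 1)"
      using q one pR by (auto simp: c_def)
  qed
  also have "(\<Prod>p\<in>R. (real p)\<^sup>2) * (\<Prod>p\<in>R'. (real p)\<^sup>2) = real m ^ 2 * real m' ^ 2"
  proof -
    have "(\<Prod>p\<in>prime_factors j. (real p)\<^sup>2) = (real j)\<^sup>2" if "squarefree j" for j
    proof -
      have "(\<Prod>p\<in>prime_factors j. (real p)\<^sup>2) = (real (\<Prod>p\<in>prime_factors j. p))\<^sup>2"
        unfolding of_nat_prod by (rule prod_power_distrib[symmetric])
      then show ?thesis by (simp only: squarefree_eq_prod_prime_factors[OF that])
    qed
    then show ?thesis using m by (simp add: R_def R'_def)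
  qed
  finally show ?thesis by (simp add: mult_ac)
qed

text \<open>On a sifted \<open>n\<close> every kernel is 1, so the weight equals the sum
  \<open>S\<close> of reciprocals. Its square is nonnegative elsewhere, and by orthogonality the
  mean square over the interval has main term \<open>(w - u) * S\<close>; dividing by the square of
  \<open>S\<close> gives the bound.\<close>

lemma card_sifted_le:
  fixes u w :: real
  assumes u: "0 \<le> u" "u \<le> w" and N: "N \<ge> 1"
  shows "real (card {n. u < real n \<and> real n \<le> w \<and> (\<forall>p. prime p \<longrightarrow> p dvd n \<longrightarrow> N < p)})
      \<le> (w - u) / (\<Sum>m | m \<in> {1..N} \<and> squarefree m. 1 / real m) + real N ^ 4"
proof -
  define I where "I = {n. u < real n \<and> real n \<le> w}"
  define M where "M = {m. m \<in> {1..N} \<and> squarefree m}"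
  define S where "S = (\<Sum>m\<in>M. 1 / real m)"
  define G where "G = {n\<in>I. \<forall>p. prime p \<longrightarrow> p dvd n \<longrightarrow> N < p}"
  have finI: "finite I" unfolding I_def
    by (rule finite_subset[of _ "{..nat \<lfloor>w\<rfloor>}"]) (use u in \<open>auto simp: le_nat_iff le_floor_iff\<close>)
  have finM: "finite M" by (simp add: M_def)
  have "1 \<in> M" using N by (simp add: M_def)
  then have "(\<Sum>m\<in>{1}. 1 / real m) \<le> S"
    unfolding S_def using finM by (intro sum_mono2) auto
  then have S: "S \<ge> 1" by simp
  have kernel_1: "sieve_kernel m n = 1" if "n \<in> G" "m \<in> M" for m n
    unfolding sieve_kernel_def
  proof (intro prod.neutral ballI)
    fix p assume "p \<in> prime_factors m"
    then have p: "prime p" "p dvd m" by (auto simp: prime_factors_dvd)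
    then have "p \<le> m" using that by (intro dvd_imp_le) (auto simp: M_def)
    then have "\<not> p dvd n" using that p by (auto simp: M_def G_def)
    then show "1 - real p * of_bool (p dvd n) = 1" by simp
  qed
  have "real (card G) * S\<^sup>2 = (\<Sum>n\<in>G. (\<Sum>m\<in>M. sieve_kernel m n / real m)\<^sup>2)"
    by (simp add: kernel_1 S_def cong: sum.cong)
  also have "\<dots> \<le> (\<Sum>n\<in>I. (\<Sum>m\<in>M. sieve_kernel m n / real m)\<^sup>2)"
    using finI by (intro sum_mono2) (auto simp: G_def)
  also have "\<dots> = (\<Sum>n\<in>I. \<Sum>m\<in>M. \<Sum>m'\<in>M. sieve_kernel m n * sieve_kernel m' n / (real m * real m'))"
    by (simp add: power2_eq_square sum_product)
  also have "\<dots> = (\<Sum>m\<in>M. \<Sum>m'\<in>M. \<Sum>n\<in>I. sieve_kernel m n * sieve_kernel m' n / (real m * real m'))"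
    by (subst sum.swap) (intro sum.cong refl sum.swap)
  also have "\<dots> = (\<Sum>m\<in>M. \<Sum>m'\<in>M. (\<Sum>n\<in>I. sieve_kernel m n * sieve_kernel m' n) / (real m * real m'))"
    by (simp add: sum_divide_distrib)
  also have "\<dots> \<le> (\<Sum>m\<in>M. \<Sum>m'\<in>M. (of_bool (m = m') * (w - u) * real m + real m ^ 2 * real m' ^ 2) / (real m * real m'))"
    unfolding I_def
    by (intro sum_mono divide_right_mono sum_sieve_kernel_le u) (auto simp: M_def)
  also have "\<dots> = (\<Sum>m\<in>M. \<Sum>m'\<in>M. (if m' = m then (w - u) / real m else 0) + real m * real m')"
    by (intro sum.cong refl) (auto simp: M_def field_simps power2_eq_square)
  also have "\<dots> = (w - u) * S + (\<Sum>m\<in>M. real m)\<^sup>2"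
  proof -
    have sq: "(\<Sum>m\<in>M. \<Sum>m'\<in>M. real m * real m') = (\<Sum>m\<in>M. real m)\<^sup>2"
      by (simp only: power2_eq_square sum_product)
    show ?thesis unfolding sum.distrib sq S_def sum_distrib_left using finM by simp
  qed
  also have "(\<Sum>m\<in>M. real m) \<le> real N ^ 2"
  proof -
    have "(\<Sum>m\<in>M. real m) \<le> (\<Sum>m\<in>M. real N)" by (intro sum_mono) (auto simp: M_def)
    also have "\<dots> \<le> (\<Sum>m\<in>{1..N}. real N)" by (intro sum_mono2) (auto simp: M_def)
    finally show ?thesis by (simp add: power2_eq_square)
  qed
  then have "(w - u) * S + (\<Sum>m\<in>M. real m)\<^sup>2 \<le> (w - u) * S + (real N ^ 2)\<^sup>2"
    by (intro add_left_mono power_mono sum_nonneg) auto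
  finally have "real (card G) * S\<^sup>2 \<le> (w - u) * S + real N ^ 4" by (simp flip: power_mult)
  \<comment> \<open>Possible because \<open>m = 1\<close> alone contributes 1 to
    \<open>S\<close>.\<close>
  also have "\<dots> \<le> (w - u) * S + real N ^ 4 * S\<^sup>2"
    using S by (simp add: mult_le_cancel_left1)
  also have "\<dots> = ((w - u) / S + real N ^ 4) * S\<^sup>2"
    using S by (simp add: field_simps power2_eq_square)
  finally have "real (card G) \<le> (w - u) / S + real N ^ 4" using S by simp
  then show ?thesis by (simp add: G_def I_def S_def M_def conj_assoc)
qed

section \<open>The sieve denominator is at least half a logarithm\<close>

lemma sum_inverse_squares_le: "(\<Sum>s=1..N. 1 / (real s)\<^sup>2) \<le> 2"
proof -
  have "(\<Sum>s=1..N. 1 / (real s)\<^sup>2) \<le> 2 - 1 / real N" if "N \<ge> 1"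
    using that
  proof (induction N rule: dec_induct)
    case (step n)
    have "1 / (real (Suc n))\<^sup>2 \<le> 1 / (real n * real (Suc n))"
      using step by (intro divide_left_mono) (auto simp: power2_eq_square)
    also have "\<dots> = 1 / real n - 1 / real (Suc n)" using step by (simp add: field_simps)
    finally show ?case using step by simp
  qed simp
  moreover have "2 - 1 / real N \<le> 2" by simp
  ultimately show ?thesis by (cases "N \<ge> 1") (blast intro: order.trans, simp)
qed

text \<open>Writing n = m s^2 with \<open>m\<close> squarefree embeds the harmonic sum into the
  product of the sum of 1 / s^2, at most 2, and the sum of 1 / m.\<close>

lemma ln_le_sum_inverse_squarefree:
  "ln (real N + 1) \<le> 2 * (\<Sum>m | m \<in> {1..N} \<and> squarefree m. 1 / real m)"
proof -
  define M where "M = {m. m \<in> {1..N} \<and> squarefree m}"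
  have "ln (real N + 1) \<le> harm N" by (rule ln_le_harm)
  also have "harm N = (\<Sum>n=1..N. 1 / real n)" by (simp add: harm_def inverse_eq_divide)
  also have "\<dots> = (\<Sum>n=1..N. 1 / (real (square_part n))\<^sup>2 * (1 / real (squarefree_part n)))"
  proof (intro sum.cong refl)
    fix n :: nat
    define s m where "s = square_part n" and "m = squarefree_part n"
    have "n = m * s\<^sup>2" unfolding s_def m_def by (rule squarefree_decompose)
    then have "real n = real m * (real s)\<^sup>2" by simp
    then show "1 / real n = 1 / (real (square_part n))\<^sup>2 * (1 / real (squarefree_part n))"
      unfolding s_def[symmetric] m_def[symmetric] by (simp add: mult.commute)
  qed
  also have "\<dots> = (\<Sum>(s, m)\<in>(\<lambda>n. (square_part n, squarefree_part n)) ` {1..N}. 1 / (real s)\<^sup>2 * (1 / real m))"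
  proof (subst sum.reindex)
    show "inj_on (\<lambda>n. (square_part n, squarefree_part n)) {1..N}"
    proof (rule inj_onI)
      fix n n' :: nat
      assume eq: "(square_part n, squarefree_part n) = (square_part n', squarefree_part n')"
      have "n = squarefree_part n * square_part n ^ 2" by (rule squarefree_decompose)
      also have "\<dots> = squarefree_part n' * square_part n' ^ 2" using eq by simp
      also have "\<dots> = n'" by (rule squarefree_decompose[symmetric])
      finally show "n = n'" .
    qed
  qed simp
  also have "\<dots> \<le> (\<Sum>(s, m)\<in>{1..N} \<times> M. 1 / (real s)\<^sup>2 * (1 / real m))"
  proof (rule sum_mono2)
    show "(\<lambda>n. (square_part n, squarefree_part n)) ` {1..N} \<subseteq> {1..N} \<times> M"
    proof safe
      fix n assume n: "n \<in> {1..N}"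
      have "square_part n > 0" "squarefree_part n > 0" using n by (auto intro!: Nat.gr0I)
      moreover have "square_part n dvd n" "squarefree_part n dvd n"
        by (rule dvd_trans[OF _ square_part_square_dvd], simp add: power2_eq_square)
          (rule dvdI[OF squarefree_decompose])
      then have "square_part n \<le> n" "squarefree_part n \<le> n" using n by (auto intro: dvd_imp_le)
      moreover have "squarefree (squarefree_part n)" using n by simp
      ultimately show "square_part n \<in> {1..N}" "squarefree_part n \<in> M" using n by (auto simp: M_def)
    qed
  qed (auto simp: M_def)
  also have "\<dots> = (\<Sum>s=1..N. 1 / (real s)\<^sup>2) * (\<Sum>m\<in>M. 1 / real m)"
    by (simp only: sum_product sum.cartesian_product)
  also have "\<dots> \<le> 2 * (\<Sum>m\<in>M. 1 / real m)"
    by (intro mult_right_mono sum_inverse_squares_le sum_nonneg) auto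
  finally show ?thesis by (simp add: M_def)
qed

lemma card_rough_le:
  fixes u w Q :: real
  assumes u: "0 \<le> u" "u \<le> w" and Q: "Q \<ge> 2"
  shows "real (card {n. u < real n \<and> real n \<le> w \<and> (\<forall>p. prime p \<longrightarrow> p dvd n \<longrightarrow> Q < real p)})
      \<le> 2 * (w - u) / ln Q + Q ^ 4"
proof -
  define N where "N = nat \<lfloor>Q\<rfloor>"
  define S where "S = (\<Sum>m | m \<in> {1..N} \<and> squarefree m. 1 / real m)"
  have N: "N \<ge> 1" "real N \<le> Q" "Q < real N + 1" using Q by (auto simp: N_def le_nat_iff le_floor_iff)
  have Np: "Q < real p \<longleftrightarrow> N < p" for p using Q by (simp add: N_def nat_less_iff floor_less_iff)
  have "ln Q \<le> ln (real N + 1)" using N Q by simp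
  also have "\<dots> \<le> 2 * S" unfolding S_def by (rule ln_le_sum_inverse_squarefree)
  finally have S: "ln Q \<le> 2 * S" .
  have lnQ: "ln Q > 0" using Q by simp
  have "real (card {n. u < real n \<and> real n \<le> w \<and> (\<forall>p. prime p \<longrightarrow> p dvd n \<longrightarrow> N < p)})
      \<le> (w - u) / S + real N ^ 4"
    unfolding S_def by (intro card_sifted_le u N)
  also have "\<dots> \<le> 2 * (w - u) / ln Q + Q ^ 4"
  proof (intro add_mono power_mono)
    have "(w - u) / S \<le> (w - u) / (ln Q / 2)" using S lnQ u by (intro divide_left_mono) auto
    then show "(w - u) / S \<le> 2 * (w - u) / ln Q" by (simp add: algebra_simps)
  qed (use N in auto)
  finally show ?thesis by (simp add: Np)
qed

section \<open>Sums over primes\<close>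

lemma sum_ln_prime_factors_le:
  assumes "n \<ge> 1"
  shows "(\<Sum>p\<in>prime_factors n. ln (real p)) \<le> ln (real n)"
proof -
  have "(\<Prod>p\<in>prime_factors n. p) dvd (\<Prod>p\<in>prime_factors n. p ^ multiplicity p n)"
    by (intro prod_dvd_prod dvd_power) (auto simp: prime_factors_multiplicity)
  also have "(\<Prod>p\<in>prime_factors n. p ^ multiplicity p n) = n"
    using assms by (intro prime_factorization_nat[symmetric]) simp
  finally have "(\<Prod>p\<in>prime_factors n. p) \<le> n" using assms by (intro dvd_imp_le) auto
  then have le: "(\<Prod>p\<in>prime_factors n. real p) \<le> real n" by (simp flip: of_nat_prod)
  have pos: "real p > 0" if "p \<in> prime_factors n" for p
    using that by (auto dest!: in_prime_factors_imp_prime prime_gt_0_nat)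
  have "(\<Sum>p\<in>prime_factors n. ln (real p)) = ln (\<Prod>p\<in>prime_factors n. real p)"
    using pos by (intro ln_prod[symmetric]) auto
  also have "\<dots> \<le> ln (real n)" using le assms pos by (subst ln_le_cancel_iff) (auto intro!: prod_pos)
  finally show ?thesis .
qed

text \<open>An upper bound of Mertens type. Summing \<open>ln p\<close> over the prime divisors of
  all \<open>n \<le> N\<close> gives at most \<open>N * ln N\<close>, while each prime
  \<open>p \<le> N\<close> is counted \<open>N div p\<close> times, which is at least N / (2
  p).\<close>

lemma sum_ln_prime_div_le:
  assumes N: "N \<ge> 1"
  shows "(\<Sum>p | prime p \<and> p \<le> N. ln (real p) / real p) \<le> 2 * ln (real N)"
proof -
  define P where "P = {p. prime p \<and> p \<le> N}"
  have finP: "finite P" by (simp add: P_def)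
  have "real N * (\<Sum>p\<in>P. ln (real p) / real p) = (\<Sum>p\<in>P. ln (real p) * (real N / real p))"
    by (simp add: sum_distrib_left mult_ac)
  also have "\<dots> \<le> (\<Sum>p\<in>P. ln (real p) * (2 * real (N div p)))"
  proof (intro sum_mono mult_left_mono)
    fix p assume p: "p \<in> P"
    then have p': "p > 0" "p \<le> N" using prime_gt_0_nat by (auto simp: P_def)
    then have "N div p \<ge> 1" by (simp add: Suc_le_eq div_greater_zero_iff)
    then have "p * 1 \<le> p * (N div p)" by (intro mult_left_mono) auto
    moreover have "N mod p < p" using p' by simp
    moreover have "N = p * (N div p) + N mod p" by simp
    ultimately have "N \<le> 2 * (p * (N div p))" by linarith
    then have "real N \<le> real (2 * (p * (N div p)))" by (rule of_nat_mono)
    then show "real N / real p \<le> 2 * real (N div p)" using p' by (simp add: field_simps)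
    show "ln (real p) \<ge> 0" using p' by simp
  qed
  also have "\<dots> = 2 * (\<Sum>p\<in>P. \<Sum>n | n \<in> {1..N} \<and> p dvd n. ln (real p))"
  proof -
    have "card {n \<in> {1..N}. p dvd n} = N div p" if "p \<in> P" for p
    proof -
      have p0: "p > 0" using that prime_gt_0_nat by (auto simp: P_def)
      have "{n \<in> {1..N}. p dvd n} = (*) p ` {1..N div p}"
      proof safe
        fix n assume n: "n \<in> {1..N}" "p dvd n"
        then obtain c where "n = p * c" by (auto elim: dvdE)
        then show "n \<in> (*) p ` {1..N div p}"
          using n p0 div_le_mono[of n N p] by (intro image_eqI[of _ _ c]) (auto intro!: Suc_leI Nat.gr0I)
      next
        fix m assume m: "m \<in> {1..N div p}"
        have "p * m \<le> p * (N div p)" using m by simp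
        also have "\<dots> \<le> N" by simp
        finally show "p * m \<in> {1..N}" using m p0 by (auto simp: Suc_le_eq)
      qed simp
      then show ?thesis using p0 by (simp add: card_image inj_on_def)
    qed
    then show ?thesis by (simp add: sum_distrib_left mult_ac)
  qed
  also have "(\<Sum>p\<in>P. \<Sum>n | n \<in> {1..N} \<and> p dvd n. ln (real p))
      = (\<Sum>n\<in>{1..N}. \<Sum>p | p \<in> P \<and> p dvd n. ln (real p))"
    using finP by (intro sum.swap_restrict) auto
  also have "\<dots> = (\<Sum>n\<in>{1..N}. \<Sum>p\<in>prime_factors n. ln (real p))"
  proof (intro sum.cong refl)
    fix n assume n: "n \<in> {1..N}"
    have "p \<in> P \<and> p dvd n \<longleftrightarrow> p \<in> prime_factors n" for p
      using n dvd_imp_le[of p n] by (auto simp: P_def prime_factors_dvd)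
    then show "{p. p \<in> P \<and> p dvd n} = prime_factors n" by blast
  qed
  also have "\<dots> \<le> (\<Sum>n\<in>{1..N}. ln (real N))"
    by (intro sum_mono order.trans[OF sum_ln_prime_factors_le]) auto
  also have "\<dots> = real N * ln (real N)" by simp
  finally have "real N * (\<Sum>p\<in>P. ln (real p) / real p) \<le> real N * (2 * ln (real N))" by simp
  then show ?thesis using N by (simp add: P_def)
qed

lemma tau_ge_1:
  assumes "k \<ge> 1" "n \<ge> 1"
  shows "tau k n \<ge> 1"
proof -
  have "prod_list (replicate j (1 :: nat)) = 1" for j by (induction j) auto
  then have "n # replicate (k - 1) 1 \<in> {ds :: nat list. length ds = k \<and> (\<forall>d\<in>set ds. d \<ge> 1) \<and> prod_list ds = n}"
    using assms by auto
  then have "card {n # replicate (k - 1) 1}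
      \<le> card {ds :: nat list. length ds = k \<and> (\<forall>d\<in>set ds. d \<ge> 1) \<and> prod_list ds = n}"
    using assms by (intro card_mono finite_factor_lists) auto
  then show ?thesis unfolding tau_def by simp
qed

text \<open>By convexity of the exponential function, p^\<delta> - 1 lies below the chord (ln p / ln
  v) (v^\<delta> - 1), so the sum of \<open>ln p / p\<close> over primes applies directly and
  partial summation is avoided. The bound is uniform in \<open>\<delta>\<close>.\<close>

lemma sum_prime_powr_le:
  fixes \<delta> v :: real
  assumes \<delta>: "\<delta> \<ge> 0" and v: "v \<ge> 1"
  shows "(\<Sum>p | prime p \<and> real p \<le> v. (real p powr \<delta> - 1) / real p) \<le> 2 * v powr \<delta>"
proof (cases "v < 2")
  case True
  then have none: "{p. prime p \<and> real p \<le> v} = {}" by (auto dest!: prime_ge_2_nat)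
  show ?thesis unfolding none by simp
next
  case False
  define N where "N = nat \<lfloor>v\<rfloor>"
  have N: "N \<ge> 1" "real N \<le> v" and Np: "real p \<le> v \<longleftrightarrow> p \<le> N" for p
    using v by (auto simp: N_def le_nat_iff le_floor_iff)
  have lnv: "ln v > 0" using False by simp
  have "(\<Sum>p | prime p \<and> real p \<le> v. (real p powr \<delta> - 1) / real p)
      \<le> (\<Sum>p | prime p \<and> p \<le> N. (v powr \<delta> - 1) / ln v * (ln (real p) / real p))"
    unfolding Np
  proof (rule sum_mono)
    fix p assume "p \<in> {p. prime p \<and> p \<le> N}"
    then have p: "1 \<le> real p" "real p \<le> v" using N prime_ge_1_nat[of p] by auto
    define t where "t = ln (real p) / ln v"
    have t: "0 \<le> t" "0 \<le> 1 - t" using p lnv by (auto simp: t_def)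
    have "real p powr \<delta> = (v powr \<delta>) powr t * 1 powr (1 - t)"
      using p v lnv by (simp add: powr_def t_def)
    also have "\<dots> \<le> t * v powr \<delta> + (1 - t) * 1"
      using v t by (intro Youngs_inequality_0) auto
    finally have "real p powr \<delta> - 1 \<le> t * (v powr \<delta> - 1)" by (simp add: algebra_simps)
    then have "(real p powr \<delta> - 1) / real p \<le> t * (v powr \<delta> - 1) / real p"
      by (intro divide_right_mono) auto
    then show "(real p powr \<delta> - 1) / real p \<le> (v powr \<delta> - 1) / ln v * (ln (real p) / real p)"
      by (simp add: t_def mult_ac)
  qed
  also have "\<dots> = (v powr \<delta> - 1) / ln v * (\<Sum>p | prime p \<and> p \<le> N. ln (real p) / real p)"
    by (rule sum_distrib_left[symmetric])
  also have "\<dots> \<le> (v powr \<delta> - 1) / ln v * (2 * ln v)"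
  proof (rule mult_left_mono)
    have "ln (real N) \<le> ln v" using N by simp
    then show "(\<Sum>p | prime p \<and> p \<le> N. ln (real p) / real p) \<le> 2 * ln v"
      using sum_ln_prime_div_le[OF N(1)] by linarith
    show "(v powr \<delta> - 1) / ln v \<ge> 0" using v lnv \<delta> by (simp add: ge_one_powr_ge_zero)
  qed
  also have "\<dots> = 2 * (v powr \<delta> - 1)" using lnv by simp
  finally show ?thesis by simp
qed

text \<open>In the extreme case \<open>p = 2\<close>, \<open>\<delta> = 2 / 5\<close> this is
  (3/2)^5 < 2^3. It keeps \<open>1 - s\<close> at least 1/3 in every Euler factor.\<close>

lemma prime_powr_le_two_thirds:
  fixes \<delta> :: real
  assumes p: "prime p" and \<delta>: "\<delta> \<le> 2 / 5"
  shows "real p powr (\<delta> - 1) \<le> 2 / 3"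
proof -
  have p2: "real p \<ge> 2" using prime_ge_2_nat[OF p] by simp
  have "3 / 2 = ((3 / 2 :: real) powr 5) powr (1 / 5)" by (simp only: powr_powr) simp
  also have "\<dots> \<le> (2 powr 3) powr (1 / 5)"
    by (intro powr_mono2) (auto simp: power_divide)
  also have "\<dots> = (2 :: real) powr (3 / 5)" by (simp only: powr_powr) simp
  finally have two: "3 / 2 \<le> (2 :: real) powr (3 / 5)" .
  have "real p powr (\<delta> - 1) \<le> real p powr (- (3 / 5))" using \<delta> p2 by (intro powr_mono) auto
  also have "\<dots> \<le> 2 powr (- (3 / 5))" using p2 by (intro powr_mono2') auto
  also have "\<dots> = 1 / 2 powr (3 / 5)" by (simp add: powr_minus field_simps)
  also have "\<dots> \<le> 1 / (3 / 2)" using two by (intro divide_left_mono) auto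
  finally show ?thesis by simp
qed

section \<open>Euler factors and sums of \<open>f a / a\<close> over smooth \<open>a\<close>\<close>

context tau_submultiplicative
begin

text \<open>Each increment of the weight is \<open>1 - real p powr (- \<delta>)\<close> times the
  weight itself. Keeping this factor in front of the series makes the bound tend to 1 as
  \<open>\<delta>\<close> tends to 0.\<close>

lemma euler_factor_le:
  fixes \<delta> :: real
  assumes p: "prime p" and \<delta>: "0 \<le> \<delta>" "\<delta> < 1"
  shows "euler_factor \<delta> N p \<le> 1 + (1 - real p powr (- \<delta>)) * ((1 / (1 - real p powr (\<delta> - 1))) ^ k - 1)"
proof -
  define s where "s = real p powr (\<delta> - 1)"
  have p1: "real p > 1" using prime_gt_1_nat[OF p] by simp
  have "s < real p powr 0" unfolding s_def using \<delta> p1 by (intro powr_less_mono) auto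
  then have s: "0 \<le> s" "s < 1" using p1 by (auto simp: s_def)
  have "euler_factor \<delta> N p = 1 + (\<Sum>j=1..N. (1 - real p powr (- \<delta>)) * (real (tau k (p ^ j)) * s ^ j))"
    unfolding euler_factor_def
  proof (intro arg_cong2[of _ _ _ _ "(+)"] sum.cong refl)
    fix j assume j: "j \<in> {1..N}"
    have "real p powr (\<delta> * real (j - 1)) = real p powr (\<delta> * real j) * real p powr (- \<delta>)"
      using j by (simp add: of_nat_diff algebra_simps flip: powr_add)
    moreover have "s ^ j = real p powr (\<delta> * real j) / real (p ^ j)"
    proof -
      have "s ^ j = s powr real j" using p1 by (simp add: s_def powr_realpow)
      also have "\<dots> = real p powr (\<delta> * real j - real j)" by (simp add: s_def powr_powr algebra_simps)
      also have "\<dots> = real p powr (\<delta> * real j) / real (p ^ j)"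
        using p1 by (simp add: powr_diff powr_realpow)
      finally show ?thesis .
    qed
    ultimately show "(real p powr (\<delta> * real j) - real p powr (\<delta> * real (j - 1))) * (real (tau k (p ^ j)) / real (p ^ j))
        = (1 - real p powr (- \<delta>)) * (real (tau k (p ^ j)) * s ^ j)"
      by (simp add: algebra_simps diff_divide_distrib del: of_nat_power)
  qed
  also have "\<dots> = 1 + (1 - real p powr (- \<delta>)) * (\<Sum>j=1..N. real (tau k (p ^ j)) * s ^ j)"
    by (simp add: sum_distrib_left)
  also have "\<dots> \<le> 1 + (1 - real p powr (- \<delta>)) * ((1 / (1 - s)) ^ k - 1)"
  proof (intro add_left_mono mult_left_mono)
    \<comment> \<open>The term \<open>j = 0\<close> is at least 1, which accounts for the
      \<open>- 1\<close> in the bound.\<close>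
    have "(\<Sum>j\<le>N. real (tau k (p ^ j)) * s ^ j) = real (tau k 1) + (\<Sum>j=1..N. real (tau k (p ^ j)) * s ^ j)"
      unfolding atMost_atLeast0 by (subst sum.atLeast_Suc_atMost) auto
    then show "(\<Sum>j=1..N. real (tau k (p ^ j)) * s ^ j) \<le> (1 / (1 - s)) ^ k - 1"
      using sum_tau_prime_power_le[OF p s, of k N] of_nat_mono[OF tau_ge_1[OF k_pos order.refl], where ?'a = real]
      by simp
    have "real p powr (- \<delta>) \<le> real p powr 0" using p1 \<delta> by (intro powr_mono) auto
    then show "0 \<le> 1 - real p powr (- \<delta>)" using p1 by simp
  qed
  finally show ?thesis unfolding s_def .
qed

text \<open>The case \<open>k = 1\<close> is singled out because the constant of the main theorem is far too small there
  to absorb a contribution from the small primes.\<close>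

definition rankin_const :: real where
  "rankin_const = (if k = 1 then 0 else 18 * real k ^ 3)"

text \<open>Twice the coefficient that a single Euler factor contributes to the exponent; the 2
  comes from \<open>sum_prime_powr_le\<close>.\<close>

definition rankin_slope :: real where
  "rankin_slope = (if k = 1 then 6 else 12 * real k)"

text \<open>If \<open>3 * k * s \<le> 1\<close>, then
  \<open>(1 / (1 - s)) ^ k \<le> exp (3 * k * s)\<close> is at most 1 + 6 k s. Otherwise
  \<open>s\<close> exceeds 1 / (3 k), which forces the square root of \<open>p\<close> below 3 k,
  and such primes pay the crude factor \<open>exp (2 * k)\<close>. For \<open>k = 1\<close> the
  identity 1 / (1 - s) - 1 = s / (1 - s) gives a linear bound for all primes at once.\<close>

lemma euler_factor_le_exp:
  fixes \<delta> :: real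
  assumes p: "prime p" and \<delta>: "0 \<le> \<delta>" "\<delta> \<le> 2 / 5"
  shows "euler_factor \<delta> N p \<le> exp (rankin_slope / 2 * ((real p powr \<delta> - 1) / real p)
      + (if k \<noteq> 1 \<and> p \<le> 9 * k\<^sup>2 then 2 * real k else 0))"
proof -
  define s where "s = real p powr (\<delta> - 1)"
  define t where "t = 1 - real p powr (- \<delta>)"
  have p1: "real p > 1" using prime_gt_1_nat[OF p] by simp
  have s: "0 < s" "s \<le> 2 / 3" using prime_powr_le_two_thirds[OF p \<delta>(2)] p1 by (auto simp: s_def)
  have "real p powr (- \<delta>) \<le> real p powr 0" using p1 \<delta> by (intro powr_mono) auto
  then have t: "0 \<le> t" "t \<le> 1" using p1 by (auto simp: t_def)
  have ts: "t * s = (real p powr \<delta> - 1) / real p"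
    using p1 by (simp add: s_def t_def left_diff_distrib powr_diff powr_minus diff_divide_distrib)
  have E: "euler_factor \<delta> N p \<le> 1 + t * ((1 / (1 - s)) ^ k - 1)"
    unfolding s_def t_def using \<delta> by (intro euler_factor_le p) auto
  have "s / (1 - s) \<le> s / (1 / 3)" using s by (intro divide_left_mono) auto
  then have s3: "s / (1 - s) \<le> 3 * s" by simp
  have inv_s: "1 / (1 - s) = 1 + s / (1 - s)" using s by (simp add: field_simps)
  show ?thesis
  proof (cases "k = 1")
    case True
    have "euler_factor \<delta> N p \<le> 1 + t * (3 * s)"
      using E s3 t mult_left_mono[OF s3 t(1)] by (simp add: True inv_s)
    also have "\<dots> = 1 + 3 * (t * s)" by simp
    also have "\<dots> \<le> exp (3 * (t * s))" by (rule exp_ge_add_one_self)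
    finally have "euler_factor \<delta> N p \<le> exp (rankin_slope / 2 * (t * s))"
      unfolding rankin_slope_def if_P[OF True] by simp
    then show ?thesis using True unfolding ts by simp
  next
    case False
    have slope: "rankin_slope / 2 * ((real p powr \<delta> - 1) / real p) = t * (6 * real k * s)"
      using False by (simp add: rankin_slope_def ts[symmetric])
    have "1 / (1 - s) \<le> exp (s / (1 - s))" unfolding inv_s by (rule exp_ge_add_one_self)
    also have "\<dots> \<le> exp (3 * s)" using s3 by simp
    finally have "(1 / (1 - s)) ^ k \<le> exp (3 * s) ^ k" using s by (intro power_mono) auto
    also have "\<dots> = exp (real k * (3 * s))" by (rule exp_of_nat_mult[symmetric])
    finally have pow: "(1 / (1 - s)) ^ k \<le> exp (3 * real k * s)" by (simp add: mult_ac)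
    show ?thesis
    proof (cases "3 * real k * s \<le> 1")
      case small: True
      have "exp (3 * real k * s) \<le> 1 + 3 * real k * s + (3 * real k * s)\<^sup>2"
        using small s by (intro exp_bound) auto
      also have "(3 * real k * s)\<^sup>2 \<le> 3 * real k * s"
        using small s unfolding power2_eq_square by (intro mult_left_le) auto
      finally have "(1 / (1 - s)) ^ k - 1 \<le> 6 * real k * s" using pow by linarith
      then have "t * ((1 / (1 - s)) ^ k - 1) \<le> t * (6 * real k * s)" using t by (intro mult_left_mono)
      then have "euler_factor \<delta> N p \<le> 1 + t * (6 * real k * s)" using E by linarith
      also have "\<dots> \<le> exp (t * (6 * real k * s))" by (rule exp_ge_add_one_self)
      also have "\<dots> \<le> exp (t * (6 * real k * s) + (if k \<noteq> 1 \<and> p \<le> 9 * k\<^sup>2 then 2 * real k else 0))"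
        by simp
      finally show ?thesis unfolding slope .
    next
      case large: False
      have "(1 / (1 - s)) ^ k \<ge> 1" using s by (intro one_le_power) auto
      then have "t * ((1 / (1 - s)) ^ k - 1) \<le> 1 * ((1 / (1 - s)) ^ k - 1)"
        using t by (intro mult_right_mono) auto
      then have "1 + t * ((1 / (1 - s)) ^ k - 1) \<le> (1 / (1 - s)) ^ k" by simp
      with E have "euler_factor \<delta> N p \<le> (1 / (1 - s)) ^ k" by (rule order.trans)
      also have "\<dots> \<le> exp (3 * real k * s)" by (rule pow)
      also have "\<dots> \<le> exp (2 * real k)" using s mult_left_mono[OF s(2), of "3 * real k"] by simp
      finally have E': "euler_factor \<delta> N p \<le> exp (2 * real k)" .
      have "1 / s = real p powr (1 - \<delta>)" using p1 by (simp add: s_def powr_diff)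
      moreover have "1 / s < 3 * real k" using large s by (simp add: field_simps)
      ultimately have "real p powr (1 - \<delta>) < 3 * real k" by simp
      moreover have "real p powr (1 / 2) \<le> real p powr (1 - \<delta>)" using p1 \<delta> by (intro powr_mono) auto
      ultimately have "real p powr (1 / 2) < 3 * real k" by linarith
      then have "sqrt (real p) < 3 * real k" using p1 by (simp add: powr_half_sqrt)
      then have "real p < (3 * real k)\<^sup>2" using real_less_lsqrt[of "sqrt (real p)"] p1
        by (metis less_eq_real_def of_nat_0_le_iff power_strict_mono real_sqrt_ge_zero real_sqrt_pow2 zero_less_numeral)
      then have "real p \<le> real (9 * k\<^sup>2)" by (simp add: power_mult_distrib)
      then have pk: "p \<le> 9 * k\<^sup>2" by (simp only: of_nat_le_iff)
      have "0 \<le> t * (6 * real k * s)" using t s by simp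
      then have "exp (2 * real k) \<le> exp (t * (6 * real k * s) + (if k \<noteq> 1 \<and> p \<le> 9 * k\<^sup>2 then 2 * real k else 0))"
        using pk False by simp
      with E' show ?thesis unfolding slope by linarith
    qed
  qed
qed

lemma prod_euler_factor_le:
  fixes \<delta> v :: real
  assumes \<delta>: "0 \<le> \<delta>" "\<delta> \<le> 2 / 5" and v: "v \<ge> 1"
  shows "(\<Prod>p | prime p \<and> real p \<le> v. euler_factor \<delta> N p) \<le> exp (rankin_const + rankin_slope * v powr \<delta>)"
proof -
  define P where "P = {p. prime p \<and> real p \<le> v}"
  have "P \<subseteq> {..nat \<lfloor>v\<rfloor>}" using v by (auto simp: P_def le_nat_iff le_floor_iff)
  then have fin: "finite P" by (rule finite_subset) simp
  have slope: "rankin_slope \<ge> 0" by (simp add: rankin_slope_def)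
  have nonneg: "euler_factor \<delta> N p \<ge> 0" if "p \<in> P" for p
  proof -
    have "p > 1" using that prime_gt_1_nat by (auto simp: P_def)
    then show ?thesis using \<delta> unfolding euler_factor_def
      by (intro add_nonneg_nonneg sum_nonneg mult_nonneg_nonneg) (auto intro!: powr_mono mult_left_mono)
  qed
  have "(\<Prod>p\<in>P. euler_factor \<delta> N p) \<le> (\<Prod>p\<in>P. exp (rankin_slope / 2 * ((real p powr \<delta> - 1) / real p)
      + (if k \<noteq> 1 \<and> p \<le> 9 * k\<^sup>2 then 2 * real k else 0)))"
    using nonneg \<delta> by (intro prod_mono conjI euler_factor_le_exp) (auto simp: P_def)
  also have "\<dots> = exp (\<Sum>p\<in>P. rankin_slope / 2 * ((real p powr \<delta> - 1) / real p)
      + (if k \<noteq> 1 \<and> p \<le> 9 * k\<^sup>2 then 2 * real k else 0))"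
    using fin by (simp add: exp_sum)
  also have "\<dots> = exp (rankin_slope / 2 * (\<Sum>p\<in>P. (real p powr \<delta> - 1) / real p)
      + (\<Sum>p\<in>P. if k \<noteq> 1 \<and> p \<le> 9 * k\<^sup>2 then 2 * real k else 0))"
    by (simp only: sum.distrib sum_distrib_left)
  also have "\<dots> \<le> exp (rankin_slope / 2 * (2 * v powr \<delta>) + rankin_const)"
    unfolding exp_le_cancel_iff
  proof (intro add_mono mult_left_mono)
    show "(\<Sum>p\<in>P. (real p powr \<delta> - 1) / real p) \<le> 2 * v powr \<delta>"
      unfolding P_def by (intro sum_prime_powr_le \<delta> v)
    show "(\<Sum>p\<in>P. if k \<noteq> 1 \<and> p \<le> 9 * k\<^sup>2 then 2 * real k else 0) \<le> rankin_const"
    proof (cases "k = 1")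
      case False
      have "(\<Sum>p\<in>P. if k \<noteq> 1 \<and> p \<le> 9 * k\<^sup>2 then 2 * real k else 0)
          = (\<Sum>p\<in>P. if p \<le> 9 * k\<^sup>2 then 2 * real k else 0)"
        using False by simp
      also have "\<dots> = (\<Sum>p\<in>{p\<in>P. p \<le> 9 * k\<^sup>2}. 2 * real k)"
        by (rule sum.inter_filter[OF fin, symmetric])
      \<comment> \<open>Counting all integers up to 9 k^2, each paying 2 k, yields the 18 k^3 of
        \<open>rankin_const\<close>.\<close>
      also have "\<dots> \<le> (\<Sum>p\<in>{1..9 * k\<^sup>2}. 2 * real k)"
        by (intro sum_mono2) (auto simp: P_def Suc_le_eq prime_gt_0_nat)
      also have "\<dots> = rankin_const" using False by (simp add: rankin_const_def power2_eq_square power3_eq_cube)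
      finally show ?thesis .
    next
      case True
      then show ?thesis unfolding rankin_const_def by simp
    qed
  qed (use slope in auto)
  finally show ?thesis by (simp add: P_def add.commute)
qed

text \<open>Rankin's trick: (a / z)^\<delta> is at least 1 on the sum, and for smooth
  \<open>a\<close> the power a^\<delta> is the product of the weights of
  \<open>rankin_induct\<close>. Afterwards the sum is extended to all \<open>a \<le> N\<close>,
  smooth or not, whose weights involve only primes up to \<open>v\<close>.\<close>

lemma sum_smooth_tail_le:
  fixes \<delta> v z :: real
  assumes \<delta>: "0 \<le> \<delta>" "\<delta> \<le> 2 / 5" and v: "v \<ge> 1" and z: "z > 0"
  shows "(\<Sum>a | a \<in> {1..N} \<and> z < real a \<and> (\<forall>p. prime p \<longrightarrow> p dvd a \<longrightarrow> real p \<le> v). f a / real a)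
      \<le> z powr (- \<delta>) * exp (rankin_const + rankin_slope * v powr \<delta>) * (\<Sum>a=1..N. f a / real a)"
proof -
  define P where "P = {p. prime p \<and> real p \<le> v}"
  define A where "A = {a. a \<in> {1..N} \<and> z < real a \<and> (\<forall>p. prime p \<longrightarrow> p dvd a \<longrightarrow> real p \<le> v)}"
  define h where "h a = (\<Prod>p\<in>P. real p powr (\<delta> * real (multiplicity p a)))" for a
  have "P \<subseteq> {..nat \<lfloor>v\<rfloor>}" using v by (auto simp: P_def le_nat_iff le_floor_iff)
  then have fin: "finite P" by (rule finite_subset) simp
  have h_smooth: "h a = real a powr \<delta>" if a: "a \<in> A" for a
  proof -
    have pf: "prime_factors a \<subseteq> P" using a by (auto simp: P_def A_def prime_factors_dvd)
    have "real a = real (\<Prod>p\<in>prime_factors a. p ^ multiplicity p a)"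
      using a by (intro arg_cong[of _ _ real] prime_factorization_nat) (auto simp: A_def)
    also have "\<dots> = (\<Prod>p\<in>prime_factors a. real p ^ multiplicity p a)" by simp
    also have "\<dots> powr \<delta> = (\<Prod>p\<in>prime_factors a. (real p ^ multiplicity p a) powr \<delta>)"
      by (rule prod_powr_distrib)
    also have "\<dots> = (\<Prod>p\<in>prime_factors a. real p powr (\<delta> * real (multiplicity p a)))"
    proof (intro prod.cong refl)
      fix p assume "p \<in> prime_factors a"
      then have "real p > 0" by (auto simp: prime_gt_0_nat in_prime_factors_imp_prime)
      then show "(real p ^ multiplicity p a) powr \<delta> = real p powr (\<delta> * real (multiplicity p a))"
        by (simp add: powr_powr mult.commute flip: powr_realpow)
    qed
    also have "\<dots> = h a"
      unfolding h_def using pf fin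
    proof (intro prod.mono_neutral_left)
      show "\<forall>p\<in>P - prime_factors a. real p powr (\<delta> * real (multiplicity p a)) = 1"
      proof
        fix p assume p: "p \<in> P - prime_factors a"
        then have "multiplicity p a = 0" "p > 0" by (auto simp: P_def prime_factors_multiplicity prime_gt_0_nat)
        then show "real p powr (\<delta> * real (multiplicity p a)) = 1" by simp
      qed
    qed
    finally show ?thesis by simp
  qed
  have term_nonneg: "f a / real a \<ge> 0" if "a \<in> {1..N}" for a using that nonneg[of a] by simp
  have "(\<Sum>a\<in>A. f a / real a) \<le> (\<Sum>a\<in>A. z powr (- \<delta>) * (f a / real a * h a))"
  proof (rule sum_mono)
    fix a assume a: "a \<in> A"
    have "1 = z powr (- \<delta>) * z powr \<delta>" using z by (simp flip: powr_add)
    also have "\<dots> \<le> z powr (- \<delta>) * h a"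
      unfolding h_smooth[OF a] using a z \<delta> by (intro mult_left_mono powr_mono2) (auto simp: A_def)
    finally have "f a / real a * 1 \<le> f a / real a * (z powr (- \<delta>) * h a)"
      using a term_nonneg by (intro mult_left_mono) (auto simp: A_def)
    then show "f a / real a \<le> z powr (- \<delta>) * (f a / real a * h a)" by (simp add: mult_ac)
  qed
  also have "\<dots> \<le> (\<Sum>a=1..N. z powr (- \<delta>) * (f a / real a * h a))"
  proof (rule sum_mono2)
    fix a assume "a \<in> {1..N} - A"
    then have "f a / real a \<ge> 0" using term_nonneg by blast
    then show "z powr (- \<delta>) * (f a / real a * h a) \<ge> 0"
      by (intro mult_nonneg_nonneg) (auto simp: h_def intro!: prod_nonneg)
  qed (auto simp: A_def)
  also have "\<dots> = z powr (- \<delta>) * (\<Sum>a=1..N. f a / real a * h a)" by (rule sum_distrib_left[symmetric])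
  also have "\<dots> \<le> z powr (- \<delta>) * ((\<Prod>p\<in>P. euler_factor \<delta> N p) * (\<Sum>a=1..N. f a / real a))"
    unfolding h_def using fin by (intro mult_left_mono rankin_induct \<delta>) (auto simp: P_def)
  also have "\<dots> \<le> z powr (- \<delta>) * (exp (rankin_const + rankin_slope * v powr \<delta>) * (\<Sum>a=1..N. f a / real a))"
    unfolding P_def
    by (intro mult_left_mono mult_right_mono prod_euler_factor_le \<delta> v sum_nonneg term_nonneg) auto
  finally show ?thesis by (simp add: A_def mult.assoc)
qed

end

section \<open>Splitting and counting\<close>

text \<open>The largest prime is stripped with its full power until the rest is at most
  \<open>z\<close>; the last prime stripped is \<open>q\<close>. Working from the top allows a
  strong induction on \<open>n\<close>, without listing its primes in increasing order.\<close>

lemma smooth_rough_split: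
  fixes z :: real
  assumes "z \<ge> 1" "z < real n"
  shows "\<exists>a b q e. n = a * b \<and> 1 \<le> a \<and> real a \<le> z \<and> prime q \<and> q ^ e dvd b \<and> z < real (a * q ^ e)
      \<and> (\<forall>p. prime p \<longrightarrow> p dvd a \<longrightarrow> p < q) \<and> (\<forall>p. prime p \<longrightarrow> p dvd b \<longrightarrow> q \<le> p)"
  using assms(2)
proof (induction n rule: less_induct)
  case (less n)
  have n: "n > 1" using less.prems assms(1) by (cases n) auto
  define p where "p = Max (prime_factors n)"
  have "n \<noteq> 1" using n by simp
  then obtain q where "prime q" "q dvd n" using prime_factor_nat by blast
  then have "prime_factors n \<noteq> {}" using n by (auto simp: prime_factors_dvd)
  then have "p \<in> prime_factors n" unfolding p_def by (intro Max_in) auto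
  then have p: "prime p" "p dvd n" by (auto simp: prime_factors_dvd)
  have max: "q \<le> p" if "prime q" "q dvd n" for q
    unfolding p_def using that n by (intro Max_ge) (auto simp: prime_factors_dvd)
  obtain m where m: "n = p ^ multiplicity p n * m" "\<not> p dvd m"
    using multiplicity_decompose'[of n p] n p(1) by (metis not_prime_unit not_one_less_zero)
  define j where "j = multiplicity p n"
  have n_eq: "n = m * p ^ j" using m by (simp add: j_def mult.commute)
  have m1: "m \<ge> 1" using n_eq n by (cases m) auto
  have m_primes: "q < p" if "prime q" "q dvd m" for q
    using max[of q] that m(2) n_eq by (cases "q = p") auto
  show ?case
  proof (cases "real m \<le> z")
    case True
    have "p \<le> q" if "prime q" "q dvd p ^ j" for q
      using that p(1) by (metis order.refl prime_dvd_power primes_dvd_imp_eq)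
    then show ?thesis
      using True n_eq m1 p(1) less.prems m_primes
      by (intro exI[of _ m] exI[of _ "p ^ j"] exI[of _ p] exI[of _ j]) simp
  next
    case False
    have "j > 0" using p n prime_multiplicity_gt_zero_iff[of p n] unfolding j_def by simp
    then have "p ^ j > 1" using prime_gt_1_nat[OF p(1)] by (metis one_less_power)
    then have "m < n" using n_eq m1 by simp
    then obtain a b q e where ab: "m = a * b" "1 \<le> a" "real a \<le> z" "prime q" "q ^ e dvd b"
        "z < real (a * q ^ e)" "\<forall>p. prime p \<longrightarrow> p dvd a \<longrightarrow> p < q" "\<forall>p. prime p \<longrightarrow> p dvd b \<longrightarrow> q \<le> p"
      using less.IH[of m] False by auto
    have "q \<le> r" if r: "prime r" "r dvd b * p ^ j" for r
    proof (cases "r dvd b")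
      case False
      then have "r dvd p ^ j" using r by (simp add: prime_dvd_mult_iff)
      then have "r = p" using r p(1) by (metis prime_dvd_power primes_dvd_imp_eq)
      \<comment> \<open>Since \<open>a \<le> z < a * q ^ e\<close>, the power is nontrivial, so
        \<open>q\<close> really divides \<open>m\<close> and lies below \<open>p\<close>.\<close>
      moreover have "e > 0" using ab(3,6) by (cases e) auto
      then have "q dvd m" using ab(1,5) by (metis dvd_power dvd_trans dvd_mult)
      then have "q < p" using m_primes ab(4) by blast
      ultimately show ?thesis by simp
    qed (use ab r in auto)
    then show ?thesis
      using ab n_eq
      by (intro exI[of _ a] exI[of _ "b * p ^ j"] exI[of _ q] exI[of _ e]) (simp add: mult.assoc dvd_mult2)
  qed
qed

section \<open>Counting integers of the interval that have a special divisor\<close>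

lemma finite_Ioc_nat: "finite {n :: nat. u < real n \<and> real n \<le> w}"
proof (rule finite_subset)
  show "{n :: nat. u < real n \<and> real n \<le> w} \<subseteq> {..nat \<lfloor>w\<rfloor>}" by (auto intro: le_nat_floor)
qed simp

lemma card_multiples_le:
  fixes x y :: real
  assumes "0 \<le> y" "y \<le> x" "d \<ge> 1" "real d \<le> y"
  shows "real (card {n. x - y < real n \<and> real n \<le> x \<and> d dvd n}) \<le> 2 * y / real d"
proof -
  have "real (card {n. x - y < real n \<and> real n \<le> x \<and> d dvd n})
      = (\<Sum>n | x - y < real n \<and> real n \<le> x. of_bool (d dvd n))"
    using finite_Ioc_nat[of "x - y" x] by (simp add: Int_def conj_assoc)
  also have "\<dots> \<le> y / real d + 1"
    using sum_multiples_approx[of "x - y" x d] assms by simp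
  also have "\<dots> \<le> y / real d + y / real d" using assms by (intro add_left_mono) simp
  finally show ?thesis by (simp add: add_divide_distrib)
qed

lemma card_multiples_of_set_le:
  fixes x y :: real
  assumes xy: "0 \<le> y" "y \<le> x" and D: "finite D" "\<And>d. d \<in> D \<Longrightarrow> d \<ge> 1 \<and> real d \<le> y"
  shows "real (card {n. x - y < real n \<and> real n \<le> x \<and> (\<exists>d\<in>D. d dvd n)}) \<le> 2 * y * (\<Sum>d\<in>D. 1 / real d)"
proof -
  have "{n. x - y < real n \<and> real n \<le> x \<and> (\<exists>d\<in>D. d dvd n)}
      = (\<Union>d\<in>D. {n. x - y < real n \<and> real n \<le> x \<and> d dvd n})" by auto
  then have "card {n. x - y < real n \<and> real n \<le> x \<and> (\<exists>d\<in>D. d dvd n)}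
      \<le> (\<Sum>d\<in>D. card {n. x - y < real n \<and> real n \<le> x \<and> d dvd n})"
    using card_UN_le[OF D(1)] by simp
  then have "real (card {n. x - y < real n \<and> real n \<le> x \<and> (\<exists>d\<in>D. d dvd n)})
      \<le> real (\<Sum>d\<in>D. card {n. x - y < real n \<and> real n \<le> x \<and> d dvd n})" by (rule of_nat_mono)
  also have "\<dots> \<le> (\<Sum>d\<in>D. 2 * y / real d)"
    unfolding of_nat_sum using D xy by (intro sum_mono card_multiples_le) auto
  finally show ?thesis by (simp add: sum_distrib_left)
qed

lemma sum_inverse_le_ln: "N \<ge> 1 \<Longrightarrow> (\<Sum>n=1..N. 1 / real n) \<le> 1 + ln (real N)"
proof -
  assume N: "N \<ge> 1"
  have "harm (Suc (N - 1)) - ln (real (Suc (N - 1))) \<le> harm (Suc 0) - ln (real (Suc 0))"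
    using decseqD[OF decseq_harm_diff_ln, of 0 "N - 1"] by simp
  then show ?thesis using N by (simp add: harm_def inverse_eq_divide)
qed

text \<open>For each \<open>q\<close> take the least power \<open>m q > w\<close>. It exceeds \<open>w\<close> and is at least \<open>q\<^sup>2\<close>, hence at least the
  geometric mean \<open>\<surd>w q\<close>, and the sum over \<open>q\<close> becomes harmonic.\<close>

lemma card_large_power_divisor_le:
  fixes x y w :: real
  assumes w: "w \<ge> 1" "w\<^sup>2 \<le> y" and xy: "y \<le> x"
  shows "real (card {n. x - y < real n \<and> real n \<le> x \<and> (\<exists>q e. 2 \<le> q \<and> real q \<le> w \<and> q ^ e dvd n \<and> w < real (q ^ e))})
      \<le> 2 * y / sqrt w * (1 + ln w)"
proof -
  define m where "m q = q ^ (LEAST e. w < real (q ^ e))" for q :: nat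
  define N where "N = nat \<lfloor>w\<rfloor>"
  have N: "N \<ge> 1" "real N \<le> w" and Nq: "real q \<le> w \<longleftrightarrow> q \<le> N" for q
    using w by (auto simp: N_def le_nat_iff le_floor_iff)
  have y0: "y \<ge> 0" using w by (meson order.trans zero_le_power2)
  have m: "w < real (m q)" "real (m q) \<le> w\<^sup>2" "sqrt w * real q \<le> real (m q)"
    "\<And>e n. w < real (q ^ e) \<Longrightarrow> q ^ e dvd n \<Longrightarrow> m q dvd n" if q: "2 \<le> q" "real q \<le> w" for q
  proof -
    define e where "e = (LEAST e. w < real (q ^ e))"
    obtain i where "w < real q ^ i" using q real_arch_pow[of "real q" w] by auto
    then have "w < real (q ^ i)" by simp
    then show gt: "w < real (m q)" unfolding m_def by (rule LeastI)
    have least: "e \<le> i" if "w < real (q ^ i)" for i unfolding e_def using that by (rule Least_le)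
    have mq: "m q = q ^ e" by (simp add: m_def e_def)
    \<comment> \<open>As \<open>q \<le> w\<close>, the least power above \<open>w\<close> is at
      least a square. Its predecessor is at most \<open>w\<close>, so it is itself at most w^2 \<le>
      y, which the divisor count needs.\<close>
    have "e \<noteq> 0" "e \<noteq> 1" by (rule notI, use gt w q in \<open>simp add: mq\<close>)+
    then obtain i where i: "e = Suc i" "i \<ge> 1" by (cases e) auto
    have "\<not> w < real (q ^ i)" using least[of i] i by auto
    then have "real q * real (q ^ i) \<le> w * w" using q w by (intro mult_mono) auto
    then show "real (m q) \<le> w\<^sup>2" by (simp add: mq i power2_eq_square)
    have "q ^ 2 \<le> m q" unfolding mq using q i by (intro power_increasing) auto
    then have q2: "(real q)\<^sup>2 \<le> real (m q)" by (metis of_nat_le_iff of_nat_power)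
    have "(sqrt w * real q)\<^sup>2 = w * (real q)\<^sup>2" using w by (simp add: power_mult_distrib)
    also have "\<dots> \<le> real (m q) * real (m q)" using gt q2 w by (intro mult_mono) auto
    finally have "(sqrt w * real q)\<^sup>2 \<le> (real (m q))\<^sup>2" by (simp add: power2_eq_square)
    then show "sqrt w * real q \<le> real (m q)" by (rule power2_le_imp_le) simp
    show "m q dvd n" if "w < real (q ^ i)" "q ^ i dvd n" for i n
      using least[OF that(1)] that(2) unfolding mq by (meson dvd_trans le_imp_power_dvd)
  qed
  have "real (card {n. x - y < real n \<and> real n \<le> x \<and> (\<exists>q e. 2 \<le> q \<and> real q \<le> w \<and> q ^ e dvd n \<and> w < real (q ^ e))})
      \<le> real (card {n. x - y < real n \<and> real n \<le> x \<and> (\<exists>d\<in>m ` {2..N}. d dvd n)})"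
  proof (intro of_nat_mono card_mono subsetI)
    show "finite {n. x - y < real n \<and> real n \<le> x \<and> (\<exists>d\<in>m ` {2..N}. d dvd n)}"
      by (rule finite_subset[OF _ finite_Ioc_nat[of "x - y" x]]) auto
  next
    fix n assume "n \<in> {n. x - y < real n \<and> real n \<le> x \<and> (\<exists>q e. 2 \<le> q \<and> real q \<le> w \<and> q ^ e dvd n \<and> w < real (q ^ e))}"
    then obtain q e where n: "x - y < real n" "real n \<le> x"
      and q: "2 \<le> q" "real q \<le> w" "q ^ e dvd n" "w < real (q ^ e)" by auto
    have "m q dvd n" using m(4)[OF q(1,2,4,3)] .
    moreover have "q \<in> {2..N}" using q Nq by auto
    ultimately show "n \<in> {n. x - y < real n \<and> real n \<le> x \<and> (\<exists>d\<in>m ` {2..N}. d dvd n)}" using n by blast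
  qed
  also have "\<dots> \<le> 2 * y * (\<Sum>d\<in>m ` {2..N}. 1 / real d)"
  proof (rule card_multiples_of_set_le[OF y0 xy])
    fix d assume "d \<in> m ` {2..N}"
    then obtain q where q: "2 \<le> q" "real q \<le> w" "d = m q" using Nq by auto
    then have "1 < real d" "real d \<le> y" using m(1,2)[OF q(1,2)] w by auto
    then show "d \<ge> 1 \<and> real d \<le> y" by simp
  qed simp
  also have "\<dots> \<le> 2 * y * (\<Sum>q\<in>{2..N}. 1 / real (m q))"
    using y0 by (intro mult_left_mono sum_image_le[unfolded o_def]) auto
  also have "\<dots> \<le> 2 * y * (\<Sum>q\<in>{2..N}. 1 / sqrt w * (1 / real q))"
  proof (intro mult_left_mono sum_mono)
    fix q assume "q \<in> {2..N}"
    then have q: "2 \<le> q" "real q \<le> w" using Nq by auto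
    have "1 / real (m q) \<le> 1 / (sqrt w * real q)"
      using m(3)[OF q] m(1)[OF q] q w by (intro divide_left_mono mult_pos_pos) auto
    then show "1 / real (m q) \<le> 1 / sqrt w * (1 / real q)" by simp
  qed (use y0 in auto)
  also have "\<dots> \<le> 2 * y * (\<Sum>q\<in>{1..N}. 1 / sqrt w * (1 / real q))"
    using y0 w by (intro mult_left_mono sum_mono2) auto
  also have "\<dots> = 2 * y / sqrt w * (\<Sum>q\<in>{1..N}. 1 / real q)"
    unfolding sum_distrib_left by (intro sum.cong) auto
  also have "\<dots> \<le> 2 * y / sqrt w * (1 + ln w)"
  proof (rule mult_left_mono)
    have "ln (real N) \<le> ln w" using N w by simp
    then show "(\<Sum>q\<in>{1..N}. 1 / real q) \<le> 1 + ln w" using sum_inverse_le_ln[OF N(1)] by simp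
  qed (use y0 w in auto)
  finally show ?thesis .
qed

text \<open>A union bound over the smooth divisors \<open>a\<close>, whose reciprocals are summed by
  Rankin's trick for the constant function 1. The largest admissible exponent 2/5, applied beyond
  \<open>sqrt z\<close>, saves z^(1/5).\<close>

lemma card_smooth_divisor_le:
  fixes x y z v :: real
  assumes z: "z \<ge> 1" "z \<le> y" and xy: "y \<le> x" and v: "v \<ge> 1"
  shows "real (card {n. x - y < real n \<and> real n \<le> x \<and>
        (\<exists>a. a \<in> {1..nat \<lfloor>z\<rfloor>} \<and> sqrt z < real a \<and> (\<forall>p. prime p \<longrightarrow> p dvd a \<longrightarrow> real p \<le> v) \<and> a dvd n)})
      \<le> 2 * y * (z powr (- (1 / 5)) * exp (6 * v powr (2 / 5)) * (1 + ln z))"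
proof -
  interpret one: tau_submultiplicative "\<lambda>_. 1" 1
    by standard (use tau_ge_1[of 1] in auto)
  define N where "N = nat \<lfloor>z\<rfloor>"
  have N: "N \<ge> 1" "real N \<le> z" using z by (auto simp: N_def le_nat_iff le_floor_iff)
  define A where "A = {a. a \<in> {1..N} \<and> sqrt z < real a \<and> (\<forall>p. prime p \<longrightarrow> p dvd a \<longrightarrow> real p \<le> v)}"
  have const: "one.rankin_const = 0" "one.rankin_slope = 6"
    unfolding one.rankin_const_def one.rankin_slope_def by simp_all
  have "real (card {n. x - y < real n \<and> real n \<le> x \<and> (\<exists>a\<in>A. a dvd n)}) \<le> 2 * y * (\<Sum>a\<in>A. 1 / real a)"
  proof (rule card_multiples_of_set_le)
    fix a assume "a \<in> A"
    then have "a \<ge> 1" "real a \<le> real N" by (auto simp: A_def)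
    then show "a \<ge> 1 \<and> real a \<le> y" using N z by linarith
  qed (use z xy in \<open>auto simp: A_def\<close>)
  also have "(\<Sum>a\<in>A. 1 / real a)
      \<le> sqrt z powr (- (2 / 5)) * exp (6 * v powr (2 / 5)) * (\<Sum>a=1..N. 1 / real a)"
    using one.sum_smooth_tail_le[of "2 / 5" v "sqrt z" N] v z unfolding const A_def by simp
  also have "\<dots> \<le> sqrt z powr (- (2 / 5)) * exp (6 * v powr (2 / 5)) * (1 + ln z)"
  proof (rule mult_left_mono)
    have "ln (real N) \<le> ln z" using N z by simp
    then show "(\<Sum>a=1..N. 1 / real a) \<le> 1 + ln z" using sum_inverse_le_ln[OF N(1)] by simp
  qed auto
  also have "sqrt z powr (- (2 / 5)) = z powr (- (1 / 5))"
    using z by (simp add: powr_half_sqrt[symmetric] powr_powr)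
  finally have "real (card {n. x - y < real n \<and> real n \<le> x \<and> (\<exists>a\<in>A. a dvd n)})
      \<le> 2 * y * (z powr (- (1 / 5)) * exp (6 * v powr (2 / 5)) * (1 + ln z))"
    using z by (simp add: mult_left_mono)
  moreover have "{n. x - y < real n \<and> real n \<le> x \<and> (\<exists>a\<in>A. a dvd n)} = {n. x - y < real n \<and> real n \<le> x \<and>
        (\<exists>a. a \<in> {1..N} \<and> sqrt z < real a \<and> (\<forall>p. prime p \<longrightarrow> p dvd a \<longrightarrow> real p \<le> v) \<and> a dvd n)}"
    by (auto simp: A_def)
  ultimately show ?thesis by (simp add: N_def)
qed

section \<open>Products of a fixed prefix and a sieved cofactor\<close>

context tau_submultiplicative
begin

text \<open>For each \<open>a\<close> the cofactors lie in an interval of length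
  \<open>y / a\<close> and are sieved. The hypothesis \<open>level\<close> bounds the error
  \<open>Q ^ 4\<close> by half of the main term even for the largest \<open>a\<close>, which turns
  the sieve constant 2 into 3.\<close>

lemma sum_rough_cofactor_le:
  fixes x y z Q :: real
  assumes Q: "Q \<ge> 2" and z: "z > 0" and level: "Q ^ 4 * ln Q \<le> y / z" and y: "0 < y" "y \<le> x" and x: "x \<ge> 1"
    and A: "finite A" "\<And>a. a \<in> A \<Longrightarrow> a \<ge> 1 \<and> real a \<le> z"
  shows "(\<Sum>n | x - y < real n \<and> real n \<le> x \<and> (\<exists>a\<in>A. \<exists>b. n = a * b \<and> (\<forall>p. prime p \<longrightarrow> p dvd b \<longrightarrow> Q < real p)). f n)
      \<le> real k powr (ln x / ln Q) * (3 * y / ln Q) * (\<Sum>a\<in>A. f a / real a)"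
proof -
  define B where "B a = {b. (x - y) / real a < real b \<and> real b \<le> x / real a \<and>
      (\<forall>p. prime p \<longrightarrow> p dvd b \<longrightarrow> Q < real p)}" for a :: nat
  have lnQ: "ln Q > 0" using Q by simp
  have finB: "finite (B a)" for a
    unfolding B_def by (rule finite_subset[OF _ finite_Ioc_nat[of "(x - y) / real a" "x / real a"]]) auto
  have B_pos: "b \<ge> 1" if "b \<in> B a" for a b
  proof -
    have "0 \<le> (x - y) / real a" using y by simp
    also have "\<dots> < real b" using that by (simp add: B_def)
    finally show ?thesis by simp
  qed
  have "{n. x - y < real n \<and> real n \<le> x \<and> (\<exists>a\<in>A. \<exists>b. n = a * b \<and> (\<forall>p. prime p \<longrightarrow> p dvd b \<longrightarrow> Q < real p))}
      \<subseteq> (\<lambda>(a, b). b * a) ` (SIGMA a:A. B a)"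
  proof safe
    fix a b assume ab: "x - y < real (a * b)" "real (a * b) \<le> x" "a \<in> A"
      "\<forall>p. prime p \<longrightarrow> p dvd b \<longrightarrow> Q < real p"
    have "real a > 0" using A(2)[OF ab(3)] by simp
    then have "b \<in> B a" using ab by (simp add: B_def field_simps)
    then show "a * b \<in> (\<lambda>(a, b). b * a) ` (SIGMA a:A. B a)" using ab by (auto simp: mult.commute)
  qed
  then have "(\<Sum>n | x - y < real n \<and> real n \<le> x \<and> (\<exists>a\<in>A. \<exists>b. n = a * b \<and> (\<forall>p. prime p \<longrightarrow> p dvd b \<longrightarrow> Q < real p)). f n)
      \<le> (\<Sum>n\<in>(\<lambda>(a, b). b * a) ` (SIGMA a:A. B a). f n)"
    using A finB B_pos by (intro sum_mono2) (force intro!: nonneg finite_imageI)+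
  also have "\<dots> \<le> (\<Sum>(a, b)\<in>(SIGMA a:A. B a). f (b * a))"
  proof -
    have "f (case i of (a, b) \<Rightarrow> b * a) \<ge> 0" if "i \<in> (SIGMA a:A. B a)" for i
      using that A(2) B_pos by (auto intro!: nonneg)
    then have "(\<Sum>n\<in>(\<lambda>(a, b). b * a) ` (SIGMA a:A. B a). f n)
        \<le> sum (f \<circ> (\<lambda>(a, b). b * a)) (SIGMA a:A. B a)"
      using A finB by (intro sum_image_le) auto
    then show ?thesis by (simp add: o_def case_prod_unfold)
  qed
  also have "\<dots> = (\<Sum>a\<in>A. \<Sum>b\<in>B a. f (b * a))" using A finB by (intro sum.Sigma[symmetric]) auto
  also have "\<dots> \<le> (\<Sum>a\<in>A. \<Sum>b\<in>B a. real k powr (ln x / ln Q) * f a)"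
  proof (intro sum_mono)
    fix a b assume a: "a \<in> A" and b: "b \<in> B a"
    have a1: "a \<ge> 1" using A(2)[OF a] by simp
    have b1: "b \<ge> 1" using B_pos[OF b] .
    have "real b \<le> x / real a" using b by (simp add: B_def)
    also have "\<dots> \<le> x / 1" using a1 x by (intro divide_left_mono) auto
    finally have bx: "ln (real b) \<le> ln x" using b1 x by simp
    have "f (b * a) \<le> real k powr (ln (real b) / ln Q) * f a"
      using b Q a1 b1 by (intro le_powr_rough) (auto simp: B_def)
    also have "\<dots> \<le> real k powr (ln x / ln Q) * f a"
      using bx lnQ k_pos a1 by (intro mult_right_mono powr_mono divide_right_mono nonneg) auto
    finally show "f (b * a) \<le> real k powr (ln x / ln Q) * f a" .
  qed
  also have "\<dots> = (\<Sum>a\<in>A. real (card (B a)) * (real k powr (ln x / ln Q) * f a))" by simp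
  also have "\<dots> \<le> (\<Sum>a\<in>A. (3 * (y / real a) / ln Q) * (real k powr (ln x / ln Q) * f a))"
  proof (intro sum_mono mult_right_mono)
    fix a assume a: "a \<in> A"
    have a1: "a \<ge> 1" "real a \<le> z" using A(2)[OF a] by simp_all
    have "real (card (B a)) \<le> 2 * (x / real a - (x - y) / real a) / ln Q + Q ^ 4"
      unfolding B_def using a1 y by (intro card_rough_le Q) (auto intro: divide_right_mono)
    also have "x / real a - (x - y) / real a = y / real a" by (simp add: diff_divide_distrib)
    also have "Q ^ 4 \<le> (y / real a) / ln Q"
    proof -
      have "Q ^ 4 * ln Q \<le> y / z" by (rule level)
      also have "\<dots> \<le> y / real a" using a1 y z by (intro divide_left_mono) auto
      finally show ?thesis by (subst pos_le_divide_eq[OF lnQ])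
    qed
    finally show "real (card (B a)) \<le> 3 * (y / real a) / ln Q" by (simp add: add_divide_distrib)
    show "0 \<le> real k powr (ln x / ln Q) * f a" using a1 by (intro mult_nonneg_nonneg nonneg) auto
  qed
  also have "\<dots> = real k powr (ln x / ln Q) * (3 * y / ln Q) * (\<Sum>a\<in>A. f a / real a)"
    unfolding sum_distrib_left by (intro sum.cong) (auto simp: mult_ac)
  finally show ?thesis .
qed

end

section \<open>Comparing constants\<close>

lemma exp_ge_pow4: "t ^ 4 / 256 \<le> exp t" if "t \<ge> 0" for t :: real
proof -
  have "t / 4 \<le> exp (t / 4)" using exp_ge_add_one_self[of "t / 4"] by linarith
  then have "(t / 4) ^ 4 \<le> exp (t / 4) ^ 4" using that by (intro power_mono) auto
  then show ?thesis by (simp add: power_divide flip: exp_of_nat_mult)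
qed

text \<open>The maximum of r (M - ln r) + r is exp M, attained at r = exp M. The term
  \<open>- r\<close> on the right supplies the geometric decay that makes the sums over levels
  converge.\<close>

lemma mult_diff_ln_le: "r * (M - ln r) \<le> exp M - r" if "r > 0" for r M :: real
proof -
  have "ln (exp M / r) \<le> exp M / r - 1" using that by (intro ln_le_minus_one) auto
  then have "r * (M - ln r) \<le> r * (exp M / r - 1)" using that by (simp add: ln_div)
  then show ?thesis using that by (simp add: algebra_simps)
qed

lemma sum_exp_decay_le:
  fixes c :: real
  assumes "finite R" "c > 0"
  shows "(\<Sum>r\<in>R. exp (- c * real r)) \<le> 1 + 1 / c"
proof -
  define q where "q = exp (- c)"
  have q: "0 \<le> q" "q < 1" using assms by (auto simp: q_def)
  have "(\<Sum>r\<in>R. exp (- c * real r)) = (\<Sum>r\<in>R. q ^ r)"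
    by (simp add: q_def mult.commute flip: exp_of_nat_mult)
  also have "\<dots> \<le> (\<Sum>r. q ^ r)" using q assms by (intro sum_le_suminf summable_geometric) auto
  also have "\<dots> = 1 / (1 - q)" using q by (intro suminf_geometric) auto
  also have "\<dots> \<le> 1 + 1 / c"
  proof -
    have "(1 + c) * q \<le> exp c * q" using q by (intro mult_right_mono exp_ge_add_one_self) auto
    then have "(1 + c) * q \<le> 1" by (simp add: q_def flip: exp_add)
    then have "c \<le> (1 + c) * (1 - q)" by (simp add: algebra_simps)
    then show ?thesis using q assms by (simp add: field_simps)
  qed
  finally show ?thesis .
qed

text \<open>The threshold yields ln x \<ge> 10^20 l^2. One factor \<open>l\<close> is spent in
  passing from \<open>ln x\<close> to \<open>ln y\<close>, the other one gives
  \<open>l \<le> ln y\<close>.\<close>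

lemma large_x_bounds:
  fixes l x y :: real
  assumes l: "l \<ge> 1"
    and x: "x \<ge> exp (7 ^ 28 * (12 * exp 1 * l) powr (28 * ln (192 * exp 1 * l)))"
    and y: "x powr (1 / l) \<le> y"
  shows "ln y \<ge> 10 ^ 20" "ln x \<le> l * ln y" "l \<le> ln y"
proof -
  have e1: "exp 1 \<ge> (1 :: real)" by simp
  have "exp 1 * 1 \<le> exp 1 * (192 * l)" using l by (intro mult_left_mono) auto
  then have "ln (exp 1) \<le> ln (192 * exp 1 * l)" using l by (subst ln_le_cancel_iff) auto
  then have ln1: "1 \<le> ln (192 * exp 1 * l)" by simp
  have "1 * (12 * l) \<le> exp 1 * (12 * l)" using l e1 by (intro mult_right_mono) auto
  then have base: "12 * l \<le> 12 * exp 1 * l" by simp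
  then have base1: "1 \<le> 12 * exp 1 * l" using l by linarith
  have "12 ^ 2 * l ^ 2 = (12 * l) ^ 2" by (simp add: power_mult_distrib)
  also have "\<dots> \<le> (12 * exp 1 * l) ^ 2" using base l by (intro power_mono) auto
  also have "\<dots> \<le> (12 * exp 1 * l) ^ 28" using base1 by (intro power_increasing) auto
  also have "\<dots> = (12 * exp 1 * l) powr 28" using l by (simp add: powr_numeral)
  also have "\<dots> \<le> (12 * exp 1 * l) powr (28 * ln (192 * exp 1 * l))"
    using base1 ln1 by (intro powr_mono) auto
  finally have "7 ^ 28 * (12 ^ 2 * l ^ 2) \<le> 7 ^ 28 * (12 * exp 1 * l) powr (28 * ln (192 * exp 1 * l))"
    by (intro mult_left_mono) auto
  then have "exp (7 ^ 28 * (12 ^ 2 * l ^ 2)) \<le> x" using x by (meson exp_le_cancel_iff order.trans)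
  moreover from this have x0: "x > 0" by (meson exp_gt_zero less_le_trans)
  ultimately have "7 ^ 28 * (12 ^ 2 * l ^ 2) \<le> ln x" by (simp add: ln_ge_iff)
  moreover have "10 ^ 20 * (l * l) \<le> 7 ^ 28 * (12 ^ 2 * l ^ 2)" by (simp add: power2_eq_square)
  ultimately have lnx: "10 ^ 20 * (l * l) \<le> ln x" by linarith
  have "x powr (1 / l) > 0" using x0 by simp
  moreover from this have "y > 0" using y by (rule less_le_trans)
  ultimately have "ln (x powr (1 / l)) \<le> ln y" using y by (subst ln_le_cancel_iff) auto
  then have quot: "ln x / l \<le> ln y" using x0 by (simp add: ln_powr)
  then show "ln x \<le> l * ln y" using l by (simp add: field_simps)
  have "10 ^ 20 * l \<le> ln x / l" using lnx l by (simp add: field_simps)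
  then have big: "10 ^ 20 * l \<le> ln y" using quot by linarith
  then show "ln y \<ge> 10 ^ 20" "l \<le> ln y" using l by simp_all
qed

text \<open>Cubing 6 k^2 \<le> 5^k, nearly an equality at \<open>k = 2\<close>, beats the
  denominator k^3. The large factor makes \<open>rankin_const\<close>, which is 18 k^3, negligible
  against \<open>A_const k\<close>.\<close>

lemma A_const_ge:
  assumes "k \<ge> 2"
  shows "A_const k \<ge> 200000 * real k ^ 3"
proof -
  have "6 * real k ^ 2 \<le> 5 ^ k"
    using assms
  proof (induction k rule: dec_induct)
    case (step n)
    have "2 * real n \<le> real n * real n" using step by (intro mult_right_mono) auto
    moreover have "real n \<ge> 2" using step by simp
    ultimately have "1 + 2 * real n \<le> 4 * (real n * real n)" by linarith
    then have "(real n + 1) ^ 2 \<le> 5 * real n ^ 2" by (simp add: power2_eq_square algebra_simps)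
    then show ?case using step by (simp add: add.commute)
  qed simp
  then have "(6 * real k ^ 2) ^ 3 \<le> (5 ^ k) ^ 3" by (intro power_mono) auto
  also have "(5 ^ k) ^ 3 = (125 :: real) ^ k" by (simp flip: power_mult power_commutes) (simp add: power_mult mult.commute[of k])
  finally have "216 * real k ^ 6 \<le> 125 ^ k" by (simp add: power_mult_distrib flip: power_mult)
  then have "216 * real k ^ 6 * (1092 / real k ^ 3) \<le> A_const k"
    unfolding A_const_def by (intro mult_right_mono) auto
  moreover have "216 * real k ^ 6 * (1092 / real k ^ 3) = 235872 * real k ^ 3"
  proof -
    have eq: "real k ^ 6 = real k ^ 3 * real k ^ 3" by (simp flip: power_add)
    have cancel: "216 * (c * c) * (1092 / c) = 235872 * c" if "c \<noteq> 0" for c :: real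
      using that by simp
    show ?thesis unfolding eq by (rule cancel) (use assms in simp)
  qed
  moreover have "real k ^ 3 \<ge> 0" by simp
  ultimately show ?thesis by linarith
qed

lemma D_const_ge:
  "A_const k * max (A_const k) (2 * real k powr (5 * l * A_const k)) \<le> D_const k l"
proof -
  define Q where "Q = (2 * A_const k) powr (- A_const k / 4) * exp (B_const k l / exp 1)
    * real k powr (5 * l * B_const k l) * (if A_const k < B_const k l then 1 else 0)"
  have "Q \<ge> 0" by (simp add: Q_def)
  then show ?thesis unfolding D_const_def Q_def[symmetric] by simp
qed

text \<open>Young's inequality with weights 2/5 and 3/5 for \<open>r\<close> and the number 14,
  chosen because (24/5)^5 < 14^3.\<close>

lemma six_powr_two_fifths_le: "6 * r powr (2 / 5) \<le> r / 2 + 11" if "r > 0" for r :: real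
proof -
  have "(24 / 5 :: real) = ((24 / 5) powr 5) powr (1 / 5)" by (simp only: powr_powr) simp
  also have "\<dots> \<le> (14 powr 3) powr (1 / 5)" by (intro powr_mono2) (auto simp: power_divide)
  also have "\<dots> = (14 :: real) powr (3 / 5)" by (simp only: powr_powr) simp
  finally have "r powr (2 / 5) * (24 / 5) \<le> r powr (2 / 5) * 14 powr (3 / 5)"
    by (intro mult_left_mono) auto
  also have "\<dots> \<le> 2 / 5 * r + 3 / 5 * 14" using that by (intro Youngs_inequality_0) auto
  finally show ?thesis using that by simp
qed

section \<open>The sum over the levels \<open>r\<close> against the prescribed constants\<close>

context tau_submultiplicative
begin

text \<open>The cost of level \<open>r\<close> up to the common factor
  \<open>9 * l * (y / ln x)\<close> and the sum of \<open>f a / a\<close>: \<open>r + 1\<close> from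
  the sieve, the power of \<open>k\<close> from the primes of the cofactor, and the rest from
  Rankin's trick for the prefix.\<close>

definition level_term :: "real \<Rightarrow> nat \<Rightarrow> real" where
  "level_term l r = (real r + 1) * real k powr (3 * l * (real r + 1)) *
     (real r powr (- (real r / 5)) * exp (rankin_const + rankin_slope * real r powr (2 / 5)))"

lemma level_term_eq:
  assumes "r \<ge> 1"
  shows "level_term l r = (real r + 1) * exp (3 * (l * ln (real k)) * (real r + 1) - real r / 5 * ln (real r)
      + (rankin_const + rankin_slope * real r powr (2 / 5)))"
proof -
  have "real k powr (3 * l * (real r + 1)) = exp (3 * (l * ln (real k)) * (real r + 1))"
    using k_pos by (simp add: powr_def mult_ac)
  moreover have "real r powr (- (real r / 5)) = exp (- (real r / 5 * ln (real r)))"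
    using assms by (simp add: powr_def)
  ultimately show ?thesis
    by (simp only: level_term_def diff_conv_add_uminus exp_add mult.assoc)
qed

text \<open>With \<open>ln k = 0\<close> only r^(-r/5) and exp (6 r^(2/5)) compete. Linear majorants
  of all exponents leave a geometric series of ratio exp (- 1/5).\<close>

lemma sum_level_term_le_1:
  assumes k: "k = 1" and R: "finite R" "\<And>r. r \<in> R \<Longrightarrow> r \<ge> 1"
  shows "(\<Sum>r\<in>R. level_term l r) \<le> 10 ^ 9"
proof -
  have const: "rankin_const = 0" "rankin_slope = 6"
    unfolding rankin_const_def rankin_slope_def if_P[OF k] by simp_all
  have e3: "exp 3 \<le> (21 :: real)"
  proof -
    have "exp 3 = (exp 1 :: real) ^ 3" by (simp flip: exp_of_nat_mult)
    also have "\<dots> \<le> (272 / 100) ^ 3" using e_less_272 by (intro power_mono) auto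
    finally show ?thesis by (simp add: power_divide)
  qed
  have e16: "exp 16 \<le> (10 ^ 7 :: real)"
  proof -
    have "exp 16 = (exp 1 :: real) ^ 16" by (simp flip: exp_of_nat_mult)
    also have "\<dots> \<le> (272 / 100) ^ 16" using e_less_272 by (intro power_mono) auto
    finally show ?thesis by (simp add: power_divide)
  qed
  have "(\<Sum>r\<in>R. level_term l r) \<le> (\<Sum>r\<in>R. 10 * exp 16 * exp (- (1 / 5) * real r))"
  proof (rule sum_mono)
    fix r assume "r \<in> R"
    then have r: "real r \<ge> 1" "r \<ge> 1" using R(2) by auto
    have "(real r + 1) / 10 \<le> exp ((real r + 1) / 10)"
      using exp_ge_add_one_self[of "(real r + 1) / 10"] by linarith
    then have "real r + 1 \<le> 10 * exp ((real r + 1) / 10)" by simp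
    moreover have "level_term l r = (real r + 1) * exp (6 * real r powr (2 / 5) - real r / 5 * ln (real r))"
    proof -
      have "ln (real k) = 0" using k by simp
      then show ?thesis unfolding level_term_eq[OF r(2)] const by simp
    qed
    ultimately have "level_term l r \<le> 10 * exp ((real r + 1) / 10) * exp (6 * real r powr (2 / 5) - real r / 5 * ln (real r))"
      by (simp add: mult_right_mono)
    also have "\<dots> = 10 * exp ((real r + 1) / 10 + (6 * real r powr (2 / 5) - real r / 5 * ln (real r)))"
      by (simp only: exp_add mult.assoc)
    also have "\<dots> \<le> 10 * exp (16 + - (1 / 5) * real r)"
    proof -
      \<comment> \<open>The choice \<open>M = 3\<close> yields slope 4/5, which exceeds the slopes
        1/10 and 1/2 of the other two terms together by 1/5.\<close>
      have "real r * (3 - ln (real r)) \<le> 21 - real r" using mult_diff_ln_le[of "real r" 3] e3 r by linarith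
      then have "real r / 5 * ln (real r) \<ge> 4 / 5 * real r - 21 / 5" by (simp add: algebra_simps)
      moreover have "6 * real r powr (2 / 5) \<le> real r / 2 + 11"
        using r by (intro six_powr_two_fifths_le) auto
      ultimately have "(real r + 1) / 10 + (6 * real r powr (2 / 5) - real r / 5 * ln (real r))
          \<le> 16 + - (1 / 5) * real r" by (simp add: add_divide_distrib)
      then show ?thesis by simp
    qed
    also have "\<dots> = 10 * exp 16 * exp (- (1 / 5) * real r)" by (simp only: exp_add mult.assoc)
    finally show "level_term l r \<le> \<dots>" .
  qed
  also have "\<dots> = 10 * exp 16 * (\<Sum>r\<in>R. exp (- (1 / 5) * real r))" by (rule sum_distrib_left[symmetric])
  also have "\<dots> \<le> 10 * 10 ^ 7 * 6"
    using sum_exp_decay_le[OF R(1), of "1 / 5"] e16 by (intro mult_mono) (auto intro: sum_nonneg)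
  finally show ?thesis by simp
qed

text \<open>The gain r^(-r/5) is discarded and \<open>r\<close> is replaced by
  \<open>A_const k\<close>. The exponent is then about \<open>3 * L * A\<close>, and the gap up to
  \<open>5 * L * A\<close> covers everything else; the number of levels gives the factor
  \<open>A_const k\<close>.\<close>

lemma sum_level_term_small_le:
  assumes k: "k \<ge> 2" and l: "l \<ge> 1" and R: "finite R" "\<And>r. r \<in> R \<Longrightarrow> r \<ge> 1 \<and> real r \<le> A_const k"
  shows "(\<Sum>r\<in>R. level_term l r) \<le> A_const k * exp (5 * (l * ln (real k)) * A_const k)"
proof -
  define A where "A = A_const k"
  define L where "L = l * ln (real k)"
  have A: "A \<ge> 200000 * real k ^ 3" unfolding A_def by (rule A_const_ge[OF k])
  have k3: "real k ^ 3 \<ge> real k ^ 2" using k by (intro power_increasing) auto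
  have k2: "real k ^ 2 \<ge> 4" using k power_mono[of 2 "real k" 2] by simp
  have A_big: "A \<ge> 800000" using A k3 k2 by linarith
  have "ln 2 \<le> ln (real k)" using k by simp
  then have "2 / 3 \<le> ln (real k)" using ln2_ge_two_thirds by linarith
  then have L: "L \<ge> 2 / 3" using l mult_mono[of 1 l "2 / 3" "ln (real k)"] by (simp add: L_def)
  have "(120 * real k)\<^sup>2 \<le> A" using A k3 k2 by (simp add: power_mult_distrib) 
  then have sqrtA: "120 * real k \<le> sqrt A" by (intro real_le_rsqrt)
  have const: "rankin_const = 18 * real k ^ 3" "rankin_slope = 12 * real k"
    using k by (simp_all add: rankin_const_def rankin_slope_def)
  have powA: "12 * real k * A powr (2 / 5) \<le> A / 10"
  proof -
    have "A powr (2 / 5) \<le> A powr (1 / 2)" using A_big by (intro powr_mono) auto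
    then have "12 * real k * A powr (2 / 5) \<le> sqrt A / 10 * sqrt A"
      using sqrtA A_big by (intro mult_mono) (auto simp: powr_half_sqrt)
    then show ?thesis using A_big by simp
  qed
  have logA: "A + 1 \<le> exp (A / 100)"
  proof -
    have "A + 1 \<le> 2 * A" using A_big by simp
    also have "\<dots> \<le> A * (A / 100) ^ 3 / 25600"
    proof -
      have "(8000 :: real) ^ 3 \<le> (A / 100) ^ 3" using A_big by (intro power_mono) auto
      then have "A * 51200 \<le> A * (A / 100) ^ 3" using A_big by (intro mult_left_mono) auto
      then show ?thesis by simp
    qed
    also have "\<dots> = (A / 100) ^ 4 / 256" by (simp add: power_divide power4_eq_xxxx power3_eq_cube)
    also have "\<dots> \<le> exp (A / 100)" using A_big by (intro exp_ge_pow4) auto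
    finally show ?thesis .
  qed
  have "(\<Sum>r\<in>R. level_term l r) \<le> (\<Sum>r\<in>R. exp (5 * L * A))"
  proof (rule sum_mono)
    fix r assume "r \<in> R"
    then have r: "r \<ge> 1" "real r \<ge> 1" "real r \<le> A" using R(2) by (auto simp: A_def)
    have "3 * L * (real r + 1) - real r / 5 * ln (real r) + (rankin_const + rankin_slope * real r powr (2 / 5))
        \<le> 3 * L * (A + 1) - 0 + (18 * real k ^ 3 + 12 * real k * A powr (2 / 5))"
      unfolding const using r L by (intro add_mono diff_mono mult_left_mono powr_mono2) auto
    \<comment> \<open>The reserve \<open>A / 100\<close> is kept to pay for the factor
      \<open>A + 1\<close> in front of the exponential.\<close>
    also have "\<dots> \<le> 5 * L * A - A / 100"
    proof -
      have "18 * real k ^ 3 \<le> A / 1000" using A k3 k2 by simp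
      moreover have "3 * L \<le> 3 / 1000 * (L * A)"
        using mult_left_mono[of 1 "A / 1000" "3 * L"] L A_big by (simp add: mult_ac)
      moreover have "3 * L * (A + 1) = 3 * (L * A) + 3 * L" by (simp add: algebra_simps)
      moreover have "2 / 3 * A \<le> L * A" using L A_big by (intro mult_right_mono) auto
      moreover have "5 * L * A = 5 * (L * A)" by simp
      ultimately show ?thesis using powA A_big by linarith
    qed
    finally have "level_term l r \<le> (A + 1) * exp (5 * L * A - A / 100)"
      unfolding level_term_eq[OF r(1)] L_def[symmetric] using r by (intro mult_mono) auto
    also have "\<dots> \<le> exp (A / 100) * exp (5 * L * A - A / 100)" using logA by (intro mult_right_mono) auto
    also have "\<dots> = exp (5 * L * A)" by (simp flip: exp_add)
    finally show "level_term l r \<le> exp (5 * L * A)" .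
  qed
  also have "\<dots> = real (card R) * exp (5 * L * A)" by simp
  also have "\<dots> \<le> A * exp (5 * L * A)"
  proof (rule mult_right_mono)
    have "R \<subseteq> {1..nat \<lfloor>A\<rfloor>}"
    proof
      fix r assume "r \<in> R"
      then show "r \<in> {1..nat \<lfloor>A\<rfloor>}" using R(2)[of r] le_nat_floor[of r A] by (simp add: A_def)
    qed
    then have "card R \<le> card {1..nat \<lfloor>A\<rfloor>}" by (intro card_mono) auto
    then have "real (card R) \<le> real (nat \<lfloor>A\<rfloor>)" by (intro of_nat_mono) simp
    also have "\<dots> \<le> A" using A_big by simp
    finally show "real (card R) \<le> A" .
  qed auto
  finally show ?thesis by (simp add: A_def L_def)
qed

text \<open>Beyond \<open>A_const k\<close> all lower-order terms together are at most
  \<open>L * r / 5\<close>. This raises the coefficient 3 of \<open>L * r\<close> to 16/5 and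
  produces the exponent 16 that matches \<open>C_const\<close>.\<close>

lemma sum_level_term_large_le:
  assumes k: "k \<ge> 2" and l: "l \<ge> 1" and R: "finite R" "\<And>r. r \<in> R \<Longrightarrow> real r \<ge> A_const k"
  shows "(\<Sum>r\<in>R. level_term l r) \<le> 6 * exp (1 / 5 * exp (16 * (l * ln (real k))))"
proof -
  define L where "L = l * ln (real k)"
  have "ln 2 \<le> ln (real k)" using k by simp
  then have "2 / 3 \<le> ln (real k)" using ln2_ge_two_thirds by linarith
  then have L: "L \<ge> 2 / 3" using l mult_mono[of 1 l "2 / 3" "ln (real k)"] by (simp add: L_def)
  have k3: "real k ^ 3 \<ge> real k ^ 2" using k by (intro power_increasing) auto
  have k2: "real k ^ 2 \<ge> 4" using k power_mono[of 2 "real k" 2] by simp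
  have const: "rankin_const = 18 * real k ^ 3" "rankin_slope = 12 * real k"
    using k by (simp_all add: rankin_const_def rankin_slope_def)
  have "(\<Sum>r\<in>R. level_term l r) \<le> (\<Sum>r\<in>R. exp (1 / 5 * exp (16 * L)) * exp (- (1 / 5) * real r))"
  proof (rule sum_mono)
    fix r assume "r \<in> R"
    then have "real r \<ge> 200000 * real k ^ 3" using R(2) A_const_ge[OF k] by force
    define t where "t = real r"
    have t: "t \<ge> 200000 * real k ^ 3" using \<open>real r \<ge> _\<close> by (simp add: t_def)
    have t_big: "t \<ge> 800000" using t k3 k2 by linarith
    then have r: "r \<ge> 1" by (simp add: t_def)
    have "(120 * real k)\<^sup>2 \<le> t" using t k3 k2 by (simp add: power_mult_distrib)
    then have sqrtt: "120 * real k \<le> sqrt t" by (intro real_le_rsqrt)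
    have powt: "12 * real k * t powr (2 / 5) \<le> t / 10"
    proof -
      have "t powr (2 / 5) \<le> t powr (1 / 2)" using t_big by (intro powr_mono) auto
      then have "12 * real k * t powr (2 / 5) \<le> sqrt t / 10 * sqrt t"
        using sqrtt t_big by (intro mult_mono) (auto simp: powr_half_sqrt)
      then show ?thesis using t_big by simp
    qed
    have logt: "t + 1 \<le> exp (t / 100)"
    proof -
      have "t + 1 \<le> 2 * t" using t_big by simp
      also have "\<dots> \<le> t * (t / 100) ^ 3 / 25600"
      proof -
        have "(8000 :: real) ^ 3 \<le> (t / 100) ^ 3" using t_big by (intro power_mono) auto
        then have "t * 51200 \<le> t * (t / 100) ^ 3" using t_big by (intro mult_left_mono) auto
        then show ?thesis by simp
      qed
      also have "\<dots> = (t / 100) ^ 4 / 256" by (simp add: power_divide power4_eq_xxxx power3_eq_cube)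
      also have "\<dots> \<le> exp (t / 100)" using t_big by (intro exp_ge_pow4) auto
      finally show ?thesis .
    qed
    have "level_term l r \<le> exp (t / 100) * exp (3 * L * (t + 1) - t / 5 * ln t
        + (18 * real k ^ 3 + 12 * real k * t powr (2 / 5)))"
      unfolding level_term_eq[OF r] L_def[symmetric] const t_def[symmetric]
      using logt by (intro mult_right_mono) auto
    also have "\<dots> = exp (t / 100 + (3 * L * (t + 1) - t / 5 * ln t + (18 * real k ^ 3 + 12 * real k * t powr (2 / 5))))"
      by (simp only: exp_add)
    also have "\<dots> \<le> exp (1 / 5 * exp (16 * L) + - (1 / 5) * t)"
      unfolding exp_le_cancel_iff
    proof -
      \<comment> \<open>The maximum over real \<open>t\<close> replaces the search for the worst
        level and still leaves the decaying factor exp (- t / 5).\<close>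
      have "t * (16 * L - ln t) \<le> exp (16 * L) - t" using t_big by (intro mult_diff_ln_le) auto
      then have main: "16 / 5 * (L * t) - t / 5 * ln t \<le> 1 / 5 * exp (16 * L) + - (1 / 5) * t"
        by (simp add: algebra_simps)
      have "18 * real k ^ 3 \<le> t / 1000" using t k3 k2 by simp
      moreover have "3 * L \<le> 3 / 1000 * (L * t)"
        using mult_left_mono[of 1 "t / 1000" "3 * L"] L t_big by (simp add: mult_ac)
      moreover have "3 * L * (t + 1) = 3 * (L * t) + 3 * L" by (simp add: algebra_simps)
      moreover have "2 / 3 * t \<le> L * t" using L t_big by (intro mult_right_mono) auto
      ultimately have "t / 100 + (3 * L * (t + 1) + (18 * real k ^ 3 + 12 * real k * t powr (2 / 5))) \<le> 16 / 5 * (L * t)"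
        using powt t_big by linarith
      then show "t / 100 + (3 * L * (t + 1) - t / 5 * ln t + (18 * real k ^ 3 + 12 * real k * t powr (2 / 5)))
          \<le> 1 / 5 * exp (16 * L) + - (1 / 5) * t" using main by linarith
    qed
    also have "\<dots> = exp (1 / 5 * exp (16 * L)) * exp (- (1 / 5) * real r)" by (simp only: exp_add t_def)
    finally show "level_term l r \<le> \<dots>" .
  qed
  also have "\<dots> = exp (1 / 5 * exp (16 * L)) * (\<Sum>r\<in>R. exp (- (1 / 5) * real r))"
    by (rule sum_distrib_left[symmetric])
  also have "\<dots> \<le> exp (1 / 5 * exp (16 * L)) * 6"
    using sum_exp_decay_le[OF R(1), of "1 / 5"] by (intro mult_left_mono) auto
  finally show ?thesis by (simp add: L_def)
qed

lemma C_const_ge: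
  assumes k: "k \<ge> 2" and l: "l \<ge> 1"
  shows "exp (real k powr (16 * l)) \<le> C_const k l"
proof -
  have "exp 1 \<le> (10 :: real)" using e_less_272 by simp
  also have "10 * 1 \<le> 10 * (l * (real k - 1))"
    using l k mult_mono[of 1 l 1 "real k - 1"] by (intro mult_left_mono) auto
  finally have base: "exp 1 \<le> 10 * l * (real k - 1)" by simp
  have "exp (real k powr (16 * l)) = exp 1 powr (real k powr (16 * l))" by (simp add: powr_def)
  also have "\<dots> \<le> (10 * l * (real k - 1)) powr (real k powr (16 * l))"
    using base by (intro powr_mono2) auto
  also have "\<dots> \<le> (10 * l * (real k - 1)) powr (real k powr (16 * l) * (real k - 1))"
  proof (rule powr_mono)
    show "real k powr (16 * l) \<le> real k powr (16 * l) * (real k - 1)"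
      using k by (simp add: mult_le_cancel_left1)
    have "(1 :: real) \<le> exp 1" by simp
    then show "1 \<le> 10 * l * (real k - 1)" using base by linarith
  qed
  finally show ?thesis using k by (simp add: C_const_def)
qed

text \<open>For \<open>k \<ge> 2\<close> the levels \<open>r \<le> A_const k\<close> are absorbed by \<open>A_k k\<^sup>5\<^sup>l\<^sup>A\<close>. Beyond \<open>A_const k\<close> the logarithm of the
  level term is at most \<open>r (16 l ln k - ln r) / 5\<close>, which peaks near \<open>r = k\<^sup>1\<^sup>6\<^sup>l / e\<close> at a value that
  \<open>C_const k l\<close> absorbs.\<close>

lemma constants_le_Lambda:
  assumes l: "l \<ge> 1" and R: "finite R" "\<And>r. r \<in> R \<Longrightarrow> r \<ge> 1"
  shows "1 + 27 * l * real k powr (9 * l) + C_const k l + 9 * l * (\<Sum>r\<in>R. level_term l r) \<le> Lambda_const k l"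
proof (cases "k = 1")
  case True
  have "(\<Sum>r\<in>R. level_term l r) \<le> 1000000000" using sum_level_term_le_1[OF True R] by simp
  then have sum: "9 * l * (\<Sum>r\<in>R. level_term l r) \<le> 9 * l * 1000000000"
    using l by (intro mult_left_mono) auto
  have "D_const k l \<ge> 10000000000"
  proof -
    \<comment> \<open>This is 125 * 1092. Its square exceeds 10^10, ten times the bound for the sum
      over the levels.\<close>
    have A: "A_const k = 136500" using True by (simp add: A_const_def)
    have "real k powr (5 * l * A_const k) = 1" using True by simp
    then have main: "A_const k * max (A_const k) (2 * real k powr (5 * l * A_const k)) = 136500 * 136500"
      by (simp only: A)
    then show ?thesis using D_const_ge[of k l] by simp
  qed
  then have D: "9 * l * 10000000000 \<le> 9 * l * D_const k l" using l by (intro mult_left_mono) auto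
  have C: "C_const k l = 1" "real k powr (9 * l) = 1" "real k powr (6 * l) = 1"
    using True by (simp_all add: C_const_def)
  show ?thesis unfolding Lambda_const_def C using sum D l by linarith
next
  case False
  then have k: "k \<ge> 2" using k_pos by simp
  define A where "A = A_const k"
  define E where "E = real k powr (16 * l)"
  define X where "X = exp (5 * (l * ln (real k)) * A)"
  have X_eq: "X = real k powr (5 * l * A)" using k by (simp add: X_def powr_def mult_ac)
  have "real k ^ 3 \<ge> 1" using k by (intro one_le_power) auto
  then have A: "A \<ge> 200000" using A_const_ge[OF k] unfolding A_def by linarith
  have X1: "real k powr (9 * l) \<le> X"
    unfolding X_eq
  proof (rule powr_mono)
    have "9 * l \<le> (5 * A) * l" using A l by (intro mult_right_mono) auto
    then show "9 * l \<le> 5 * l * A" by (simp add: mult_ac)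
  qed (use k in auto)
  have D: "2 * A * X \<le> D_const k l"
  proof -
    have "A * (2 * X) \<le> A * max A (2 * X)" using A by (intro mult_left_mono) auto
    then show ?thesis using D_const_ge[of k l] unfolding X_eq A_def by (simp add: mult_ac)
  qed
  have sum: "(\<Sum>r\<in>R. level_term l r) \<le> A * X + 6 * exp (1 / 5 * E)"
  proof -
    have "(\<Sum>r\<in>R. level_term l r) = (\<Sum>r\<in>{r\<in>R. real r \<le> A} \<union> {r\<in>R. real r > A}. level_term l r)"
      by (intro sum.cong) auto
    also have "\<dots> = (\<Sum>r\<in>{r\<in>R. real r \<le> A}. level_term l r) + (\<Sum>r\<in>{r\<in>R. real r > A}. level_term l r)"
      using R(1) by (intro sum.union_disjoint) auto
    also have "\<dots> \<le> A * X + 6 * exp (1 / 5 * exp (16 * (l * ln (real k))))"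
      unfolding X_def A_def using R
      by (intro add_mono sum_level_term_small_le sum_level_term_large_le k l) auto
    also have "exp (16 * (l * ln (real k))) = E" using k by (simp add: E_def powr_def mult_ac)
    finally show ?thesis .
  qed
  \<comment> \<open>After multiplication by \<open>9 * l\<close> this takes
    \<open>4 * l * C_const k l\<close>; the exceptional integers take one more
    \<open>C_const k l\<close>, which completes the coefficient 5 in
    \<open>Lambda_const\<close>.\<close>
  have E: "6 * exp (1 / 5 * E) \<le> 4 / 9 * C_const k l"
  proof -
    have "2 powr 16 \<le> real k powr 16" using k by (intro powr_mono2) auto
    also have "\<dots> \<le> E" unfolding E_def using k l by (intro powr_mono) auto
    finally have E: "E \<ge> 65536" by simp
    have "27 / 2 \<le> exp (4 / 5 * E)" using exp_ge_add_one_self[of "4 / 5 * E"] E by linarith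
    then have "27 / 2 * exp (1 / 5 * E) \<le> exp (4 / 5 * E) * exp (1 / 5 * E)" by (intro mult_right_mono) auto
    also have "\<dots> = exp E" by (simp flip: exp_add)
    also have "\<dots> \<le> C_const k l" unfolding E_def by (rule C_const_ge[OF k l])
    finally show ?thesis by simp
  qed
  have C: "C_const k l \<ge> 0" by (simp add: C_const_def)
  have "27 * real k powr (9 * l) + 9 * (\<Sum>r\<in>R. level_term l r) \<le> 27 * X + 9 * (A * X) + 4 * C_const k l"
    using X1 sum E by linarith
  \<comment> \<open>As \<open>2 * A * X \<le> D_const k l\<close>, half of
    \<open>9 * D_const k l\<close> goes to the levels up to \<open>A\<close> and the other half to
    the class of very rough cofactors.\<close>
  also have "27 * X \<le> 9 * (A * X)"
    using A by (simp add: X_def)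
  also have "9 * (A * X) + 9 * (A * X) + 4 * C_const k l \<le> 9 * D_const k l + 4 * C_const k l" using D by simp
  finally have "l * (27 * real k powr (9 * l) + 9 * (\<Sum>r\<in>R. level_term l r)) \<le> l * (9 * D_const k l + 4 * C_const k l)"
    using l by (intro mult_left_mono) auto
  moreover have "C_const k l \<le> l * C_const k l" using C l by (simp add: mult_le_cancel_right1)
  moreover have "1 * 1 \<le> 12 * l * real k powr (6 * l)"
    using l k by (intro mult_mono ge_one_powr_ge_zero) auto
  ultimately show ?thesis unfolding Lambda_const_def by (simp add: algebra_simps)
qed

end

section \<open>Sums over the short interval\<close>

lemma sum_Un_nonneg_le:
  fixes f :: "'a \<Rightarrow> real"
  assumes "finite A" "finite B" "\<And>i. i \<in> A \<inter> B \<Longrightarrow> f i \<ge> 0"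
  shows "sum f (A \<union> B) \<le> sum f A + sum f B"
  using sum.union_inter[OF assms(1,2), of f] sum_nonneg[of "A \<inter> B" f] assms(3) by fastforce

lemma sum_UN_nonneg_le:
  fixes f :: "'a \<Rightarrow> real"
  assumes "finite I" "\<And>i. i \<in> I \<Longrightarrow> finite (B i)" "\<And>i j. i \<in> I \<Longrightarrow> j \<in> B i \<Longrightarrow> f j \<ge> 0"
  shows "sum f (\<Union>i\<in>I. B i) \<le> (\<Sum>i\<in>I. sum f (B i))"
  using assms
proof (induction I rule: finite_induct)
  case (insert i I)
  have "sum f (\<Union>i\<in>insert i I. B i) = sum f (B i \<union> (\<Union>i\<in>I. B i))" by simp
  also have "\<dots> \<le> sum f (B i) + sum f (\<Union>i\<in>I. B i)"
    using insert by (intro sum_Un_nonneg_le) auto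
  also have "\<dots> \<le> sum f (B i) + (\<Sum>i\<in>I. sum f (B i))"
    using insert by (intro add_left_mono insert.IH) auto
  finally show ?case using insert.hyps by simp
qed simp

section \<open>The classes of integers in the interval\<close>

locale short_interval = tau_submultiplicative f k for f k +
  fixes l x y :: real
  assumes l: "l \<ge> 1" and y_pos: "y > 0" and y_le_x: "y \<le> x" and x_le_y: "x powr (1 / l) \<le> y"
    and ln_y: "ln y \<ge> 10 ^ 20" and ln_x: "ln x \<le> l * ln y" and l_le: "l \<le> ln y"
begin

definition z :: real where "z = exp (ln y / 3)"

definition F :: real where "F = (\<Sum>a=1..nat \<lfloor>x\<rfloor>. f a / real a)"

definition rough_part :: "nat set \<Rightarrow> real \<Rightarrow> nat set" where
  "rough_part A Q = {n. x - y < real n \<and> real n \<le> x \<and>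
     (\<exists>a\<in>A. \<exists>b. n = a * b \<and> (\<forall>p. prime p \<longrightarrow> p dvd b \<longrightarrow> Q < real p))}"

definition power_part :: "nat set" where
  "power_part = {n. x - y < real n \<and> real n \<le> x \<and>
     (\<exists>q e. 2 \<le> q \<and> real q \<le> sqrt z \<and> q ^ e dvd n \<and> sqrt z < real (q ^ e))}"

definition smooth_part :: "nat set" where
  "smooth_part = {n. x - y < real n \<and> real n \<le> x \<and>
     (\<exists>a. a \<in> {1..nat \<lfloor>z\<rfloor>} \<and> sqrt z < real a \<and> (\<forall>p. prime p \<longrightarrow> p dvd a \<longrightarrow> real p \<le> ln z) \<and> a dvd n)}"

definition smooth_prefixes :: "nat \<Rightarrow> nat set" where
  "smooth_prefixes r = {a. a \<in> {1..nat \<lfloor>z\<rfloor>} \<and> sqrt z < real a \<and>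
     (\<forall>p. prime p \<longrightarrow> p dvd a \<longrightarrow> real p \<le> exp (ln z / real r))}"

text \<open>The condition on \<open>r\<close> says exactly that the Rankin exponent chosen in
  \<open>level_sum_le\<close> is at most 2/5. It holds for every level that occurs, since there
  \<open>ln z < q\<close> gives \<open>r \<le> q\<close>.\<close>

definition levels :: "nat set" where
  "levels = {r. 2 \<le> r \<and> real r * ln (real r) \<le> ln z}"

section \<open>Size relations between \<open>x\<close>, \<open>y\<close> and
  \<open>z\<close>\<close>

lemma ln_y_pos: "ln y > 0" using ln_y by (rule less_le_trans[rotated]) simp

lemma ln_x_pos: "ln x > 0"
  using ln_y_pos y_pos y_le_x by (smt (verit) ln_le_cancel_iff)

lemma x_ge_1: "x \<ge> 1"
  using ln_x_pos y_pos y_le_x by (smt (verit) ln_less_zero_iff)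

lemma ln_x_le_square: "ln x \<le> (ln y)\<^sup>2"
proof -
  have "l * ln y \<le> ln y * ln y" using l_le ln_y_pos by (intro mult_right_mono) auto
  then show ?thesis using ln_x by (simp add: power2_eq_square)
qed

lemma ln_z: "ln z = ln y / 3" by (simp add: z_def)

lemma sqrt_z: "sqrt z = exp (ln y / 6)"
proof -
  have "z = (exp (ln y / 6))\<^sup>2" by (simp add: z_def power2_eq_square flip: exp_add)
  then show ?thesis by simp
qed

lemma z_ge_1: "z \<ge> 1" using ln_y_pos by (simp add: z_def)

lemma z_le_y: "z \<le> y"
proof -
  have "z \<le> exp (ln y)" unfolding z_def using ln_y_pos by simp
  then show ?thesis using y_pos by simp
qed

lemma term_nonneg: "a \<ge> 1 \<Longrightarrow> f a / real a \<ge> 0"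
  using nonneg[of a] by simp

lemma F_nonneg: "F \<ge> 0"
  unfolding F_def by (intro sum_nonneg term_nonneg) auto

lemma nat_floor_z_le_x: "nat \<lfloor>z\<rfloor> \<le> nat \<lfloor>x\<rfloor>"
  using z_le_y y_le_x by (intro nat_mono floor_mono) linarith

lemma sum_le_F: "A \<subseteq> {1..nat \<lfloor>x\<rfloor>} \<Longrightarrow> (\<Sum>a\<in>A. f a / real a) \<le> F"
  unfolding F_def by (intro sum_mono2 term_nonneg) auto

lemma f_1_le_F: "f 1 \<le> F"
proof -
  have "{1} \<subseteq> {1..nat \<lfloor>x\<rfloor>}" using x_ge_1 by (auto simp: le_nat_iff)
  from sum_le_F[OF this] show ?thesis by simp
qed

lemma interval_pos: "x - y < real n \<Longrightarrow> n \<ge> 1"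
  using y_le_x by (cases n) auto

text \<open>A saving of 1/15 against a loss of 1/16 leaves exp (- ln y / 240). Two slowly growing
  factors share this margin equally, hence 480.\<close>

lemma cube_le_exp: "2 * ln y ^ 3 \<le> exp (ln y / 480)"
proof -
  have "(10 :: real) ^ 20 \<le> ln y" by (rule ln_y)
  then have "512 * 480 ^ 4 \<le> ln y" by simp
  then have "512 * 480 ^ 4 * ln y ^ 3 \<le> ln y * ln y ^ 3"
    using ln_y_pos by (intro mult_right_mono) auto
  then have "2 * ln y ^ 3 \<le> (ln y / 480) ^ 4 / 256"
    by (simp add: power_divide power4_eq_xxxx power3_eq_cube)
  also have "\<dots> \<le> exp (ln y / 480)" using ln_y_pos by (intro exp_ge_pow4) auto
  finally show ?thesis .
qed

lemma ln_x_le_exp: "ln x \<le> exp (ln y / 480)"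
proof -
  have "ln x \<le> ln y ^ 2 * 1" using ln_x_le_square by simp
  also have "\<dots> \<le> ln y ^ 2 * (2 * ln y)" using ln_y by (intro mult_left_mono) auto
  also have "\<dots> = 2 * ln y ^ 3" by (simp add: power2_eq_square power3_eq_cube)
  also have "\<dots> \<le> exp (ln y / 480)" by (rule cube_le_exp)
  finally show ?thesis .
qed

lemma z_le: "z \<le> y / ln x"
proof -
  have "z * ln x \<le> exp (ln y / 3) * exp (ln y / 480)"
    unfolding z_def by (intro mult_left_mono ln_x_le_exp) auto
  also have "\<dots> \<le> exp (ln y)" using ln_y_pos by (simp flip: exp_add)
  also have "\<dots> = y" using y_pos by simp
  finally show ?thesis using ln_x_pos by (simp add: field_simps)
qed

text \<open>The splitting needs \<open>z < n\<close>. Smaller \<open>n\<close> occur only when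
  \<open>y\<close> is within \<open>z\<close> of \<open>x\<close>, and they are negligible because
  \<open>z \<le> y / ln x\<close>.\<close>

lemma small_sum_le:
  "(\<Sum>n | x - y < real n \<and> real n \<le> x \<and> real n \<le> z. f n) \<le> (y / ln x) * F"
proof -
  have "(\<Sum>n | x - y < real n \<and> real n \<le> x \<and> real n \<le> z. f n)
      \<le> (\<Sum>n | x - y < real n \<and> real n \<le> x \<and> real n \<le> z. z * (f n / real n))"
  proof (rule sum_mono)
    fix n assume "n \<in> {n. x - y < real n \<and> real n \<le> x \<and> real n \<le> z}"
    then have n: "n \<ge> 1" "real n \<le> z" using interval_pos[of n] by auto
    have "f n = real n * (f n / real n)" using n by simp
    also have "\<dots> \<le> z * (f n / real n)" using n by (intro mult_right_mono term_nonneg)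
    finally show "f n \<le> z * (f n / real n)" .
  qed
  also have "\<dots> = z * (\<Sum>n | x - y < real n \<and> real n \<le> x \<and> real n \<le> z. f n / real n)"
    by (rule sum_distrib_left[symmetric])
  also have "\<dots> \<le> z * F"
    using z_ge_1 interval_pos by (intro mult_left_mono sum_le_F) (auto intro: le_nat_floor)
  also have "\<dots> \<le> (y / ln x) * F" by (intro mult_right_mono z_le F_nonneg)
  finally show ?thesis .
qed

text \<open>For Q = y^(1/m) with \<open>m \<ge> 9\<close>, the level condition follows from Q^4 ln Q
  \<le> Q^5 \<le> y^(5/9) \<le> y^(2/3) = y / z. The ratio \<open>ln x / ln Q\<close> is at most
  \<open>l * m\<close>, which governs both the number of primes in the cofactor and the loss from
  replacing \<open>ln Q\<close> by \<open>ln x\<close>.\<close>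

lemma rough_part_sum_le:
  assumes A: "A \<subseteq> {1..nat \<lfloor>z\<rfloor>}" and m: "m \<ge> 9" "ln 2 \<le> ln y / m"
  shows "sum f (rough_part A (exp (ln y / m)))
      \<le> real k powr (l * m) * (3 * l * m * (y / ln x)) * (\<Sum>a\<in>A. f a / real a)"
proof -
  define t where "t = ln y / m"
  have "ln y * 9 \<le> ln y * m" using m ln_y_pos by (intro mult_left_mono) auto
  then have t: "0 < t" "ln 2 \<le> t" "9 * t \<le> ln y" using m ln_y_pos by (auto simp: t_def field_simps)
  have fin: "finite A" using A by (rule finite_subset) simp
  have "exp (ln 2) \<le> exp t" using t by (subst exp_le_cancel_iff)
  then have Q: "exp t \<ge> 2" by simp
  have level: "exp t ^ 4 * ln (exp t) \<le> y / z"
  proof -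
    have "exp t ^ 4 * ln (exp t) = exp (4 * t) * t" by (simp flip: exp_of_nat_mult)
    also have "\<dots> \<le> exp (4 * t) * exp t"
      using exp_ge_add_one_self[of t] by (intro mult_left_mono) (linarith, simp)
    also have "\<dots> \<le> exp (ln y - ln y / 3)" using t by (simp flip: exp_add)
    also have "\<dots> = y / z" by (simp only: exp_diff z_def exp_ln[OF y_pos])
    finally show ?thesis .
  qed
  have "sum f (rough_part A (exp t))
      \<le> real k powr (ln x / ln (exp t)) * (3 * y / ln (exp t)) * (\<Sum>a\<in>A. f a / real a)"
    unfolding rough_part_def
  proof (rule sum_rough_cofactor_le[OF Q _ level y_pos y_le_x x_ge_1 fin])
    show "z > 0" using z_ge_1 by simp
    fix a assume "a \<in> A"
    then have "a \<ge> 1" "a \<le> nat \<lfloor>z\<rfloor>" using A by auto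
    moreover from this have "real a \<le> z" using z_ge_1 by (simp add: le_nat_iff le_floor_iff)
    ultimately show "a \<ge> 1 \<and> real a \<le> z" by simp
  qed
  also have "\<dots> \<le> real k powr (l * m) * (3 * l * m * (y / ln x)) * (\<Sum>a\<in>A. f a / real a)"
  proof (intro mult_right_mono mult_mono)
    have "ln x * m \<le> l * ln y * m" using ln_x m by (intro mult_right_mono) auto
    then have "ln x / ln (exp t) \<le> l * m" using ln_y_pos m by (simp add: t_def field_simps)
    then show "real k powr (ln x / ln (exp t)) \<le> real k powr (l * m)"
      using k_pos by (intro powr_mono) auto
    have "3 * y * m * ln x \<le> 3 * y * m * (l * ln y)" using ln_x m y_pos by (intro mult_left_mono) auto
    then show "3 * y / ln (exp t) \<le> 3 * l * m * (y / ln x)"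
      using ln_y_pos ln_x_pos m by (simp add: t_def field_simps)
    show "(\<Sum>a\<in>A. f a / real a) \<ge> 0" using A by (intro sum_nonneg term_nonneg) auto
  qed (use t y_pos in auto)
  finally show ?thesis by (simp add: t_def)
qed

lemma f_le_C_const:
  assumes n: "n \<ge> 1" "real n \<le> x"
  shows "f n \<le> C_const k l * exp (ln y / 16) * F"
proof -
  have C: "C_const k l \<ge> 0" by (simp add: C_const_def)
  have "real n powr (1 / (16 * l)) \<le> x powr (1 / (16 * l))" using n l by (intro powr_mono2) auto
  also have "\<dots> = (x powr (1 / l)) powr (1 / 16)" by (simp add: powr_powr mult.commute)
  also have "\<dots> \<le> y powr (1 / 16)" using x_le_y by (intro powr_mono2) auto
  also have "\<dots> = exp (ln y / 16)" using y_pos by (simp add: powr_def)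
  finally have pow: "real n powr (1 / (16 * l)) \<le> exp (ln y / 16)" .
  have "f n \<le> C_const k l * real n powr (1 / (16 * l)) * f 1" by (rule le_C_const[OF l n(1)])
  also have "\<dots> \<le> C_const k l * exp (ln y / 16) * F"
    using pow C f_1_le_F nonneg[of 1] by (intro mult_mono) auto
  finally show ?thesis .
qed

lemma sum_le_card:
  assumes "\<And>n. n \<in> S \<Longrightarrow> x - y < real n \<and> real n \<le> x"
  shows "sum f S \<le> real (card S) * (C_const k l * exp (ln y / 16) * F)"
proof (rule sum_bounded_above)
  fix n assume "n \<in> S"
  then show "f n \<le> C_const k l * exp (ln y / 16) * F"
    using assms[of n] interval_pos[of n] by (intro f_le_C_const) auto
qed

lemma exceptional_sum_le:
  "sum f power_part + sum f smooth_part \<le> C_const k l * (y / ln x) * F"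
proof -
  define Y where "Y = ln y"
  have Y: "Y \<ge> 10 ^ 20" "Y > 0" using ln_y ln_y_pos by (auto simp: Y_def)
  have C: "C_const k l \<ge> 0" by (simp add: C_const_def)
  \<comment> \<open>The Rankin factor for primes up to \<open>ln z\<close>; at this smoothness it
    grows more slowly than any power of \<open>y\<close>.\<close>
  define G where "G = exp (6 * (Y / 3) powr (2 / 5))"
  have G: "G \<ge> 1" by (simp add: G_def)
  have G_le: "G \<le> exp (Y / 480)"
  proof -
    have "(Y / 3) powr (2 / 5) \<le> Y powr (1 / 2)"
    proof -
      have "(Y / 3) powr (2 / 5) \<le> Y powr (2 / 5)" using Y by (intro powr_mono2) auto
      also have "\<dots> \<le> Y powr (1 / 2)" using Y by (intro powr_mono) auto
      finally show ?thesis .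
    qed
    also have "\<dots> = sqrt Y" using Y by (simp add: powr_half_sqrt)
    finally have "6 * (Y / 3) powr (2 / 5) \<le> 6 * sqrt Y" by simp
    moreover have "2880 * sqrt Y \<le> sqrt Y * sqrt Y"
    proof (rule mult_right_mono)
      have "2880\<^sup>2 \<le> Y" using Y by simp
      then show "2880 \<le> sqrt Y" by (rule real_le_rsqrt)
    qed (use Y in auto)
    ultimately show ?thesis using Y by (simp add: G_def)
  qed
  have w: "sqrt z \<ge> 1" "(sqrt z)\<^sup>2 \<le> y" using z_ge_1 z_le_y by auto
  have "real (card power_part) \<le> 2 * y / sqrt (sqrt z) * (1 + ln (sqrt z))"
    unfolding power_part_def by (rule card_large_power_divisor_le[OF w y_le_x])
  also have "\<dots> = 2 * y * (exp (- (Y / 12)) * (1 + Y / 6))"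
  proof -
    have "sqrt z = (exp (ln y / 12))\<^sup>2" unfolding sqrt_z by (simp add: power2_eq_square flip: exp_add)
    then have "sqrt (sqrt z) = exp (Y / 12)" by (simp add: Y_def)
    then show ?thesis by (simp add: sqrt_z Y_def exp_minus field_simps)
  qed
  \<comment> \<open>The stronger saving for \<open>power_part\<close> is relaxed to the form
    available for \<open>smooth_part\<close>, so that both counts are added at once.\<close>
  also have "\<dots> \<le> 2 * y * ((exp (- (Y / 15)) * G) * (1 + Y / 3))"
  proof (intro mult_left_mono mult_mono)
    have "exp (- (Y / 12)) \<le> exp (- (Y / 15)) * 1" using Y by simp
    also have "\<dots> \<le> exp (- (Y / 15)) * G" using G by (intro mult_left_mono) auto
    finally show "exp (- (Y / 12)) \<le> exp (- (Y / 15)) * G" .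
  qed (use Y G y_pos in auto)
  finally have 1: "real (card power_part) \<le> 2 * y * ((exp (- (Y / 15)) * G) * (1 + Y / 3))" .
  have "ln z \<ge> 1" using Y by (simp add: ln_z Y_def)
  then have "real (card smooth_part) \<le> 2 * y * (z powr (- (1 / 5)) * exp (6 * ln z powr (2 / 5)) * (1 + ln z))"
    unfolding smooth_part_def by (intro card_smooth_divisor_le z_ge_1 z_le_y y_le_x)
  also have "\<dots> = 2 * y * ((exp (- (Y / 15)) * G) * (1 + Y / 3))"
    by (simp add: ln_z Y_def G_def) (simp add: z_def powr_def)
  finally have 2: "real (card smooth_part) \<le> 2 * y * ((exp (- (Y / 15)) * G) * (1 + Y / 3))" .
  have main: "4 * ((exp (- (Y / 15)) * G) * (1 + Y / 3)) * exp (Y / 16) \<le> 1 / ln x"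
  proof -
    have "6 \<le> Y" using Y(1) by (rule order.trans[rotated]) simp
    then have lin: "4 * (1 + Y / 3) \<le> 2 * Y" by simp
    have "4 * (1 + Y / 3) * ln x \<le> (2 * Y) * Y ^ 2"
      using Y ln_x_le_square ln_x_pos unfolding Y_def[symmetric] by (intro mult_mono[OF lin]) auto
    also have "\<dots> = 2 * Y ^ 3" by (simp add: power2_eq_square power3_eq_cube)
    also have "\<dots> \<le> exp (Y / 480)" unfolding Y_def by (rule cube_le_exp)
    finally have "(4 * (1 + Y / 3) * ln x) * G * (exp (- (Y / 15)) * exp (Y / 16))
        \<le> exp (Y / 480) * exp (Y / 480) * (exp (- (Y / 15)) * exp (Y / 16))"
      using G_le G Y by (intro mult_right_mono mult_mono) auto
    also have "\<dots> = 1" by (simp flip: exp_add)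
    finally show ?thesis using ln_x_pos by (simp add: field_simps)
  qed
  have "sum f power_part + sum f smooth_part
      \<le> (real (card power_part) + real (card smooth_part)) * (C_const k l * exp (ln y / 16) * F)"
    unfolding distrib_right by (intro add_mono sum_le_card) (auto simp: power_part_def smooth_part_def)
  also have "\<dots> \<le> (4 * y * ((exp (- (Y / 15)) * G) * (1 + Y / 3))) * (C_const k l * exp (ln y / 16) * F)"
  proof (rule mult_right_mono)
    have "2 * t + 2 * t = 4 * t" for t :: real by simp
    from this[of "y * ((exp (- (Y / 15)) * G) * (1 + Y / 3))"] add_mono[OF 1 2]
    show "real (card power_part) + real (card smooth_part) \<le> 4 * y * ((exp (- (Y / 15)) * G) * (1 + Y / 3))"
      by (simp only: mult.assoc)
  qed (use C F_nonneg in simp)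
  also have "\<dots> = (C_const k l * y * F) * (4 * ((exp (- (Y / 15)) * G) * (1 + Y / 3)) * exp (Y / 16))"
    by (simp add: Y_def mult_ac)
  also have "\<dots> \<le> (C_const k l * y * F) * (1 / ln x)"
    using main C y_pos F_nonneg by (intro mult_left_mono) auto
  finally show ?thesis by simp
qed

lemma level_sum_le:
  assumes r: "r \<in> levels"
  shows "sum f (rough_part (smooth_prefixes r) (exp (ln y / (3 * (real r + 1)))))
      \<le> 9 * l * (y / ln x) * F * level_term l r"
proof -
  have r2: "2 \<le> r" "real r * ln (real r) \<le> ln z" using r by (auto simp: levels_def)
  have z_big: "ln z \<ge> 10" using ln_y by (simp add: ln_z)
  have sub: "smooth_prefixes r \<subseteq> {1..nat \<lfloor>z\<rfloor>}" by (auto simp: smooth_prefixes_def)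
  \<comment> \<open>This means that the sieve limit is at least 2. For \<open>r \<ge> 4\<close> it
    follows from r ln r \<le> ln z, for \<open>r \<le> 3\<close> from the size of
    \<open>ln z\<close>.\<close>
  have level: "(real r + 1) * ln 2 \<le> ln z"
  proof (cases "r \<ge> 4")
    case True
    have "ln 2 * 2 = ln ((2 :: real) ^ 2)" by (subst ln_realpow) simp_all
    also have "\<dots> \<le> ln (real r)" using True by (subst ln_le_cancel_iff) auto
    finally have four: "ln 2 * 2 \<le> ln (real r)" .
    have "(real r + 1) * ln 2 \<le> (real r * 2) * ln 2" using True by (intro mult_right_mono) auto
    also have "\<dots> = real r * (ln 2 * 2)" by simp
    also have "\<dots> \<le> real r * ln (real r)" using four by (intro mult_left_mono) auto
    also note r2(2)
    finally show ?thesis .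
  next
    case False
    then have "(real r + 1) * ln 2 \<le> 4 * 1" using ln2_le_25_over_36 by (intro mult_mono) auto
    then show ?thesis using z_big by simp
  qed
  \<comment> \<open>Chosen so that \<open>sqrt z powr (- \<delta>)\<close> is r^(-r/5), while the
    smoothness bound z^(1/r) raised to \<open>\<delta>\<close> is only r^(2/5), which keeps the
    Euler product small.\<close>
  define \<delta> where "\<delta> = 2 / 5 * (real r * ln (real r) / ln z)"
  have "real r * ln (real r) / ln z \<le> 1" using r2 z_big by (simp add: pos_divide_le_eq)
  then have "\<delta> \<le> 2 / 5 * 1" unfolding \<delta>_def by (intro mult_left_mono) auto
  then have \<delta>: "0 \<le> \<delta>" "\<delta> \<le> 2 / 5" using r2 z_big by (simp_all add: \<delta>_def)
  have v: "exp (ln z / real r) \<ge> 1" using z_big by simp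
  have "(\<Sum>a\<in>smooth_prefixes r. f a / real a)
      \<le> sqrt z powr (- \<delta>) * exp (rankin_const + rankin_slope * exp (ln z / real r) powr \<delta>)
        * (\<Sum>a=1..nat \<lfloor>z\<rfloor>. f a / real a)"
    unfolding smooth_prefixes_def using z_ge_1 by (intro sum_smooth_tail_le \<delta> v) auto
  also have "sqrt z powr (- \<delta>) = real r powr (- (real r / 5))"
  proof -
    have "sqrt z powr (- \<delta>) = exp (- \<delta> * (ln z / 2))" by (simp add: sqrt_z powr_def ln_z)
    also have "- \<delta> * (ln z / 2) = - (real r / 5) * ln (real r)" using z_big by (simp add: \<delta>_def)
    finally show ?thesis using r2 by (simp add: powr_def)
  qed
  also have "exp (ln z / real r) powr \<delta> = real r powr (2 / 5)"
  proof -
    have "\<delta> * (ln z / real r) = 2 / 5 * ln (real r)" using z_big r2 by (simp add: \<delta>_def)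
    then show ?thesis using r2 by (simp add: powr_def)
  qed
  also have "real r powr (- (real r / 5)) * exp (rankin_const + rankin_slope * real r powr (2 / 5))
        * (\<Sum>a=1..nat \<lfloor>z\<rfloor>. f a / real a)
      \<le> real r powr (- (real r / 5)) * exp (rankin_const + rankin_slope * real r powr (2 / 5)) * F"
    using nat_floor_z_le_x by (intro mult_left_mono sum_le_F) auto
  finally have prefixes: "(\<Sum>a\<in>smooth_prefixes r. f a / real a)
      \<le> real r powr (- (real r / 5)) * exp (rankin_const + rankin_slope * real r powr (2 / 5)) * F" .
  have "sum f (rough_part (smooth_prefixes r) (exp (ln y / (3 * (real r + 1)))))
      \<le> real k powr (l * (3 * (real r + 1))) * (3 * l * (3 * (real r + 1)) * (y / ln x))
        * (\<Sum>a\<in>smooth_prefixes r. f a / real a)"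
  proof (rule rough_part_sum_le[OF sub])
    show "3 * (real r + 1) \<ge> 9" using r2 by simp
    show "ln 2 \<le> ln y / (3 * (real r + 1))" using level by (simp add: ln_z field_simps)
  qed
  also have "\<dots> \<le> real k powr (l * (3 * (real r + 1))) * (3 * l * (3 * (real r + 1)) * (y / ln x))
        * (real r powr (- (real r / 5)) * exp (rankin_const + rankin_slope * real r powr (2 / 5)) * F)"
    using l y_pos ln_x_pos by (intro mult_left_mono prefixes) auto
  also have "\<dots> = 9 * l * (y / ln x) * F * level_term l r"
    by (simp add: level_term_def mult_ac)
  finally show ?thesis .
qed

lemma interval_cover:
  "{n. 1 \<le> n \<and> x - y < real n \<and> real n \<le> x}
    \<subseteq> {n. x - y < real n \<and> real n \<le> x \<and> real n \<le> z} \<union> rough_part {1..nat \<lfloor>z\<rfloor>} (exp (ln y / 9))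
      \<union> (power_part \<union> smooth_part)
      \<union> (\<Union>r\<in>levels. rough_part (smooth_prefixes r) (exp (ln y / (3 * (real r + 1)))))"
proof
  fix n assume "n \<in> {n. 1 \<le> n \<and> x - y < real n \<and> real n \<le> x}"
  then have n: "x - y < real n" "real n \<le> x" by auto
  show "n \<in> {n. x - y < real n \<and> real n \<le> x \<and> real n \<le> z} \<union> rough_part {1..nat \<lfloor>z\<rfloor>} (exp (ln y / 9))
      \<union> (power_part \<union> smooth_part)
      \<union> (\<Union>r\<in>levels. rough_part (smooth_prefixes r) (exp (ln y / (3 * (real r + 1)))))"
  proof (cases "real n \<le> z")
    case False
    then obtain a b q e where ab: "n = a * b" "1 \<le> a" "real a \<le> z" "prime q" "q ^ e dvd b"
        "z < real (a * q ^ e)" "\<And>p. prime p \<Longrightarrow> p dvd a \<Longrightarrow> p < q" "\<And>p. prime p \<Longrightarrow> p dvd b \<Longrightarrow> q \<le> p"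
      using smooth_rough_split[of z n] z_ge_1 by auto
    have a: "a \<in> {1..nat \<lfloor>z\<rfloor>}" using ab(2,3) by (auto intro: le_nat_floor)
    have q2: "q \<ge> 2" using prime_ge_2_nat[OF ab(4)] .
    have rough: "n \<in> rough_part A Q" if "a \<in> A" "Q < real q" for A Q
    proof -
      have "Q < real p" if "prime p" "p dvd b" for p
        using ab(8)[OF that] \<open>Q < real q\<close> by simp
      then show ?thesis using n ab(1) that unfolding rough_part_def by blast
    qed
    consider "real q > sqrt z" | "real q \<le> sqrt z" "real a \<le> sqrt z"
      | "real a > sqrt z" "real q \<le> ln z" | "real q \<le> sqrt z" "real a > sqrt z" "real q > ln z"
      by linarith
    then show ?thesis
    proof cases
      case 1
      \<comment> \<open>The primes of \<open>b\<close> exceed y^(1/6), but the sieve bound is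
        available only up to y^(1/9).\<close>
      have "exp (ln y / 9) \<le> sqrt z" using ln_y_pos by (simp add: sqrt_z)
      then have "n \<in> rough_part {1..nat \<lfloor>z\<rfloor>} (exp (ln y / 9))" using a 1 by (intro rough) auto
      then show ?thesis by blast
    next
      case 2
      \<comment> \<open>Since \<open>a * q ^ e\<close> exceeds \<open>z\<close> and \<open>a\<close>
        is at most its square root, the prime power must exceed that square root.\<close>
      have "sqrt z * sqrt z < sqrt z * real (q ^ e)"
      proof -
        have "sqrt z * sqrt z = z" using z_ge_1 by simp
        also have "\<dots> < real a * real (q ^ e)" using ab(6) by simp
        also have "\<dots> \<le> sqrt z * real (q ^ e)" using 2 by (intro mult_right_mono) auto
        finally show ?thesis .
      qed
      moreover have "sqrt z > 0" using z_ge_1 by simp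
      ultimately have "sqrt z < real (q ^ e)" by (simp only: mult_less_cancel_left_pos)
      moreover have "q ^ e dvd n" using ab(1,5) by simp
      ultimately have "n \<in> power_part" using n q2 2 unfolding power_part_def by blast
      then show ?thesis by blast
    next
      case 3
      have "real p \<le> ln z" if "prime p" "p dvd a" for p using ab(7)[OF that] 3 by simp
      moreover have "a dvd n" using ab(1) by simp
      ultimately have "n \<in> smooth_part" using n a 3 unfolding smooth_part_def by blast
      then show ?thesis by blast
    next
      case 4
      \<comment> \<open>The integer with z^(1/(r+1)) < q \<le> z^(1/r): the upper bound makes
        \<open>a\<close> smooth, the lower one makes \<open>b\<close> rough.\<close>
      define r where "r = nat \<lfloor>ln z / ln (real q)\<rfloor>"
      have z_big: "ln z \<ge> 10" using ln_y by (simp add: ln_z)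
      have lnq: "ln (real q) > 0" using q2 by simp
      have "ln (real q) \<le> ln (sqrt z)" using 4 q2 z_ge_1 by (subst ln_le_cancel_iff) auto
      then have two: "2 \<le> ln z / ln (real q)" using lnq by (simp add: sqrt_z ln_z field_simps)
      have r: "2 \<le> r" "real r \<le> ln z / ln (real q)" "ln z / ln (real q) < real r + 1"
        using two by (auto simp: r_def le_nat_iff le_floor_iff)
      have r_lnq: "real r * ln (real q) \<le> ln z" using r lnq by (simp add: field_simps)
      have "exp 1 \<le> (3 :: real)" using e_less_272 by simp
      then have "exp 1 \<le> real q" using 4 z_big by linarith
      then have lnq1: "ln (real q) \<ge> 1" using q2 by (subst ln_ge_iff) auto
      \<comment> \<open>Here \<open>r \<le> ln z < q\<close>, so r ln r \<le> r ln q \<le> ln z and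
        \<open>r\<close> is a level; this is why small \<open>q\<close> were treated
        separately.\<close>
      have "ln z / ln (real q) \<le> ln z / 1" using lnq1 z_big by (intro divide_left_mono) auto
      then have "real r \<le> real q" using r(2) 4 by simp
      then have "ln (real r) \<le> ln (real q)" using r q2 by (subst ln_le_cancel_iff) auto
      then have "real r * ln (real r) \<le> real r * ln (real q)" by (intro mult_left_mono) auto
      also note r_lnq
      finally have lev: "r \<in> levels" using r by (simp add: levels_def)
      have "ln (real q) \<le> ln z / real r" using r_lnq r by (simp add: field_simps)
      then have "exp (ln (real q)) \<le> exp (ln z / real r)" by (simp only: exp_le_cancel_iff)
      then have qv: "real q \<le> exp (ln z / real r)" using q2 by simp
      have "real p \<le> exp (ln z / real r)" if "prime p" "p dvd a" for p using ab(7)[OF that] qv by simp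
      then have sm: "a \<in> smooth_prefixes r" using a 4 unfolding smooth_prefixes_def by blast
      have "ln z / (real r + 1) < ln (real q)" using r(3) lnq by (simp add: field_simps)
      then have "exp (ln z / (real r + 1)) < exp (ln (real q))" by (simp only: exp_less_cancel_iff)
      then have "exp (ln y / (3 * (real r + 1))) < real q" using q2 by (simp add: ln_z)
      with sm have "n \<in> rough_part (smooth_prefixes r) (exp (ln y / (3 * (real r + 1))))" by (rule rough)
      then show ?thesis using lev by blast
    qed
  qed (use n in blast)
qed

lemma interval_sum_le:
  "(\<Sum>n | 1 \<le> n \<and> x - y < real n \<and> real n \<le> x. f n) \<le> Lambda_const k l * (y / ln x) * F"
proof -
  define S0 where "S0 = {n. x - y < real n \<and> real n \<le> x \<and> real n \<le> z}"
  define S1 where "S1 = rough_part {1..nat \<lfloor>z\<rfloor>} (exp (ln y / 9))"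
  define S2 where "S2 = power_part \<union> smooth_part"
  define T where "T r = rough_part (smooth_prefixes r) (exp (ln y / (3 * (real r + 1))))" for r
  have fin_levels: "finite levels"
  proof (rule finite_subset)
    show "levels \<subseteq> {..nat \<lfloor>ln z / ln 2\<rfloor>}"
    proof
      fix r assume r: "r \<in> levels"
      then have "real r * ln 2 \<le> real r * ln (real r)"
        by (intro mult_left_mono) (auto simp: levels_def)
      also have "\<dots> \<le> ln z" using r by (simp add: levels_def)
      finally have "real r \<le> ln z / ln 2" by (simp add: field_simps)
      then show "r \<in> {..nat \<lfloor>ln z / ln 2\<rfloor>}" by (auto intro: le_nat_floor)
    qed
  qed simp
  have fin: "finite S0" "finite S1" "finite power_part" "finite smooth_part" "finite (T r)" for r
    unfolding S0_def S1_def power_part_def smooth_part_def T_def rough_part_def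
    by (rule finite_subset[OF _ finite_Ioc_nat[of "x - y" x]]; blast)+
  have in_interval: "x - y < real n" if "n \<in> S0 \<union> S1 \<union> power_part \<union> smooth_part \<union> T r" for n r
    using that by (auto simp: S0_def S1_def power_part_def smooth_part_def T_def rough_part_def)
  have pos: "f n \<ge> 0" if "n \<in> S0 \<union> S1 \<union> power_part \<union> smooth_part \<union> T r" for n r
    using in_interval[OF that] interval_pos nonneg by blast
  have finU: "finite (\<Union>r\<in>levels. T r)" using fin_levels fin by blast
  have "(\<Sum>n | 1 \<le> n \<and> x - y < real n \<and> real n \<le> x. f n)
      \<le> sum f (S0 \<union> S1 \<union> (power_part \<union> smooth_part) \<union> (\<Union>r\<in>levels. T r))"
    using interval_cover pos fin finU unfolding S0_def S1_def T_def
    by (intro sum_mono2) blast+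
  also have "\<dots> \<le> sum f (S0 \<union> S1 \<union> (power_part \<union> smooth_part)) + sum f (\<Union>r\<in>levels. T r)"
    using fin finU pos by (intro sum_Un_nonneg_le) blast+
  also have "\<dots> \<le> (sum f S0 + sum f S1 + (sum f power_part + sum f smooth_part)) + (\<Sum>r\<in>levels. sum f (T r))"
  proof (intro add_mono)
    have "sum f (S0 \<union> S1 \<union> (power_part \<union> smooth_part)) \<le> sum f (S0 \<union> S1) + sum f (power_part \<union> smooth_part)"
      using fin pos by (intro sum_Un_nonneg_le) blast+
    moreover have "sum f (S0 \<union> S1) \<le> sum f S0 + sum f S1"
      using fin pos by (intro sum_Un_nonneg_le) blast+
    moreover have "sum f (power_part \<union> smooth_part) \<le> sum f power_part + sum f smooth_part"
      using fin pos by (intro sum_Un_nonneg_le) blast+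
    ultimately show "sum f (S0 \<union> S1 \<union> (power_part \<union> smooth_part))
        \<le> sum f S0 + sum f S1 + (sum f power_part + sum f smooth_part)" by linarith
    show "sum f (\<Union>r\<in>levels. T r) \<le> (\<Sum>r\<in>levels. sum f (T r))"
      using fin_levels fin pos by (intro sum_UN_nonneg_le) blast+
  qed
  also have "\<dots> \<le> ((y / ln x) * F + 27 * l * real k powr (9 * l) * ((y / ln x) * F) + C_const k l * ((y / ln x) * F))
      + (\<Sum>r\<in>levels. 9 * l * ((y / ln x) * F) * level_term l r)"
  proof (intro add_mono sum_mono)
    show "sum f S0 \<le> (y / ln x) * F" unfolding S0_def by (rule small_sum_le)
    have "ln 2 \<le> (1 :: real)" using ln2_le_25_over_36 by simp
    then have "ln 2 \<le> ln y / 9" using ln_y by simp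
    then have "sum f S1 \<le> real k powr (l * 9) * (3 * l * 9 * (y / ln x)) * (\<Sum>a\<in>{1..nat \<lfloor>z\<rfloor>}. f a / real a)"
      unfolding S1_def by (intro rough_part_sum_le) auto
    also have "\<dots> \<le> real k powr (l * 9) * (3 * l * 9 * (y / ln x)) * F"
      using l y_pos ln_x_pos nat_floor_z_le_x by (intro mult_left_mono sum_le_F) auto
    finally show "sum f S1 \<le> 27 * l * real k powr (9 * l) * ((y / ln x) * F)" by (simp add: mult_ac)
    show "sum f power_part + sum f smooth_part \<le> C_const k l * ((y / ln x) * F)"
      using exceptional_sum_le by (simp add: mult.assoc)
    show "sum f (T r) \<le> 9 * l * ((y / ln x) * F) * level_term l r" if "r \<in> levels" for r
      using level_sum_le[OF that] by (simp add: T_def mult_ac)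
  qed
  also have "\<dots> = (1 + 27 * l * real k powr (9 * l) + C_const k l + 9 * l * (\<Sum>r\<in>levels. level_term l r))
      * ((y / ln x) * F)"
    unfolding sum_distrib_left[symmetric] by (simp only: distrib_left distrib_right mult_1 mult_ac)
  also have "\<dots> \<le> Lambda_const k l * ((y / ln x) * F)"
    using y_pos ln_x_pos F_nonneg fin_levels
    by (intro mult_right_mono constants_le_Lambda l) (auto simp: levels_def)
  finally show ?thesis by (simp add: mult.assoc)
qed

end

theorem mainTheorem1:
  fixes l :: real and f :: "nat \<Rightarrow> real" and k :: nat
  assumes "l \<ge> 1"
    and "\<And>n. n \<ge> 1 \<Longrightarrow> f n \<ge> 0"
    and "k \<ge> 1"
    and "\<And>m n. m \<ge> 1 \<Longrightarrow> n \<ge> 1 \<Longrightarrow> f (m * n) \<le> real (tau k m) * f n"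
  shows "\<forall>x y :: real. x \<ge> exp (7 ^ 28 * (12 * exp 1 * l) powr (28 * ln (192 * exp 1 * l)))
      \<and> x powr (1 / l) \<le> y \<and> y \<le> x \<longrightarrow>
      (\<Sum>n\<in>{n. 1 \<le> n \<and> x - y < real n \<and> real n \<le> x}. f n)
        \<le> Lambda_const k l * (y / ln x) * (\<Sum>n\<in>{n. 1 \<le> n \<and> real n \<le> x}. f n / real n)"
proof (intro allI impI, elim conjE)
  fix x y :: real
  assume x: "x \<ge> exp (7 ^ 28 * (12 * exp 1 * l) powr (28 * ln (192 * exp 1 * l)))"
    and y: "x powr (1 / l) \<le> y" "y \<le> x"
  have "x > 0" using x by (meson exp_gt_zero less_le_trans)
  then have "x powr (1 / l) > 0" by simp
  then have y_pos: "y > 0" using y(1) by (rule less_le_trans)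
  interpret short_interval f k l x y
    by unfold_locales (use assms y y_pos large_x_bounds[OF assms(1) x y(1)] in auto)
  have "{n :: nat. 1 \<le> n \<and> real n \<le> x} = {1..nat \<lfloor>x\<rfloor>}"
    using x_ge_1 by (auto simp: le_nat_iff le_floor_iff)
  then have F_eq: "(\<Sum>n\<in>{n. 1 \<le> n \<and> real n \<le> x}. f n / real n) = F" by (simp add: F_def)
  show "(\<Sum>n\<in>{n. 1 \<le> n \<and> x - y < real n \<and> real n \<le> x}. f n)
      \<le> Lambda_const k l * (y / ln x) * (\<Sum>n\<in>{n. 1 \<le> n \<and> real n \<le> x}. f n / real n)"
    unfolding F_eq by (rule interval_sum_le)
qed

end
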